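(* Suppose $(X,d,\mu)$ is a doubling metric measure space satisfying a strong $(1,\Phi)$-Orlicz--Poincaré inequality. Then there is $q\in[1,\infty)$ such that $(X,d,\mu)$ satisfies a $(1,q)$-Poincaré inequality.
   Context: Standing assumptions: metric measure spaces $(X,d,\mu)$ are complete and separable, $\mu$ is a Radon measure, and $0<\mu(B(x,r))<\infty$ for all open balls. $f_B=\frac{1}{\mu(B)}\int_Bf\,d\mu$. Doubling: there is $D$ such that $\mu(B(x,2r))\le D\,\mu(B(x,r))$ for all $x\in X$, $r>0$. Upper gradient: a non-negative Borel function $g$ is an upper gradient of $u$ if $|u(\gamma(0))-u(\gamma(L))|\le\int_\gamma g\,ds$ for every rectifiable curve $\gamma:[0,L]\to X$. Strong $(1,\Phi)$-Orlicz--Poincaré inequality: here $\Phi:[0,\infty)\to[0,\infty)$ is a strictly increasing Young function (convex, $\Phi(0)=0$), and there are constants $C_\Phi>0$, $\tau\ge1$ such that for every ball $B(x,r)$, every locally integrable $u$ on $X$ and every upper gradient $g$ of $u$, $$\frac1{\mu(B(x,r))}\int_{B(x,r)}|u-u_{B(x,r)}|\,d\mu\le C_\Phi\,r\,\Phi^{-1}\left(\frac1{\mu(B(x,\tau r))}\int_{B(x,\tau r)}\Phi(g)\,d\mu\right).$$ $(1,q)$-Poincaré inequality: with $\mathrm{lip} f(x)=\liminf_{r\to0}\sup_{y\in B(x,r)}|f(x)-f(y)|/r$, there are $C,C_{PI}>0$ such that for all $x\in X$, $r>0$ and Lipschitz $f:X\to\mathbb{R}$, $$\frac{1}{\mu(B(x,r))}\int_{B(x,r)}|f-f_{B(x,r)}|\,d\mu\le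 C_{PI}\,r\left(\frac{1}{\mu(B(x,Cr))}\int_{B(x,Cr)}(\mathrm{lip} f)^q\,d\mu\right)^{1/q}.$$ *)

theory Defs
  imports "HOL-Analysis.Analysis"
begin

text \<open>
  A complete separable metric space is a type of class \<open>polish_space\<close>; \<open>ball x r\<close> is the open ball.
  Measures live on the Borel sigma-algebra. Mean values and integrals of non-negative functions are
  taken in \<open>ennreal\<close>.
\<close>

definition radon_measure :: "'a::metric_space measure \<Rightarrow> bool" where
  "radon_measure \<mu> \<longleftrightarrow>
     sets \<mu> = sets borel \<and>
     (\<forall>x. \<exists>r>0. emeasure \<mu> (ball x r) < \<infinity>) \<and>
     (\<forall>A\<in>sets borel. emeasure \<mu> A = (SUP K\<in>{K. compact K \<and> K \<subseteq> A}. emeasure \<mu> K))"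

definition metric_measure_space :: "'a::polish_space measure \<Rightarrow> bool" where
  "metric_measure_space \<mu> \<longleftrightarrow>
     radon_measure \<mu> \<and>
     (\<forall>x r. 0 < r \<longrightarrow> 0 < emeasure \<mu> (ball x r) \<and> emeasure \<mu> (ball x r) < \<infinity>)"

definition doubling :: "'a::metric_space measure \<Rightarrow> bool" where
  "doubling \<mu> \<longleftrightarrow>
     (\<exists>D::real. \<forall>x r. 0 < r \<longrightarrow> emeasure \<mu> (ball x (2 * r)) \<le> ennreal D * emeasure \<mu> (ball x r))"

definition average :: "'a measure \<Rightarrow> 'a set \<Rightarrow> ('a \<Rightarrow> real) \<Rightarrow> real" where
  "average \<mu> B f = (LINT x:B|\<mu>. f x) / measure \<mu> B"

definition nn_average :: "'a measure \<Rightarrow> 'a set \<Rightarrow> ('a \<Rightarrow> ennreal) \<Rightarrow> ennreal" where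
  "nn_average \<mu> B g = (\<integral>\<^sup>+x\<in>B. g x \<partial>\<mu>) / emeasure \<mu> B"

definition mean_oscillation :: "'a measure \<Rightarrow> 'a set \<Rightarrow> ('a \<Rightarrow> real) \<Rightarrow> ennreal" where
  "mean_oscillation \<mu> B u = nn_average \<mu> B (\<lambda>x. ennreal \<bar>u x - average \<mu> B u\<bar>)"

definition locally_integrable :: "'a::metric_space measure \<Rightarrow> ('a \<Rightarrow> real) \<Rightarrow> bool" where
  "locally_integrable \<mu> u \<longleftrightarrow> (\<forall>x. \<exists>r>0. set_integrable \<mu> (ball x r) u)"

text \<open>
  The length of \<open>\<gamma>\<close> on \<open>{a..b}\<close> is the supremum over finite monotone chains of points of \<open>{a..b}\<close>.
\<close>

definition curve_length :: "real \<Rightarrow> real \<Rightarrow> (real \<Rightarrow> 'a::metric_space) \<Rightarrow> ennreal" where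
  "curve_length a b \<gamma> =
     (SUP ts\<in>{ts. sorted ts \<and> set ts \<subseteq> {a..b}}.
        \<Sum>i<length ts - 1. ennreal (dist (\<gamma> (ts ! i)) (\<gamma> (ts ! Suc i))))"

definition rectifiable_curve :: "real \<Rightarrow> (real \<Rightarrow> 'a::metric_space) \<Rightarrow> bool" where
  "rectifiable_curve L \<gamma> \<longleftrightarrow> 0 \<le> L \<and> continuous_on {0..L} \<gamma> \<and> curve_length 0 L \<gamma> < \<infinity>"

text \<open>
  Arc-length parametrization of a rectifiable \<open>\<gamma>\<close> on \<open>{0..L}\<close>: the point reached once length \<open>s\<close>
  has been traversed. The choice of the parameter \<open>t\<close> is immaterial, since \<open>\<gamma>\<close> is constant between
  any two parameters at which the traversed length agrees.
\<close>

definition arclength_param :: "real \<Rightarrow> (real \<Rightarrow> 'a::metric_space) \<Rightarrow> real \<Rightarrow> 'a" where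
  "arclength_param L \<gamma> s = \<gamma> (SOME t. t \<in> {0..L} \<and> curve_length 0 t \<gamma> = ennreal s)"

definition curve_integral :: "real \<Rightarrow> (real \<Rightarrow> 'a::metric_space) \<Rightarrow> ('a \<Rightarrow> ennreal) \<Rightarrow> ennreal" where
  "curve_integral L \<gamma> g =
     (\<integral>\<^sup>+s\<in>{0..enn2real (curve_length 0 L \<gamma>)}. g (arclength_param L \<gamma> s) \<partial>lborel)"

text \<open>As usual, upper gradients may take the value \<open>\<infinity>\<close>.\<close>

definition upper_gradient :: "('a::metric_space \<Rightarrow> real) \<Rightarrow> ('a \<Rightarrow> ennreal) \<Rightarrow> bool" where
  "upper_gradient u g \<longleftrightarrow>
     g \<in> borel_measurable borel \<and>
     (\<forall>L \<gamma>. rectifiable_curve L \<gamma> \<longrightarrow> ennreal \<bar>u (\<gamma> 0) - u (\<gamma> L)\<bar> \<le> curve_integral L \<gamma> g)"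

definition strict_young_function :: "(real \<Rightarrow> real) \<Rightarrow> bool" where
  "strict_young_function \<Phi> \<longleftrightarrow>
     \<Phi> \<in> {0..} \<rightarrow> {0..} \<and> strict_mono_on {0..} \<Phi> \<and> convex_on {0..} \<Phi> \<and> \<Phi> 0 = 0"

text \<open>
  Extension of a function on \<open>{0..}\<close> by \<open>\<infinity> \<mapsto> \<infinity>\<close>. It is only applied to increasing bijections of
  \<open>{0..}\<close>; a strictly increasing Young function is one.
\<close>

definition extend_infty :: "(real \<Rightarrow> real) \<Rightarrow> ennreal \<Rightarrow> ennreal" where
  "extend_infty \<phi> t = (if t = \<infinity> then \<infinity> else ennreal (\<phi> (enn2real t)))"

definition strong_orlicz_poincare :: "'a::metric_space measure \<Rightarrow> (real \<Rightarrow> real) \<Rightarrow> bool" where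
  "strong_orlicz_poincare \<mu> \<Phi> \<longleftrightarrow>
     (\<exists>C>0. \<exists>\<tau>\<ge>1. \<forall>x r u g. 0 < r \<longrightarrow> locally_integrable \<mu> u \<longrightarrow> upper_gradient u g \<longrightarrow>
        mean_oscillation \<mu> (ball x r) u
          \<le> ennreal (C * r) *
             extend_infty (the_inv_into {0..} \<Phi>)
               (nn_average \<mu> (ball x (\<tau> * r)) (\<lambda>y. extend_infty \<Phi> (g y))))"

definition lower_lip :: "('a::metric_space \<Rightarrow> real) \<Rightarrow> 'a \<Rightarrow> ennreal" where
  "lower_lip f x = Liminf (at_right 0) (\<lambda>r. SUP y\<in>ball x r. ennreal (\<bar>f x - f y\<bar> / r))"

definition poincare :: "'a::metric_space measure \<Rightarrow> real \<Rightarrow> bool" where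
  "poincare \<mu> q \<longleftrightarrow>
     (\<exists>C>0. \<exists>C_PI>0. \<forall>x r f. 0 < r \<longrightarrow> (\<exists>K. K-lipschitz_on UNIV f) \<longrightarrow>
        mean_oscillation \<mu> (ball x r) f
          \<le> ennreal (C_PI * r) *
             extend_infty (\<lambda>t. t powr (1 / q))
               (nn_average \<mu> (ball x (C * r)) (\<lambda>y. extend_infty (\<lambda>t. t powr q) (lower_lip f y))))"

end

theory Submission
  imports Defs
begin

text \<open>
  The heart of the proof is a pointwise (Hajlasz type) estimate. For a function \<open>g\<close> that controls the
  variation of a Lipschitz function \<open>f\<close> along curves, write \<open>M (g\<^sup>q)\<close> for the uncentred maximal function
  of \<open>g\<^sup>q\<close>. If \<open>q\<close> is large then
    \<open>\<bar>f x - f y\<bar> \<le> \<Lambda> * c * dist x y\<close> whenever \<open>M (g\<^sup>q) x \<le> c\<^sup>q\<close> and \<open>M (g\<^sup>q) y \<le> c\<^sup>q\<close>,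
  with \<open>\<Lambda>\<close> and \<open>q\<close> depending only on the space and on \<open>\<Phi>\<close>.

  The difficulty is that \<open>\<Phi>\<close> may grow arbitrarily fast, so that the Orlicz-Poincare inequality says
  little about a given large \<open>g\<close>. It is strong, however, for a function whose upper gradient is at most \<open>1\<close> off
  a set \<open>E\<close> and at most a fixed number \<open>\<Lambda>\<close> on \<open>E\<close>: if \<open>E\<close> has density at most \<open>1 / \<Phi> \<Lambda>\<close> in all balls around a
  point, then all \<open>\<Phi>\<close>-means there are at most \<open>\<Phi> 1 + 1\<close>, and the resulting Lipschitz bound
  between two such points does not depend on \<open>\<Lambda>\<close>. The pointwise estimate reduces to this case by improving
  the constant in it again and again (\<open>hajlasz_constant_halving\<close>). Suppose that it holds with
  \<open>A \<ge> \<Lambda>\<close> in place of \<open>\<Lambda>\<close>. Let \<open>E\<close> be the set where \<open>M (g\<^sup>q)\<close> exceeds \<open>(2 c)\<^sup>q\<close>. Off \<open>E\<close> the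
  function \<open>f\<close> is Lipschitz with constant \<open>2 A c\<close>; let \<open>u\<close> extend this restriction to the whole space with the
  same constant. The variation of \<open>u\<close> is controlled by \<open>g \<le> 2 c\<close> off \<open>E\<close> and by \<open>2 A c\<close> on \<open>E\<close>. Multiplied by
  \<open>\<Lambda> / (2 A c)\<close> it is of the special kind above, because \<open>E\<close> has density at most \<open>D\<^sup>4 / 2\<^sup>q\<close> around
  points with \<open>M (g\<^sup>q) \<le> c\<^sup>q\<close> (\<open>density_maximal_superlevel\<close>). As \<open>\<Lambda>\<close> is chosen large compared
  with the Lipschitz bound just mentioned, the estimate for \<open>u\<close>, hence for \<open>f\<close>, holds with \<open>A / 2\<close> in
  place of \<open>A\<close>. Since \<open>f\<close> is Lipschitz, the estimate holds with some finite constant as long as \<open>c\<close> is bounded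
  below, and halving this constant finitely often brings it down to \<open>\<Lambda>\<close> (\<open>hajlasz_estimate\<close>).

  A truncation of \<open>f\<close> that is constant outside a large ball localises the estimate
  (\<open>local_hajlasz_estimate\<close>), and summing over the dyadic levels of the maximal function turns it
  into the \<open>(1, q)\<close>-Poincare inequality (\<open>mean_oscillation_le_majorant\<close>).

  The replacement of \<open>f\<close> by \<open>u\<close> requires that upper gradients may be glued along a Borel set. For this
  the variation along curves is controlled by the condition \<open>variation_dominated\<close>,
  which bounds the outer measure of the image of every Borel set of parameters of finite measure rather than
  the oscillation on intervals. For this condition gluing is trivial; a Vitali covering
  argument shows that the lower Lipschitz constant of \<open>f\<close> satisfies it, and reparametrisation by arc length
  turns it into the upper gradient inequality.
\<close>

section \<open>Stretching of Lipschitz images on the line\<close>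

lemma outer_measure_of_UN_le:
  fixes A :: "nat \<Rightarrow> 'a set"
  assumes "\<And>i. A i \<subseteq> space M"
  shows "outer_measure_of M (\<Union>i. A i) \<le> (\<Sum>i. outer_measure_of M (A i))"
proof -
  have "\<forall>i. \<exists>E. E \<in> sets M \<and> A i \<subseteq> E \<and> outer_measure_of M (A i) = emeasure M E"
    using outer_measure_of_attain[OF assms] by blast
  then obtain E where E: "\<And>i. E i \<in> sets M" "\<And>i. A i \<subseteq> E i"
      "\<And>i. outer_measure_of M (A i) = emeasure M (E i)"
    by metis
  have "outer_measure_of M (\<Union>i. A i) \<le> outer_measure_of M (\<Union>i. E i)"
    using E(2) by (intro outer_measure_of_mono) blast
  also have "\<dots> = emeasure M (\<Union>i. E i)"
    using E(1) by (intro outer_measure_of_eq) blast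
  also have "\<dots> \<le> (\<Sum>i. emeasure M (E i))"
    using E(1) by (intro emeasure_subadditive_countably) auto
  finally show ?thesis
    by (simp add: E(3))
qed

lemma outer_measure_of_Un_le:
  assumes "A \<subseteq> space M" "B \<subseteq> space M"
  shows "outer_measure_of M (A \<union> B) \<le> outer_measure_of M A + outer_measure_of M B"
proof -
  obtain E where E: "E \<in> sets M" "A \<subseteq> E" "outer_measure_of M A = emeasure M E"
    using outer_measure_of_attain[OF assms(1)] by blast
  obtain F where F: "F \<in> sets M" "B \<subseteq> F" "outer_measure_of M B = emeasure M F"
    using outer_measure_of_attain[OF assms(2)] by blast
  have "outer_measure_of M (A \<union> B) \<le> outer_measure_of M (E \<union> F)"
    using E F by (intro outer_measure_of_mono) auto
  also have "\<dots> = emeasure M (E \<union> F)"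
    using E F by simp
  also have "\<dots> \<le> emeasure M E + emeasure M F"
    using E F by (intro emeasure_subadditive) auto
  finally show ?thesis
    using E F by simp
qed

lemma outer_measure_lborel_negligible:
  fixes A :: "real set"
  assumes "negligible A"
  shows "outer_measure_of lborel A = 0"
proof -
  have "A \<in> null_sets lebesgue"
    using assms by (simp add: negligible_iff_null_sets)
  then obtain N where N: "N \<in> null_sets lborel" "A \<subseteq> N"
    by (auto simp: null_sets_completion_iff2)
  then have "outer_measure_of lborel A \<le> outer_measure_of lborel N"
    by (intro outer_measure_of_mono)
  also have "\<dots> = 0"
    using N(1) by (simp add: null_sets_def)
  finally show ?thesis
    by simp
qed

text \<open>
  If \<open>v\<close> stretches by at most \<open>c\<close> at arbitrarily small scales around every point of \<open>S\<close>, then the small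
  intervals on which it does so form a Vitali cover of \<open>S\<close>. Disjoint ones cover almost all of \<open>S\<close>, the
  rest has a null image because \<open>v\<close> is Lipschitz, and each chosen interval has an image of at most \<open>c\<close>
  times its length. The scales may depend on the point and need not include all small ones, which is what
  the lower limit in the definition of \<open>lower_lip\<close> provides.
\<close>

lemma outer_measure_lipschitz_image_le:
  fixes v :: "real \<Rightarrow> real"
  assumes v: "N-lipschitz_on UNIV v"
    and c: "0 \<le> c"
    and S: "S \<in> sets borel"
    and scales: "\<And>s d. s \<in> S \<Longrightarrow> 0 < d \<Longrightarrow>
      \<exists>r>0. r < d \<and> (\<forall>s'\<in>cball s r. \<bar>v s' - v s\<bar> \<le> c * r)"
  shows "outer_measure_of lborel (v ` S) \<le> ennreal c * emeasure lborel S"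
proof (cases "emeasure lborel S = \<infinity> \<and> c > 0")
  case True
  then show ?thesis by (simp add: ennreal_mult_top)
next
  case False
  have approx: "outer_measure_of lborel (v ` S) \<le> ennreal c * emeasure lborel S + ennreal e" if "e > 0" for e
  proof -
    \<comment> \<open>The denominator \<open>c + 1\<close> is positive also for \<open>c = 0\<close>.\<close>
    define e' where "e' = e / (c + 1)"
    have e': "e' > 0" "c * e' \<le> e"
      using that c by (auto simp: e'_def field_simps)
    obtain V where V: "open V" "S \<subseteq> V" "emeasure lborel (V - S) < e'"
      using outer_regular_lborel[OF S e'(1)] .
    define K where "K = {i. fst i \<in> S \<and> 0 < snd i \<and> cball (fst i) (snd i) \<subseteq> V
      \<and> (\<forall>s'\<in>cball (fst i) (snd i). \<bar>v s' - v (fst i)\<bar> \<le> c * snd i)}"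
    have fine: "\<exists>i. i \<in> K \<and> x \<in> cball (fst i) (snd i) \<and> snd i < d" if "x \<in> S" "0 < d" for x d
    proof -
      obtain h where h: "h > 0" "cball x h \<subseteq> V"
        using V \<open>x \<in> S\<close> open_contains_cball by blast
      obtain r where "r > 0" "r < min d h" "\<forall>s'\<in>cball x r. \<bar>v s' - v x\<bar> \<le> c * r"
        using scales[OF \<open>x \<in> S\<close>, of "min d h"] \<open>d > 0\<close> h(1) by auto
      moreover then have "cball x r \<subseteq> V"
        using h(2) by auto
      ultimately have "(x, r) \<in> K"
        using \<open>x \<in> S\<close> by (auto simp: K_def)
      then show ?thesis
        using \<open>r > 0\<close> \<open>r < min d h\<close> by (intro exI[of _ "(x, r)"]) auto
    qed
    have Kpos: "\<And>i. i \<in> K \<Longrightarrow> 0 < snd i"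
      by (auto simp: K_def)
    obtain C where C: "countable C" "C \<subseteq> K"
      "pairwise (\<lambda>i j. disjnt (cball (fst i) (snd i)) (cball (fst j) (snd j))) C"
      "negligible (S - (\<Union>i\<in>C. cball (fst i) (snd i)))"
      by (rule Vitali_covering_theorem_cballs[of K snd S fst, OF Kpos fine])
    \<comment> \<open>The chosen intervals and the intervals that contain their images, indexed by natural numbers.\<close>
    define B where "B n = (if n \<in> to_nat_on C ` C
        then cball (fst (from_nat_into C n)) (snd (from_nat_into C n)) else {})" for n
    define T where "T n = (if n \<in> to_nat_on C ` C
        then cball (v (fst (from_nat_into C n))) (c * snd (from_nat_into C n)) else {})" for n
    have UB: "(\<Union>n. B n) = (\<Union>i\<in>C. cball (fst i) (snd i))"
      using C(1) by (auto simp: B_def split: if_splits)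
    have BC: "cball (fst i) (snd i) \<subseteq> V" if "i \<in> C" for i
      using that C(2) unfolding K_def by blast
    have disj: "disjoint_family B"
    proof (unfold disjoint_family_on_def, intro ballI impI)
      fix m n :: nat assume "m \<noteq> n"
      show "B m \<inter> B n = {}"
      proof (cases "m \<in> to_nat_on C ` C \<and> n \<in> to_nat_on C ` C")
        case True
        then obtain i j where ij: "i \<in> C" "m = to_nat_on C i" "j \<in> C" "n = to_nat_on C j"
          by blast
        with \<open>m \<noteq> n\<close> have "i \<noteq> j" by auto
        then have "disjnt (cball (fst i) (snd i)) (cball (fst j) (snd j))"
          using C(3) ij by (auto simp: pairwise_def)
        then show ?thesis
          using ij C(1) by (simp add: B_def disjnt_def)
      qed (auto simp: B_def)
    qed
    have TB: "emeasure lborel (T n) = ennreal c * emeasure lborel (B n)" for n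
    proof (cases "n \<in> to_nat_on C ` C")
      case True
      then obtain i where i: "i \<in> C" "n = to_nat_on C i" by blast
      then have "snd i > 0" using C(2) Kpos by blast
      then show ?thesis
        using i C(1) c by (simp add: T_def B_def cball_eq_atLeastAtMost ennreal_mult[symmetric] algebra_simps)
    qed (simp add: T_def B_def)
    have "v ` S \<subseteq> v ` (S - (\<Union>n. B n)) \<union> (\<Union>n. T n)"
    proof
      fix y assume "y \<in> v ` S"
      then obtain s where s: "s \<in> S" "y = v s" by blast
      show "y \<in> v ` (S - (\<Union>n. B n)) \<union> (\<Union>n. T n)"
      proof (cases "s \<in> (\<Union>n. B n)")
        case True
        then obtain i where i: "i \<in> C" "s \<in> cball (fst i) (snd i)"
          unfolding UB by blast
        then have "\<bar>v s - v (fst i)\<bar> \<le> c * snd i"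
          using C(2) by (auto simp: K_def)
        then have "y \<in> T (to_nat_on C i)"
          using i C(1) s by (auto simp: T_def dist_real_def abs_minus_commute)
        then show ?thesis by blast
      qed (use s in blast)
    qed
    then have "outer_measure_of lborel (v ` S)
        \<le> outer_measure_of lborel (v ` (S - (\<Union>n. B n)) \<union> (\<Union>n. T n))"
      by (rule outer_measure_of_mono)
    also have "\<dots> \<le> outer_measure_of lborel (v ` (S - (\<Union>n. B n))) + outer_measure_of lborel (\<Union>n. T n)"
      by (rule outer_measure_of_Un_le) auto
    also have "negligible (v ` (S - (\<Union>n. B n)))"
    proof (rule negligible_locally_Lipschitz_image)
      show "\<exists>T L. open T \<and> x \<in> T \<and> (\<forall>y\<in>(S - (\<Union>n. B n)) \<inter> T. norm (v y - v x) \<le> L * norm (y - x))" for x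
        using lipschitz_on_normD[OF v] by (intro exI[of _ UNIV] exI[of _ N]) auto
    qed (use C(4) UB in auto)
    then have "outer_measure_of lborel (v ` (S - (\<Union>n. B n))) = 0"
      by (rule outer_measure_lborel_negligible)
    also have "outer_measure_of lborel (\<Union>n. T n) = emeasure lborel (\<Union>n. T n)"
      by (intro outer_measure_of_eq sets.countable_UN) (auto simp: T_def)
    also have "\<dots> \<le> (\<Sum>n. emeasure lborel (T n))"
      by (intro emeasure_subadditive_countably) (auto simp: T_def)
    also have "\<dots> = ennreal c * (\<Sum>n. emeasure lborel (B n))"
      by (simp add: TB)
    also have "(\<Sum>n. emeasure lborel (B n)) = emeasure lborel (\<Union>n. B n)"
    proof (rule suminf_emeasure[OF _ disj])
      show "range B \<subseteq> sets lborel" by (auto simp: B_def)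
    qed
    also have "\<dots> \<le> emeasure lborel (S \<union> (V - S))"
      using BC V(1) S unfolding UB by (intro emeasure_mono) auto
    also have "\<dots> \<le> emeasure lborel S + emeasure lborel (V - S)"
      using V(1) S by (intro emeasure_subadditive) auto
    also have "\<dots> \<le> emeasure lborel S + ennreal e'"
      using V(3) by (intro add_left_mono) auto
    finally have "outer_measure_of lborel (v ` S) \<le> ennreal c * (emeasure lborel S + ennreal e')"
      by (simp add: mult_left_mono)
    also have "\<dots> = ennreal c * emeasure lborel S + ennreal (c * e')"
      using c e' by (simp add: distrib_left ennreal_mult)
    also have "\<dots> \<le> ennreal c * emeasure lborel S + ennreal e"
      using e' by (intro add_left_mono ennreal_leI)
    finally show ?thesis .
  qed
  show ?thesis
  proof (rule ennreal_le_epsilon)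
    fix e :: real assume "0 < e"
    then show "outer_measure_of lborel (v ` S) \<le> ennreal c * emeasure lborel S + ennreal e"
      by (rule approx)
  qed
qed

section \<open>Functions whose variation along curves is dominated\<close>

text \<open>
  A form of the upper gradient inequality for measurable sets \<open>S\<close> of parameters instead of
  intervals. It makes sense for any piece of a curve, so it can be verified separately on the two parts
  into which a Borel set of the space cuts the curve. Outer measure avoids the question whether the image
  is measurable. Curves are defined on the whole line, where an arc-length parametrisation is continued by
  constants.
\<close>

definition variation_dominated :: "('a::metric_space \<Rightarrow> real) \<Rightarrow> ('a \<Rightarrow> real) \<Rightarrow> bool" where
  "variation_dominated f g \<longleftrightarrow>
     (\<forall>\<eta> S. 1-lipschitz_on UNIV (\<eta> :: real \<Rightarrow> 'a) \<longrightarrow> S \<in> sets borel \<longrightarrow> emeasure lborel S < \<infinity> \<longrightarrow>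
        outer_measure_of lborel ((\<lambda>s. f (\<eta> s)) ` S) \<le> (\<integral>\<^sup>+s\<in>S. ennreal (g (\<eta> s)) \<partial>lborel))"

lemma variation_dominatedD:
  assumes "variation_dominated f g" "1-lipschitz_on UNIV (\<eta> :: real \<Rightarrow> 'a::metric_space)"
    "S \<in> sets borel" "emeasure lborel S < \<infinity>"
  shows "outer_measure_of lborel ((\<lambda>s. f (\<eta> s)) ` S) \<le> (\<integral>\<^sup>+s\<in>S. ennreal (g (\<eta> s)) \<partial>lborel)"
  using assms unfolding variation_dominated_def by blast

lemma lipschitz_borel_measurable:
  assumes "N-lipschitz_on UNIV (f :: 'a::metric_space \<Rightarrow> 'b::metric_space)"
  shows "f \<in> borel_measurable borel"
  using lipschitz_on_continuous_on[OF assms] by (rule borel_measurable_continuous_onI)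

text \<open>
  The lower limit gives open balls of arbitrarily small radius \<open>R\<close> on which \<open>f\<close> oscillates by strictly less than
  \<open>c * R\<close>; the closed balls needed for Vitali coverings are obtained by shrinking the radius a little.
\<close>

lemma lower_lip_less_imp_scales:
  fixes f :: "'a::metric_space \<Rightarrow> real"
  assumes "lower_lip f x < ennreal c" "0 < d"
  shows "\<exists>r>0. r < d \<and> (\<forall>y\<in>cball x r. \<bar>f y - f x\<bar> \<le> c * r)"
proof -
  define F where "F r = (SUP y\<in>ball x r. ennreal (\<bar>f x - f y\<bar> / r))" for r
  have "\<exists>\<^sub>F r in at_right 0. F r < ennreal c"
  proof (rule ccontr)
    assume "\<not> (\<exists>\<^sub>F r in at_right 0. F r < ennreal c)"
    then have "\<forall>\<^sub>F r in at_right 0. ennreal c \<le> F r"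
      by (simp add: not_frequently not_less)
    then have "ennreal c \<le> lower_lip f x"
      unfolding lower_lip_def F_def by (rule Liminf_bounded)
    with assms(1) show False by simp
  qed
  moreover have "\<forall>\<^sub>F r in at_right 0. 0 < r \<and> r < d"
    using assms(2) by (auto simp: eventually_at_right_field)
  ultimately obtain R where R: "F R < ennreal c" "0 < R" "R < d"
    using frequently_eventually_frequently frequently_ex
    by (smt (verit, best) eventually_frequently_simps(1) frequently_elim1)
  have c: "c > 0"
    using R(1) by (cases "c > 0") (auto simp: ennreal_neg)
  obtain c' where c': "F R = ennreal c'" "0 \<le> c'" "c' < c"
    using R(1) c by (cases "F R") (auto simp: ennreal_less_iff top_unique)
  have est: "\<bar>f y - f x\<bar> \<le> c' * R" if "y \<in> ball x R" for y
  proof -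
    have "ennreal (\<bar>f x - f y\<bar> / R) \<le> F R"
      unfolding F_def using that by (rule SUP_upper)
    then show ?thesis
      using c' R(2) by (simp add: field_simps abs_minus_commute)
  qed
  \<comment> \<open>Shrinking by the factor \<open>c' / c < 1\<close> is compensated by passing from \<open>c'\<close> to \<open>c\<close>; the \<open>1/2\<close> only
    keeps the radius positive when \<open>c' = 0\<close>.\<close>
  define r where "r = R * max (1/2) (c' / c)"
  have "0 < max (1/2) (c' / c)" "max (1/2) (c' / c) < 1"
    using c c' by auto
  then have r: "0 < r" "r < R"
    using R(2) by (auto simp: r_def simp del: max_less_iff_conj less_max_iff_disj)
  have "c' * R \<le> c * r"
    using c R(2) c' unfolding r_def by (simp add: field_simps max_def)
  moreover have "cball x r \<subseteq> ball x R"
    using r by auto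
  ultimately have "\<forall>y\<in>cball x r. \<bar>f y - f x\<bar> \<le> c * r"
    using est by (meson order_trans subsetD)
  then show ?thesis
    using r R(3) by (intro exI[of _ r]) auto
qed

text \<open>
  Cut \<open>S\<close> into the sets where \<open>g\<close> along the curve lies between consecutive multiples of a small \<open>\<epsilon>\<close>. On each of
  them the stretching lemma applies with a constant \<open>c\<close> that exceeds \<open>g\<close> by at most \<open>\<epsilon>\<close>, and the bounds
  add up to the integral of \<open>g\<close> with an error of \<open>\<epsilon>\<close> times the length of \<open>S\<close>.
\<close>

lemma variation_dominated_lower_lip:
  fixes f :: "'a::metric_space \<Rightarrow> real"
  assumes f: "N-lipschitz_on UNIV f"
    and g: "g \<in> borel_measurable borel" "\<And>x. 0 \<le> g x" "\<And>x. lower_lip f x \<le> ennreal (g x)"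
  shows "variation_dominated f g"
  unfolding variation_dominated_def
proof (intro allI impI)
  fix \<eta> :: "real \<Rightarrow> 'a" and S :: "real set"
  assume \<eta>: "1-lipschitz_on UNIV \<eta>" and S: "S \<in> sets borel" "emeasure lborel S < \<infinity>"
  define v where "v = (\<lambda>s. f (\<eta> s))"
  have v: "N-lipschitz_on UNIV v"
    using lipschitz_on_compose2[OF \<eta>, of N f] f lipschitz_on_subset[OF f] unfolding v_def by simp
  have g\<eta>: "(\<lambda>s. g (\<eta> s)) \<in> borel_measurable borel"
    using g(1) lipschitz_borel_measurable[OF \<eta>] by measurable
  have approx: "outer_measure_of lborel (v ` S) \<le> (\<integral>\<^sup>+s\<in>S. ennreal (g (\<eta> s)) \<partial>lborel) + ennreal e" if e: "e > 0" for e
  proof -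
    define m where "m = enn2real (emeasure lborel S)"
    have m: "emeasure lborel S = ennreal m" "m \<ge> 0"
      using S(2) by (auto simp: m_def top.not_eq_extremum)
    define \<epsilon> where "\<epsilon> = e / (m + 1)"
    have \<epsilon>: "\<epsilon> > 0" "\<epsilon> * m \<le> e"
      using e m by (auto simp: \<epsilon>_def field_simps)
    define T where "T k = {s \<in> S. \<epsilon> * real k \<le> g (\<eta> s) \<and> g (\<eta> s) < \<epsilon> * (real k + 1)}" for k
    have T: "T k \<in> sets borel" for k
      unfolding T_def using g\<eta> S by measurable
    have UT: "S = (\<Union>k. T k)"
    proof -
      have "s \<in> T (nat \<lfloor>g (\<eta> s) / \<epsilon>\<rfloor>)" if "s \<in> S" for s
      proof -
        have nn: "0 \<le> g (\<eta> s) / \<epsilon>" using g(2) \<epsilon> by simp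
        then have "real (nat \<lfloor>g (\<eta> s) / \<epsilon>\<rfloor>) = \<lfloor>g (\<eta> s) / \<epsilon>\<rfloor>" by simp
        moreover have "real_of_int \<lfloor>g (\<eta> s) / \<epsilon>\<rfloor> * \<epsilon> \<le> g (\<eta> s)"
          using \<epsilon>(1) by (metis of_int_floor_le pos_le_divide_eq)
        moreover have "g (\<eta> s) < (real_of_int \<lfloor>g (\<eta> s) / \<epsilon>\<rfloor> + 1) * \<epsilon>"
          using \<epsilon>(1) by (metis real_of_int_floor_add_one_gt pos_divide_less_eq)
        ultimately have "\<epsilon> * real (nat \<lfloor>g (\<eta> s) / \<epsilon>\<rfloor>) \<le> g (\<eta> s)"
            "g (\<eta> s) < \<epsilon> * (real (nat \<lfloor>g (\<eta> s) / \<epsilon>\<rfloor>) + 1)"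
          by (simp_all only: mult.commute)
        then show ?thesis
          using that by (simp add: T_def)
      qed
      then show ?thesis by (auto simp: T_def)
    qed
    have disj: "disjoint_family T"
      unfolding disjoint_family_on_def
    proof (intro ballI impI)
      fix i j :: nat assume "i \<noteq> j"
      have False if s: "s \<in> T i" "s \<in> T j" for s
      proof -
        have "\<epsilon> * real i < \<epsilon> * (real j + 1)" "\<epsilon> * real j < \<epsilon> * (real i + 1)"
          using s unfolding T_def by auto
        then have "real i < real j + 1" "real j < real i + 1"
          using \<epsilon>(1) by auto
        with \<open>i \<noteq> j\<close> show False by linarith
      qed
      then show "T i \<inter> T j = {}" by blast
    qed
    have each: "outer_measure_of lborel (v ` T k) \<le> (\<integral>\<^sup>+s\<in>T k. ennreal (g (\<eta> s) + \<epsilon>) \<partial>lborel)" for k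
    proof -
      have "outer_measure_of lborel (v ` T k) \<le> ennreal (\<epsilon> * (real k + 1)) * emeasure lborel (T k)"
      proof (rule outer_measure_lipschitz_image_le[OF v _ T])
        show "0 \<le> \<epsilon> * (real k + 1)" using \<epsilon> by simp
        fix s d :: real assume s: "s \<in> T k" and d: "0 < d"
        have "lower_lip f (\<eta> s) \<le> ennreal (g (\<eta> s))" by (rule g)
        also have "\<dots> < ennreal (\<epsilon> * (real k + 1))"
          using s g(2) by (auto simp: T_def intro!: ennreal_lessI intro: le_less_trans)
        finally obtain r where r: "r > 0" "r < d"
          "\<forall>y\<in>cball (\<eta> s) r. \<bar>f y - f (\<eta> s)\<bar> \<le> \<epsilon> * (real k + 1) * r"
          using lower_lip_less_imp_scales d by blast
        have "\<eta> s' \<in> cball (\<eta> s) r" if "s' \<in> cball s r" for s'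
          using lipschitz_onD[OF \<eta>, of s s'] that by auto
        then show "\<exists>r>0. r < d \<and> (\<forall>s'\<in>cball s r. \<bar>v s' - v s\<bar> \<le> \<epsilon> * (real k + 1) * r)"
          using r unfolding v_def by blast
      qed
      also have "\<dots> = (\<integral>\<^sup>+s. ennreal (\<epsilon> * (real k + 1)) * indicator (T k) s \<partial>lborel)"
        using T by (simp add: nn_integral_cmult_indicator)
      also have "\<dots> \<le> (\<integral>\<^sup>+s\<in>T k. ennreal (g (\<eta> s) + \<epsilon>) \<partial>lborel)"
      proof (intro nn_integral_mono)
        fix s
        show "ennreal (\<epsilon> * (real k + 1)) * indicator (T k) s \<le> ennreal (g (\<eta> s) + \<epsilon>) * indicator (T k) s"
        proof (cases "s \<in> T k")
          case True
          then have "\<epsilon> * (real k + 1) \<le> g (\<eta> s) + \<epsilon>"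
            by (simp add: T_def distrib_left)
          then show ?thesis
            by (intro mult_right_mono ennreal_leI) auto
        qed simp
      qed
      finally show ?thesis .
    qed
    have "outer_measure_of lborel (v ` S) \<le> (\<Sum>k. outer_measure_of lborel (v ` T k))"
      unfolding UT image_UN by (rule outer_measure_of_UN_le) auto
    also have "\<dots> \<le> (\<Sum>k. \<integral>\<^sup>+s\<in>T k. ennreal (g (\<eta> s) + \<epsilon>) \<partial>lborel)"
      by (intro suminf_le each summableI)
    also have "\<dots> = (\<integral>\<^sup>+s\<in>S. ennreal (g (\<eta> s) + \<epsilon>) \<partial>lborel)"
    proof -
      have "(\<lambda>s. ennreal (g (\<eta> s) + \<epsilon>)) \<in> borel_measurable lborel"
        using g\<eta> by simp
      then have "(\<integral>\<^sup>+s\<in>(\<Union>k. T k). ennreal (g (\<eta> s) + \<epsilon>) \<partial>lborel)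
          = (\<Sum>k. \<integral>\<^sup>+s\<in>T k. ennreal (g (\<eta> s) + \<epsilon>) \<partial>lborel)"
        by (rule nn_integral_disjoint_family) (use T disj in simp_all)
      then show ?thesis
        by (simp only: UT[symmetric])
    qed
    also have "\<dots> = (\<integral>\<^sup>+s. ennreal (g (\<eta> s)) * indicator S s + ennreal \<epsilon> * indicator S s \<partial>lborel)"
      using g(2) \<epsilon> by (intro nn_integral_cong) (auto split: split_indicator)
    also have "\<dots> = (\<integral>\<^sup>+s\<in>S. ennreal (g (\<eta> s)) \<partial>lborel) + ennreal \<epsilon> * emeasure lborel S"
      using g\<eta> S by (subst nn_integral_add) (auto simp: nn_integral_cmult_indicator)
    also have "\<dots> \<le> (\<integral>\<^sup>+s\<in>S. ennreal (g (\<eta> s)) \<partial>lborel) + ennreal e"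
    proof (intro add_left_mono)
      have "ennreal \<epsilon> * emeasure lborel S = ennreal (\<epsilon> * m)"
        using \<epsilon> m by (simp add: ennreal_mult)
      then show "ennreal \<epsilon> * emeasure lborel S \<le> ennreal e"
        using \<epsilon>(2) by (simp add: ennreal_leI)
    qed
    finally show ?thesis .
  qed
  have "outer_measure_of lborel (v ` S) \<le> (\<integral>\<^sup>+s\<in>S. ennreal (g (\<eta> s)) \<partial>lborel)"
  proof (rule ennreal_le_epsilon)
    fix e :: real assume "0 < e"
    then show "outer_measure_of lborel (v ` S) \<le> (\<integral>\<^sup>+s\<in>S. ennreal (g (\<eta> s)) \<partial>lborel) + ennreal e"
      by (rule approx)
  qed
  then show "outer_measure_of lborel ((\<lambda>s. f (\<eta> s)) ` S) \<le> (\<integral>\<^sup>+s\<in>S. ennreal (g (\<eta> s)) \<partial>lborel)"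
    by (simp add: v_def)
qed

lemma lower_lip_le_lipschitz_constant:
  fixes f :: "'a::metric_space \<Rightarrow> real"
  assumes f: "L-lipschitz_on UNIV f"
  shows "lower_lip f x \<le> ennreal L"
proof -
  have "0 \<le> L" using f by (rule lipschitz_on_nonneg)
  have "(SUP y\<in>ball x r. ennreal (\<bar>f x - f y\<bar> / r)) \<le> ennreal L" if "r > 0" for r
  proof (intro SUP_least ennreal_leI)
    fix y assume "y \<in> ball x r"
    then have "L * dist x y \<le> L * r"
      using \<open>0 \<le> L\<close> by (intro mult_left_mono) auto
    then have "\<bar>f x - f y\<bar> \<le> L * r"
      using lipschitz_onD[OF f, of x y] by (simp add: dist_real_def)
    then show "\<bar>f x - f y\<bar> / r \<le> L"
      using that by (simp add: field_simps)
  qed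
  then have "\<forall>\<^sub>F r in at_right 0. (SUP y\<in>ball x r. ennreal (\<bar>f x - f y\<bar> / r)) \<le> ennreal L"
    by (auto simp: eventually_at_right_field intro: exI[of _ 1])
  then show ?thesis
    unfolding lower_lip_def by (intro order_trans[OF Liminf_le_Limsup Limsup_bounded]) auto
qed

lemma variation_dominated_lipschitz:
  assumes "L-lipschitz_on UNIV (f :: 'a::metric_space \<Rightarrow> real)"
  shows "variation_dominated f (\<lambda>_. L)"
proof (rule variation_dominated_lower_lip[OF assms])
  show "0 \<le> L" using assms by (rule lipschitz_on_nonneg)
  show "lower_lip f x \<le> ennreal L" for x
    using assms by (rule lower_lip_le_lipschitz_constant)
qed auto

text \<open>
  The gluing principle: along a curve the parameters split according to whether the curve is in \<open>A\<close>, the image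
  of each part is an image under \<open>f\<^sub>1\<close> or under \<open>f\<^sub>2\<close>, and outer measure is subadditive. For upper
  gradients in the sense of intervals this would need an analysis of the components of the complement
  of \<open>A\<close> along the curve.
\<close>

lemma variation_dominated_cases:
  fixes f f\<^sub>1 f\<^sub>2 :: "'a::metric_space \<Rightarrow> real"
  assumes dom: "variation_dominated f\<^sub>1 g\<^sub>1" "variation_dominated f\<^sub>2 g\<^sub>2"
    and A: "A \<in> sets borel" and meas: "g\<^sub>1 \<in> borel_measurable borel" "g\<^sub>2 \<in> borel_measurable borel"
    and eq: "\<And>x. x \<in> A \<Longrightarrow> f x = f\<^sub>1 x" "\<And>x. x \<notin> A \<Longrightarrow> f x = f\<^sub>2 x"
  shows "variation_dominated f (\<lambda>x. if x \<in> A then g\<^sub>1 x else g\<^sub>2 x)"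
  unfolding variation_dominated_def
proof (intro allI impI)
  fix \<eta> :: "real \<Rightarrow> 'a" and S :: "real set"
  assume \<eta>: "1-lipschitz_on UNIV \<eta>" and S: "S \<in> sets borel" "emeasure lborel S < \<infinity>"
  have \<eta>m [measurable]: "\<eta> \<in> borel_measurable borel"
    by (rule lipschitz_borel_measurable[OF \<eta>])
  note [measurable] = meas A S(1)
  define S1 where "S1 = S \<inter> \<eta> -` A"
  define S2 where "S2 = S - \<eta> -` A"
  have [measurable]: "\<eta> -` A \<in> sets borel"
    using measurable_sets[OF \<eta>m A] by simp
  have S12: "S1 \<in> sets borel" "S2 \<in> sets borel" "S1 \<inter> S2 = {}" "S = S1 \<union> S2"
    by (auto simp: S1_def S2_def)
  have fin: "emeasure lborel S1 < \<infinity>" "emeasure lborel S2 < \<infinity>"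
    using S(2) emeasure_mono[of S1 S lborel] emeasure_mono[of S2 S lborel] S12 S(1)
    by (auto intro: le_less_trans)
  have "(\<lambda>s. f (\<eta> s)) ` S \<subseteq> (\<lambda>s. f\<^sub>1 (\<eta> s)) ` S1 \<union> (\<lambda>s. f\<^sub>2 (\<eta> s)) ` S2"
  proof (intro image_subsetI)
    fix s assume "s \<in> S"
    show "f (\<eta> s) \<in> (\<lambda>s. f\<^sub>1 (\<eta> s)) ` S1 \<union> (\<lambda>s. f\<^sub>2 (\<eta> s)) ` S2"
      using \<open>s \<in> S\<close> by (cases "\<eta> s \<in> A") (auto simp: S1_def S2_def eq)
  qed
  then have "outer_measure_of lborel ((\<lambda>s. f (\<eta> s)) ` S)
      \<le> outer_measure_of lborel ((\<lambda>s. f\<^sub>1 (\<eta> s)) ` S1 \<union> (\<lambda>s. f\<^sub>2 (\<eta> s)) ` S2)"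
    by (rule outer_measure_of_mono)
  also have "\<dots> \<le> outer_measure_of lborel ((\<lambda>s. f\<^sub>1 (\<eta> s)) ` S1) + outer_measure_of lborel ((\<lambda>s. f\<^sub>2 (\<eta> s)) ` S2)"
    by (intro outer_measure_of_Un_le) auto
  also have "\<dots> \<le> (\<integral>\<^sup>+s\<in>S1. ennreal (g\<^sub>1 (\<eta> s)) \<partial>lborel) + (\<integral>\<^sup>+s\<in>S2. ennreal (g\<^sub>2 (\<eta> s)) \<partial>lborel)"
    using dom \<eta> S12 fin by (intro add_mono variation_dominatedD) auto
  also have "\<dots> = (\<integral>\<^sup>+s. ennreal (g\<^sub>1 (\<eta> s)) * indicator S1 s + ennreal (g\<^sub>2 (\<eta> s)) * indicator S2 s \<partial>lborel)"
    using S12(1,2) by (intro nn_integral_add[symmetric]) auto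
  also have "\<dots> = (\<integral>\<^sup>+s\<in>S. ennreal (if \<eta> s \<in> A then g\<^sub>1 (\<eta> s) else g\<^sub>2 (\<eta> s)) \<partial>lborel)"
    by (intro nn_integral_cong) (auto simp: S1_def S2_def split: split_indicator)
  finally show "outer_measure_of lborel ((\<lambda>s. f (\<eta> s)) ` S)
    \<le> (\<integral>\<^sup>+s\<in>S. ennreal (if \<eta> s \<in> A then g\<^sub>1 (\<eta> s) else g\<^sub>2 (\<eta> s)) \<partial>lborel)" .
qed

lemma variation_dominated_mono:
  assumes "variation_dominated f g" "\<And>x. g x \<le> g' x"
  shows "variation_dominated f g'"
  unfolding variation_dominated_def
proof (intro allI impI)
  fix \<eta> :: "real \<Rightarrow> 'a" and S :: "real set"
  assume *: "1-lipschitz_on UNIV \<eta>" "S \<in> sets borel" "emeasure lborel S < \<infinity>"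
  have "outer_measure_of lborel ((\<lambda>s. f (\<eta> s)) ` S) \<le> (\<integral>\<^sup>+s\<in>S. ennreal (g (\<eta> s)) \<partial>lborel)"
    using assms(1) * by (rule variation_dominatedD)
  also have "\<dots> \<le> (\<integral>\<^sup>+s\<in>S. ennreal (g' (\<eta> s)) \<partial>lborel)"
    using assms(2) by (intro nn_integral_mono) (auto split: split_indicator intro: ennreal_leI)
  finally show "outer_measure_of lborel ((\<lambda>s. f (\<eta> s)) ` S) \<le> (\<integral>\<^sup>+s\<in>S. ennreal (g' (\<eta> s)) \<partial>lborel)" .
qed

lemma variation_dominated_const: "variation_dominated (\<lambda>_ :: 'a::metric_space. c) (\<lambda>_. 0)"
  by (rule variation_dominated_lipschitz) (rule lipschitz_on_constant)

lemma variation_dominated_clamp: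
  fixes f :: "'a::metric_space \<Rightarrow> real"
  assumes f: "f \<in> borel_measurable borel" and g: "g \<in> borel_measurable borel" "\<And>x. 0 \<le> g x"
    and dom: "variation_dominated f g"
  shows "variation_dominated (\<lambda>x. min (max (f x) a) b) g"
proof -
  have "variation_dominated (\<lambda>x. max (f x) a) (\<lambda>x. if x \<in> {x. f x < a} then 0 else g x)"
    by (rule variation_dominated_cases[OF variation_dominated_const dom])
      (use f g in \<open>auto simp: max_def\<close>)
  then have dom': "variation_dominated (\<lambda>x. max (f x) a) g"
    by (rule variation_dominated_mono) (use g in auto)
  have "variation_dominated (\<lambda>x. min (max (f x) a) b) (\<lambda>x. if x \<in> {x. max (f x) a > b} then 0 else g x)"
    by (rule variation_dominated_cases[OF variation_dominated_const dom'])
      (use f g in \<open>auto simp: min_def\<close>)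
  then show ?thesis
    by (rule variation_dominated_mono) (use g in auto)
qed

lemma variation_dominated_max:
  fixes f\<^sub>1 f\<^sub>2 :: "'a::metric_space \<Rightarrow> real"
  assumes "f\<^sub>1 \<in> borel_measurable borel" "f\<^sub>2 \<in> borel_measurable borel"
    and "g\<^sub>1 \<in> borel_measurable borel" "g\<^sub>2 \<in> borel_measurable borel"
    and "variation_dominated f\<^sub>1 g\<^sub>1" "variation_dominated f\<^sub>2 g\<^sub>2"
    and "\<And>x. g\<^sub>1 x \<le> g x" "\<And>x. g\<^sub>2 x \<le> g x"
  shows "variation_dominated (\<lambda>x. max (f\<^sub>1 x) (f\<^sub>2 x)) g"
proof -
  have "variation_dominated (\<lambda>x. max (f\<^sub>1 x) (f\<^sub>2 x)) (\<lambda>x. if x \<in> {x. f\<^sub>2 x < f\<^sub>1 x} then g\<^sub>1 x else g\<^sub>2 x)"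
    by (rule variation_dominated_cases[OF assms(5,6)]) (use assms in \<open>auto simp: max_def\<close>)
  then show ?thesis
    by (rule variation_dominated_mono) (use assms in auto)
qed

text \<open>
  The image of an interval is connected, so its measure bounds the distance of the values at the
  endpoints.
\<close>

lemma variation_dominated_interval:
  fixes f :: "'a::metric_space \<Rightarrow> real" and \<eta> :: "real \<Rightarrow> 'a"
  assumes f: "continuous_on UNIV f" and dom: "variation_dominated f g"
    and \<eta>: "1-lipschitz_on UNIV \<eta>" and l: "0 \<le> l"
  shows "ennreal \<bar>f (\<eta> 0) - f (\<eta> l)\<bar> \<le> (\<integral>\<^sup>+s\<in>{0..l}. ennreal (g (\<eta> s)) \<partial>lborel)"
proof -
  define v where "v = (\<lambda>s. f (\<eta> s))"
  have cont: "continuous_on {0..l} v"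
    unfolding v_def using continuous_on_compose2[OF f lipschitz_on_continuous_on[OF \<eta>]]
    by (auto intro: continuous_on_subset)
  then have "connected (v ` {0..l})"
    by (intro connected_continuous_image) auto
  then have "{min (v 0) (v l)..max (v 0) (v l)} \<subseteq> v ` {0..l}"
    using l by (intro connected_contains_Icc) (auto simp: min_def max_def)
  then have "outer_measure_of lborel {min (v 0) (v l)..max (v 0) (v l)} \<le> outer_measure_of lborel (v ` {0..l})"
    by (rule outer_measure_of_mono)
  also have "outer_measure_of lborel {min (v 0) (v l)..max (v 0) (v l)} = ennreal \<bar>v 0 - v l\<bar>"
    by (auto simp: min_def max_def)
  also have "outer_measure_of lborel (v ` {0..l}) \<le> (\<integral>\<^sup>+s\<in>{0..l}. ennreal (g (\<eta> s)) \<partial>lborel)"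
    unfolding v_def using dom \<eta> by (rule variation_dominatedD) (use l in auto)
  finally show ?thesis
    by (simp add: v_def)
qed

section \<open>Length of curves and the passage to upper gradients\<close>

text \<open>
  The sums in the definition of \<open>curve_length\<close> in recursive form, for inductions on the chain.
\<close>

fun chain_length :: "(real \<Rightarrow> 'a::metric_space) \<Rightarrow> real list \<Rightarrow> ennreal" where
  "chain_length \<gamma> (s # t # ts) = ennreal (dist (\<gamma> s) (\<gamma> t)) + chain_length \<gamma> (t # ts)"
| "chain_length \<gamma> _ = 0"

lemma chain_length_eq_sum:
  "chain_length \<gamma> ts = (\<Sum>i<length ts - 1. ennreal (dist (\<gamma> (ts ! i)) (\<gamma> (ts ! Suc i))))"
proof (induction \<gamma> ts rule: chain_length.induct)
  case (1 \<gamma> s t ts)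
  have "(\<Sum>i<length (s # t # ts) - 1. ennreal (dist (\<gamma> ((s # t # ts) ! i)) (\<gamma> ((s # t # ts) ! Suc i))))
     = (\<Sum>i<Suc (length ts). ennreal (dist (\<gamma> ((s # t # ts) ! i)) (\<gamma> ((s # t # ts) ! Suc i))))"
    by simp
  also have "\<dots> = ennreal (dist (\<gamma> s) (\<gamma> t))
     + (\<Sum>i<length ts. ennreal (dist (\<gamma> ((t # ts) ! i)) (\<gamma> ((t # ts) ! Suc i))))"
    by (subst sum.lessThan_Suc_shift) simp
  finally show ?case
    using 1 by simp
qed simp_all

lemma curve_length_eq: "curve_length a b \<gamma> = (SUP ts\<in>{ts. sorted ts \<and> set ts \<subseteq> {a..b}}. chain_length \<gamma> ts)"
  by (simp add: curve_length_def chain_length_eq_sum)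

lemma chain_length_le_curve_length:
  assumes "sorted ts" "set ts \<subseteq> {a..b}"
  shows "chain_length \<gamma> ts \<le> curve_length a b \<gamma>"
  unfolding curve_length_eq by (rule SUP_upper) (use assms in auto)

lemma dist_le_curve_length:
  assumes "a \<le> s" "s \<le> t" "t \<le> b"
  shows "ennreal (dist (\<gamma> s) (\<gamma> t)) \<le> curve_length a b \<gamma>"
  using chain_length_le_curve_length[of "[s, t]" a b \<gamma>] assms by simp

lemma curve_length_mono:
  assumes "a' \<le> a" "b \<le> b'"
  shows "curve_length a b \<gamma> \<le> curve_length a' b' \<gamma>"
  unfolding curve_length_eq using assms by (intro SUP_subset_mono) force+

lemma curve_length_refl: "curve_length a a \<gamma> = 0"
proof -
  have "chain_length \<gamma> ts = 0" if "set ts \<subseteq> {a..a}" for ts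
    using that by (induction \<gamma> ts rule: chain_length.induct) auto
  then show ?thesis
    unfolding curve_length_eq by (intro antisym SUP_least) auto
qed

lemma chain_length_append_ge:
  "chain_length \<gamma> ts + chain_length \<gamma> us \<le> chain_length \<gamma> (ts @ us)"
proof (induction \<gamma> ts rule: chain_length.induct)
  case (1 \<gamma> s t ts)
  then show ?case by (simp add: add.assoc add_left_mono)
next
  case ("2_2" \<gamma> v)
  then show ?case by (cases us) (auto simp: add_increasing)
qed simp

text \<open>
  Inserting \<open>c\<close> into the chain does not decrease the sum, by the triangle inequality.
\<close>

lemma chain_length_insert:
  assumes "sorted ts" "set ts \<subseteq> {a..b}" "a \<le> c" "c \<le> b"
  shows "chain_length \<gamma> ts \<le> curve_length a c \<gamma> + curve_length c b \<gamma>"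
  using assms
proof (induction \<gamma> ts arbitrary: a rule: chain_length.induct)
  case (1 \<gamma> s t ts)
  have st: "a \<le> s" "s \<le> t"
    using 1(2,3) by auto
  have rest: "t \<le> x \<and> x \<le> b" if "x \<in> set (t # ts)" for x
    using 1(2,3) that by auto
  show ?case
  proof (cases "t \<le> c")
    case True
    have "chain_length \<gamma> (t # ts) \<le> curve_length t c \<gamma> + curve_length c b \<gamma>"
      by (rule "1.IH") (use 1 True in auto)
    then have "chain_length \<gamma> (s # t # ts)
        \<le> ennreal (dist (\<gamma> s) (\<gamma> t)) + curve_length t c \<gamma> + curve_length c b \<gamma>"
      by (simp add: add.assoc add_left_mono)
    also have "ennreal (dist (\<gamma> s) (\<gamma> t)) + curve_length t c \<gamma> \<le> curve_length a c \<gamma>"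
    proof -
      have "ennreal (dist (\<gamma> s) (\<gamma> t)) + chain_length \<gamma> us \<le> curve_length a c \<gamma>"
        if us: "sorted us" "set us \<subseteq> {t..c}" for us
      proof -
        have "ennreal (dist (\<gamma> s) (\<gamma> t)) + chain_length \<gamma> us \<le> chain_length \<gamma> ([s, t] @ us)"
          using chain_length_append_ge[of \<gamma> "[s, t]" us] by simp
        also have "\<dots> \<le> curve_length a c \<gamma>"
        proof (rule chain_length_le_curve_length)
          have lower: "t \<le> x \<and> x \<le> c" if "x \<in> set us" for x
            using that us(2) by auto
          show "sorted ([s, t] @ us)"
            using us(1) lower st by (auto intro: order_trans)
          show "set ([s, t] @ us) \<subseteq> {a..c}"
            using lower st True by (force intro: order_trans)
        qed
        finally show ?thesis .
      qed
      moreover have "{ts. sorted ts \<and> set ts \<subseteq> {t..c}} \<noteq> {}"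
        by (auto intro!: exI[of _ "[]"])
      ultimately show ?thesis
        unfolding curve_length_eq[of t c]
        by (subst ennreal_SUP_add_right) (auto intro!: SUP_least)
    qed
    finally show ?thesis by (simp add: add_right_mono)
  next
    case t: False
    show ?thesis
    proof (cases "s \<le> c")
      case True
      have "ennreal (dist (\<gamma> s) (\<gamma> t)) \<le> ennreal (dist (\<gamma> s) (\<gamma> c)) + ennreal (dist (\<gamma> c) (\<gamma> t))"
        by (simp add: ennreal_plus[symmetric] dist_triangle del: ennreal_plus)
      then have "chain_length \<gamma> (s # t # ts)
          \<le> ennreal (dist (\<gamma> s) (\<gamma> c)) + (ennreal (dist (\<gamma> c) (\<gamma> t)) + chain_length \<gamma> (t # ts))"
        by (simp add: add.assoc[symmetric] add_right_mono)
      also have "\<dots> = ennreal (dist (\<gamma> s) (\<gamma> c)) + chain_length \<gamma> (c # t # ts)"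
        by simp
      also have "\<dots> \<le> curve_length a c \<gamma> + curve_length c b \<gamma>"
      proof (intro add_mono dist_le_curve_length chain_length_le_curve_length)
        have "c \<le> x \<and> x \<le> b" if "x \<in> set (t # ts)" for x
          using rest[OF that] t by linarith
        then show "sorted (c # t # ts)" "set (c # t # ts) \<subseteq> {c..b}"
          using 1(2,5) by auto
      qed (use 1(3) True in auto)
      finally show ?thesis .
    next
      case False
      have "chain_length \<gamma> (s # t # ts) \<le> curve_length c b \<gamma>"
      proof (rule chain_length_le_curve_length)
        have "c \<le> x \<and> x \<le> b" if "x \<in> set (t # ts)" for x
          using rest[OF that] st False by linarith
        moreover have "s \<in> {c..b}"
          using st False rest[of t] by auto
        ultimately show "set (s # t # ts) \<subseteq> {c..b}"
          by auto
      qed (rule 1(2))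
      then show ?thesis by (simp add: add_increasing)
    qed
  qed
qed simp_all

lemma curve_length_add:
  assumes "a \<le> c" "c \<le> b"
  shows "curve_length a b \<gamma> = curve_length a c \<gamma> + curve_length c b \<gamma>"
proof (rule antisym)
  show "curve_length a b \<gamma> \<le> curve_length a c \<gamma> + curve_length c b \<gamma>"
    unfolding curve_length_eq[of a b] using assms by (auto intro!: SUP_least chain_length_insert)
  have step: "chain_length \<gamma> ts + chain_length \<gamma> us \<le> curve_length a b \<gamma>"
    if "sorted ts" "set ts \<subseteq> {a..c}" "sorted us" "set us \<subseteq> {c..b}" for ts us
  proof -
    have bounds: "a \<le> x \<and> x \<le> c" if "x \<in> set ts" for x
      using that \<open>set ts \<subseteq> {a..c}\<close> by auto
    have bounds': "c \<le> x \<and> x \<le> b" if "x \<in> set us" for x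
      using that \<open>set us \<subseteq> {c..b}\<close> by auto
    have "sorted (ts @ us)"
      using that(1,3) bounds bounds' by (auto simp: sorted_append intro: order_trans)
    moreover have "set (ts @ us) \<subseteq> {a..b}"
      using assms bounds bounds' by (force intro: order_trans)
    ultimately have "chain_length \<gamma> (ts @ us) \<le> curve_length a b \<gamma>"
      by (rule chain_length_le_curve_length)
    moreover have "chain_length \<gamma> ts + chain_length \<gamma> us \<le> chain_length \<gamma> (ts @ us)"
      by (rule chain_length_append_ge)
    ultimately show ?thesis
      by (rule order_trans[rotated])
  qed
  have nonempty: "{ts. sorted ts \<and> set ts \<subseteq> {x..y}} \<noteq> {}" for x y :: real
    by (auto intro!: exI[of _ "[]"])
  have "curve_length a c \<gamma> + chain_length \<gamma> us \<le> curve_length a b \<gamma>"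
    if "sorted us" "set us \<subseteq> {c..b}" for us
  proof -
    have "(SUP ts\<in>{ts. sorted ts \<and> set ts \<subseteq> {a..c}}. chain_length \<gamma> ts + chain_length \<gamma> us) \<le> curve_length a b \<gamma>"
      using step that by (intro SUP_least) simp
    then show ?thesis
      by (simp only: curve_length_eq[of a c] ennreal_SUP_add_left[OF nonempty])
  qed
  then have "(SUP us\<in>{us. sorted us \<and> set us \<subseteq> {c..b}}. curve_length a c \<gamma> + chain_length \<gamma> us) \<le> curve_length a b \<gamma>"
    by (intro SUP_least) simp
  then show "curve_length a c \<gamma> + curve_length c b \<gamma> \<le> curve_length a b \<gamma>"
    by (simp only: curve_length_eq[of c b] ennreal_SUP_add_right[OF nonempty])
qed

text \<open>
  Lower semicontinuity of length: a chain in \<open>{a..b}\<close> is the limit of its projections to the intervals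
  \<open>{\<alpha> n..\<beta> n}\<close>. It gives the continuity of arc length from the left (fixed \<open>\<alpha>\<close>) and from the
  right (fixed \<open>\<beta>\<close>).
\<close>

lemma curve_length_le_exhaustion:
  fixes \<gamma> :: "real \<Rightarrow> 'a::metric_space"
  assumes \<gamma>: "continuous_on {a..b} \<gamma>"
    and \<alpha>\<beta>: "\<And>n. a \<le> \<alpha> n" "\<And>n. \<alpha> n \<le> \<beta> n" "\<And>n. \<beta> n \<le> b"
    and lim: "\<alpha> \<longlonglongrightarrow> a" "\<beta> \<longlonglongrightarrow> b"
    and bound: "\<And>n. curve_length (\<alpha> n) (\<beta> n) \<gamma> \<le> c"
  shows "curve_length a b \<gamma> \<le> c"
  unfolding curve_length_eq
proof (rule SUP_least)
  fix ts assume "ts \<in> {ts. sorted ts \<and> set ts \<subseteq> {a..b}}"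
  then have ts: "sorted ts" "set ts \<subseteq> {a..b}" by auto
  define r where "r n t = max (\<alpha> n) (min (\<beta> n) t)" for n t
  have r_in: "r n t \<in> {\<alpha> n..\<beta> n}" for n t
    using \<alpha>\<beta>(2)[of n] by (auto simp: r_def)
  have r_mono: "s \<le> t \<Longrightarrow> r n s \<le> r n t" for n s t
    by (auto simp: r_def)
  have r_lim: "(\<lambda>n. \<gamma> (r n t)) \<longlonglongrightarrow> \<gamma> t" if "t \<in> {a..b}" for t
  proof (rule continuous_on_tendsto_compose[OF \<gamma> _ that])
    have "(\<lambda>n. r n t) \<longlonglongrightarrow> max a (min b t)"
      unfolding r_def by (intro tendsto_max tendsto_min lim tendsto_const)
    then show "(\<lambda>n. r n t) \<longlonglongrightarrow> t"
      using that by simp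
    show "\<forall>\<^sub>F n in sequentially. r n t \<in> {a..b}"
    proof (intro always_eventually allI)
      fix n show "r n t \<in> {a..b}"
        using r_in[of n t] \<alpha>\<beta>(1)[of n] \<alpha>\<beta>(3)[of n] by auto
    qed
  qed
  have "(\<lambda>n. chain_length \<gamma> (map (r n) ts)) \<longlonglongrightarrow> chain_length \<gamma> ts"
  proof -
    have "(\<lambda>n. \<Sum>i<length ts - 1. ennreal (dist (\<gamma> (r n (ts ! i))) (\<gamma> (r n (ts ! Suc i)))))
        \<longlonglongrightarrow> (\<Sum>i<length ts - 1. ennreal (dist (\<gamma> (ts ! i)) (\<gamma> (ts ! Suc i))))"
    proof (intro tendsto_sum tendsto_ennrealI tendsto_dist r_lim)
      fix i assume "i \<in> {..<length ts - 1}"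
      then have "ts ! i \<in> set ts" "ts ! Suc i \<in> set ts"
        by (auto intro!: nth_mem)
      then show "ts ! i \<in> {a..b}" "ts ! Suc i \<in> {a..b}"
        using ts(2) by blast+
    qed
    moreover have "(\<Sum>i<length ts - 1. ennreal (dist (\<gamma> (r n (ts ! i))) (\<gamma> (r n (ts ! Suc i)))))
        = chain_length \<gamma> (map (r n) ts)" for n
      unfolding chain_length_eq_sum by (intro sum.cong) auto
    ultimately show ?thesis
      by (simp add: chain_length_eq_sum)
  qed
  moreover have "chain_length \<gamma> (map (r n) ts) \<le> c" for n
  proof -
    have "sorted (map (r n) ts)"
      using ts(1) r_mono by (simp add: sorted_wrt_map sorted_wrt_mono_rel[of ts "(\<le>)"])
    moreover have "set (map (r n) ts) \<subseteq> {\<alpha> n..\<beta> n}"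
      using r_in by auto
    ultimately show ?thesis
      using chain_length_le_curve_length bound order_trans by blast
  qed
  ultimately show "chain_length \<gamma> ts \<le> c"
    by (intro LIMSEQ_le_const2) auto
qed

lemma curve_length_finite:
  assumes "rectifiable_curve L \<gamma>" "0 \<le> a" "b \<le> L"
  shows "curve_length a b \<gamma> = ennreal (enn2real (curve_length a b \<gamma>))"
proof -
  have "curve_length a b \<gamma> \<le> curve_length 0 L \<gamma>"
    using assms by (intro curve_length_mono) auto
  then show ?thesis
    using assms(1) by (auto simp: rectifiable_curve_def ennreal_enn2real_if top_unique)
qed

text \<open>
  The last parameter \<open>T\<close> up to which the length is at most \<open>s\<close> works: by exhaustion from the left the length up
  to \<open>T\<close> is at most \<open>s\<close>, and by exhaustion from the right the remaining length is at most the total length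
  minus \<open>s\<close>.
\<close>

lemma curve_length_attained:
  fixes \<gamma> :: "real \<Rightarrow> 'a::metric_space"
  assumes \<gamma>: "rectifiable_curve L \<gamma>" and s: "0 \<le> s" "s \<le> enn2real (curve_length 0 L \<gamma>)"
  shows "\<exists>t\<in>{0..L}. curve_length 0 t \<gamma> = ennreal s"
proof -
  have L: "0 \<le> L" and cont: "continuous_on {0..L} \<gamma>"
    using \<gamma> by (auto simp: rectifiable_curve_def)
  define len where "len a b = enn2real (curve_length a b \<gamma>)" for a b
  have len: "curve_length a b \<gamma> = ennreal (len a b)" "0 \<le> len a b" if "0 \<le> a" "b \<le> L" for a b
    using curve_length_finite[OF \<gamma> that] by (auto simp: len_def)
  have len_add: "len 0 L = len 0 t + len t L" if "0 \<le> t" "t \<le> L" for t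
  proof -
    have "ennreal (len 0 L) = ennreal (len 0 t) + ennreal (len t L)"
      using curve_length_add[OF that, of \<gamma>] len[of 0 L] len[of 0 t] len[of t L] that L by simp
    then show ?thesis
      using len(2)[of 0 t] len(2)[of t L] len(2)[of 0 L] that L
      by (simp add: ennreal_plus[symmetric] del: ennreal_plus)
  qed
  define A where "A = {t\<in>{0..L}. len 0 t \<le> s}"
  define T where "T = Sup A"
  have "len 0 0 = 0"
    by (simp add: len_def curve_length_refl)
  then have A0: "0 \<in> A"
    using s L by (simp add: A_def)
  have bdd: "bdd_above A"
    by (auto simp: A_def intro: bdd_aboveI[of _ L])
  have T: "0 \<le> T" "T \<le> L"
    using A0 bdd by (auto simp: T_def A_def intro: cSup_upper cSup_least)
  have below: "len 0 t \<le> s" if t: "0 \<le> t" "t < T" for t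
  proof -
    obtain t' where t': "t' \<in> A" "t < t'"
      using t(2) less_cSup_iff[of A t] A0 bdd by (auto simp: T_def)
    then have "curve_length 0 t \<gamma> \<le> curve_length 0 t' \<gamma>"
      by (intro curve_length_mono) auto
    then have "len 0 t \<le> len 0 t'"
      using len[of 0 t] len[of 0 t'] t' t T by (simp add: A_def)
    then show ?thesis
      using t' by (simp add: A_def)
  qed
  have above: "s < len 0 t" if "T < t" "t \<le> L" for t
  proof (rule ccontr)
    assume "\<not> s < len 0 t"
    then have "t \<in> A"
      using that T by (auto simp: A_def)
    then have "t \<le> T"
      unfolding T_def using bdd by (rule cSup_upper)
    with that show False by simp
  qed
  have "len 0 T \<le> s"
  proof (cases "T = 0")
    case False
    have "curve_length 0 T \<gamma> \<le> ennreal s"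
    proof (rule curve_length_le_exhaustion[where \<alpha> = "\<lambda>_. 0" and \<beta> = "\<lambda>n. T - T / real (Suc n)"])
      show "continuous_on {0..T} \<gamma>"
        using cont T by (auto intro: continuous_on_subset)
      show "(\<lambda>n. T - T / real (Suc n)) \<longlonglongrightarrow> T"
        using tendsto_diff[OF tendsto_const LIMSEQ_Suc[OF lim_const_over_n[of T]], of T] by simp
      fix n
      have "T / real (Suc n) \<le> T" "0 < T / real (Suc n)"
        using T False by (auto simp: field_simps)
      then show "0 \<le> T - T / real (Suc n)" "T - T / real (Suc n) \<le> T"
        "curve_length 0 (T - T / real (Suc n)) \<gamma> \<le> ennreal s"
        using below[of "T - T / real (Suc n)"] len[of 0 "T - T / real (Suc n)"] T
        by (auto intro!: ennreal_leI)
    qed auto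
    then show ?thesis
      using len[of 0 T] T s by simp
  qed (use \<open>len 0 0 = 0\<close> s in simp)
  moreover have "s \<le> len 0 T"
  proof (cases "T = L")
    case True
    then show ?thesis using s by (simp add: len_def)
  next
    case False
    define h where "h n = (L - T) / real (Suc n)" for n
    have h: "0 < h n" "h n \<le> L - T" for n
      using T False divide_left_mono[of 1 "real (Suc n)" "L - T"] by (auto simp: h_def)
    have "curve_length T L \<gamma> \<le> ennreal (len 0 L - s)"
    proof (rule curve_length_le_exhaustion[where \<alpha> = "\<lambda>n. T + h n" and \<beta> = "\<lambda>_. L"])
      show "continuous_on {T..L} \<gamma>"
        using cont T by (auto intro: continuous_on_subset)
      show "(\<lambda>n. T + h n) \<longlonglongrightarrow> T"
        using tendsto_add[OF tendsto_const LIMSEQ_Suc[OF lim_const_over_n[of "L - T"]], of T]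
        by (simp add: h_def)
      fix n
      have "len 0 L = len 0 (T + h n) + len (T + h n) L" "s < len 0 (T + h n)"
        using len_add[of "T + h n"] above[of "T + h n"] h[of n] T by auto
      then show "curve_length (T + h n) L \<gamma> \<le> ennreal (len 0 L - s)"
        using len[of "T + h n" L] h[of n] T by (auto intro!: ennreal_leI)
      show "T \<le> T + h n" "T + h n \<le> L"
        using h[of n] by auto
    qed auto
    then have "len T L \<le> len 0 L - s"
      using len[of T L] T s by (simp add: len_def[symmetric])
    then show ?thesis
      using len_add[OF T] by simp
  qed
  ultimately show ?thesis
    using len[of 0 T] T by (intro bexI[of _ T]) auto
qed

lemma dist_le_length_difference:
  assumes \<gamma>: "rectifiable_curve L \<gamma>" and t: "0 \<le> t" "t \<le> t'" "t' \<le> L"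
    and len: "curve_length 0 t \<gamma> = ennreal s" "curve_length 0 t' \<gamma> = ennreal s'" "0 \<le> s" "0 \<le> s'"
  shows "dist (\<gamma> t) (\<gamma> t') \<le> s' - s"
proof -
  define m where "m = enn2real (curve_length t t' \<gamma>)"
  have m: "curve_length t t' \<gamma> = ennreal m" "0 \<le> m"
    using curve_length_finite[OF \<gamma>, of t t'] t by (auto simp: m_def)
  have "ennreal s' = ennreal s + ennreal m"
    using curve_length_add[of 0 t t' \<gamma>] t len m by simp
  then have "s' = s + m"
    using len m by (simp add: ennreal_plus[symmetric] del: ennreal_plus)
  moreover have "ennreal (dist (\<gamma> t) (\<gamma> t')) \<le> ennreal m"
    using dist_le_curve_length[of t t t' t' \<gamma>] t m by simp
  then have "dist (\<gamma> t) (\<gamma> t') \<le> m"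
    using m by simp
  ultimately show ?thesis by simp
qed

text \<open>
  The choice in the definition of \<open>arclength_param\<close> is harmless because points at which the traversed
  lengths are \<open>s\<close> and \<open>s'\<close> have distance at most \<open>\<bar>s - s'\<bar>\<close>, however they are chosen.
\<close>

lemma arclength_param_lipschitz:
  fixes \<gamma> :: "real \<Rightarrow> 'a::metric_space"
  assumes \<gamma>: "rectifiable_curve L \<gamma>"
  defines "l \<equiv> enn2real (curve_length 0 L \<gamma>)"
  obtains \<eta> where "1-lipschitz_on UNIV \<eta>" "\<And>s. s \<in> {0..l} \<Longrightarrow> \<eta> s = arclength_param L \<gamma> s"
    "\<eta> 0 = \<gamma> 0" "\<eta> l = \<gamma> L"
proof -
  have L: "0 \<le> L"
    using \<gamma> by (simp add: rectifiable_curve_def)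
  have l: "0 \<le> l" "curve_length 0 L \<gamma> = ennreal l"
    using curve_length_finite[OF \<gamma>, of 0 L] by (auto simp: l_def)
  define \<tau> where "\<tau> s = (SOME t. t \<in> {0..L} \<and> curve_length 0 t \<gamma> = ennreal s)" for s
  have \<tau>: "\<tau> s \<in> {0..L} \<and> curve_length 0 (\<tau> s) \<gamma> = ennreal s" if "s \<in> {0..l}" for s
  proof -
    have "\<exists>t. t \<in> {0..L} \<and> curve_length 0 t \<gamma> = ennreal s"
      using curve_length_attained[OF \<gamma>, of s] that by (auto simp: l_def)
    then show ?thesis
      unfolding \<tau>_def by (rule someI_ex)
  qed
  \<comment> \<open>Continuation by constants to the whole line.\<close>
  define p where "p s = max 0 (min l s)" for s
  have p: "p s \<in> {0..l}" "\<bar>p s - p s'\<bar> \<le> \<bar>s - s'\<bar>" for s s'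
    using l by (auto simp: p_def)
  define \<eta> where "\<eta> s = \<gamma> (\<tau> (p s))" for s
  have "dist (\<gamma> (\<tau> s)) (\<gamma> (\<tau> s')) \<le> \<bar>s - s'\<bar>" if s: "s \<in> {0..l}" "s' \<in> {0..l}" for s s'
  proof (cases "\<tau> s \<le> \<tau> s'")
    case True
    then show ?thesis
      using dist_le_length_difference[OF \<gamma>, of "\<tau> s" "\<tau> s'" s s'] \<tau>[OF s(1)] \<tau>[OF s(2)] s by auto
  next
    case False
    then show ?thesis
      using dist_le_length_difference[OF \<gamma>, of "\<tau> s'" "\<tau> s" s' s] \<tau>[OF s(1)] \<tau>[OF s(2)] s
      by (auto simp: dist_commute)
  qed
  then have "dist (\<eta> s) (\<eta> s') \<le> \<bar>s - s'\<bar>" for s s'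
    unfolding \<eta>_def using p(1) p(2)[of s s'] by (meson order_trans)
  then have "1-lipschitz_on UNIV \<eta>"
    by (intro lipschitz_onI) (auto simp: dist_real_def)
  moreover have "\<eta> s = arclength_param L \<gamma> s" if "s \<in> {0..l}" for s
    using that by (simp add: \<eta>_def arclength_param_def \<tau>_def p_def)
  moreover have "\<eta> 0 = \<gamma> 0"
    using dist_le_length_difference[OF \<gamma>, of 0 "\<tau> 0" 0 0] \<tau>[of 0] l curve_length_refl[of 0 \<gamma>]
    by (simp add: \<eta>_def p_def)
  moreover have "\<eta> l = \<gamma> L"
    using dist_le_length_difference[OF \<gamma>, of "\<tau> l" L l l] \<tau>[of l] l L
    by (simp add: \<eta>_def p_def)
  ultimately show ?thesis
    using that by blast
qed

lemma upper_gradient_lipschitz_curvesI: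
  fixes u :: "'a::metric_space \<Rightarrow> real"
  assumes g: "g \<in> borel_measurable borel"
    and *: "\<And>\<eta> l. 1-lipschitz_on UNIV (\<eta> :: real \<Rightarrow> 'a) \<Longrightarrow> 0 \<le> l \<Longrightarrow>
      ennreal \<bar>u (\<eta> 0) - u (\<eta> l)\<bar> \<le> (\<integral>\<^sup>+s\<in>{0..l}. g (\<eta> s) \<partial>lborel)"
  shows "upper_gradient u g"
  unfolding upper_gradient_def
proof (intro conjI allI impI g)
  fix L and \<gamma> :: "real \<Rightarrow> 'a" assume \<gamma>: "rectifiable_curve L \<gamma>"
  define l where "l = enn2real (curve_length 0 L \<gamma>)"
  obtain \<eta> where \<eta>: "1-lipschitz_on UNIV \<eta>" "\<And>s. s \<in> {0..l} \<Longrightarrow> \<eta> s = arclength_param L \<gamma> s"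
    "\<eta> 0 = \<gamma> 0" "\<eta> l = \<gamma> L"
    using arclength_param_lipschitz[OF \<gamma>] unfolding l_def by blast
  have "ennreal \<bar>u (\<gamma> 0) - u (\<gamma> L)\<bar> \<le> (\<integral>\<^sup>+s\<in>{0..l}. g (\<eta> s) \<partial>lborel)"
    using *[OF \<eta>(1), of l] \<eta>(3,4) by (simp add: l_def)
  also have "\<dots> = curve_integral L \<gamma> g"
    unfolding curve_integral_def l_def[symmetric]
    by (intro nn_integral_cong) (auto simp: \<eta>(2) split: split_indicator)
  finally show "ennreal \<bar>u (\<gamma> 0) - u (\<gamma> L)\<bar> \<le> curve_integral L \<gamma> g" .
qed

text \<open>
  The factor \<open>k\<close> is built in because the Orlicz-Poincare inequality is not homogeneous and has to be
  applied to a suitable multiple of the function at hand.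
\<close>

lemma variation_dominated_imp_upper_gradient:
  fixes f :: "'a::metric_space \<Rightarrow> real"
  assumes f: "continuous_on UNIV f" and g: "g \<in> borel_measurable borel"
    and dom: "variation_dominated f g" and k: "0 \<le> k"
  shows "upper_gradient (\<lambda>x. k * f x) (\<lambda>x. ennreal (k * g x))"
proof (rule upper_gradient_lipschitz_curvesI)
  show "(\<lambda>x. ennreal (k * g x)) \<in> borel_measurable borel"
    using g by measurable
  fix \<eta> :: "real \<Rightarrow> 'a" and l :: real assume \<eta>: "1-lipschitz_on UNIV \<eta>" and l: "0 \<le> l"
  have g\<eta>: "(\<lambda>s. g (\<eta> s)) \<in> borel_measurable borel"
    using measurable_compose[OF lipschitz_borel_measurable[OF \<eta>] g] .
  have "ennreal \<bar>k * f (\<eta> 0) - k * f (\<eta> l)\<bar> = ennreal k * ennreal \<bar>f (\<eta> 0) - f (\<eta> l)\<bar>"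
    using k by (simp add: ennreal_mult[symmetric] right_diff_distrib[symmetric] abs_mult)
  also have "\<dots> \<le> ennreal k * (\<integral>\<^sup>+s\<in>{0..l}. ennreal (g (\<eta> s)) \<partial>lborel)"
    using variation_dominated_interval[OF f dom \<eta> l] by (rule mult_left_mono) simp
  also have "\<dots> = (\<integral>\<^sup>+s. ennreal k * (ennreal (g (\<eta> s)) * indicator {0..l} s) \<partial>lborel)"
    using g\<eta> by (intro nn_integral_cmult[symmetric]) auto
  also have "\<dots> = (\<integral>\<^sup>+s\<in>{0..l}. ennreal (k * g (\<eta> s)) \<partial>lborel)"
    using k by (intro nn_integral_cong) (simp add: ennreal_mult' mult.assoc)
  finally show "ennreal \<bar>k * f (\<eta> 0) - k * f (\<eta> l)\<bar> \<le> (\<integral>\<^sup>+s\<in>{0..l}. ennreal (k * g (\<eta> s)) \<partial>lborel)" .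
qed

section \<open>The uncentred maximal function on a doubling space\<close>

text \<open>
  The finite form of Vitali's covering lemma: select a ball of largest radius, discard the balls that meet it,
  which lie in its threefold enlargement, and continue with the others.
\<close>

lemma finite_disjoint_subballs:
  fixes I :: "('a::metric_space \<times> real) set"
  assumes "finite I"
  obtains J where "J \<subseteq> I" "disjoint_family_on (\<lambda>i. ball (fst i) (snd i)) J"
    "(\<Union>i\<in>I. ball (fst i) (snd i)) \<subseteq> (\<Union>i\<in>J. ball (fst i) (3 * snd i))"
proof -
  have "\<exists>J\<subseteq>I. disjoint_family_on (\<lambda>i. ball (fst i) (snd i)) J \<and>
    (\<Union>i\<in>I. ball (fst i) (snd i)) \<subseteq> (\<Union>i\<in>J. ball (fst i) (3 * snd i))"
    using assms
  proof (induction I rule: finite_psubset_induct)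
    case (psubset I)
    show ?case
    proof (cases "I = {}")
      case True
      then show ?thesis by (auto simp: disjoint_family_on_def)
    next
      case False
      obtain i where i: "i \<in> I" "\<And>j. j \<in> I \<Longrightarrow> snd j \<le> snd i"
        using Max_in[of "snd ` I"] Max_ge[of "snd ` I"] psubset.hyps False by fastforce
      define I' where "I' = {j \<in> I - {i}. ball (fst i) (snd i) \<inter> ball (fst j) (snd j) = {}}"
      have "I' \<subset> I"
        using i(1) by (auto simp: I'_def)
      then obtain J where J: "J \<subseteq> I'" "disjoint_family_on (\<lambda>i. ball (fst i) (snd i)) J"
        "(\<Union>i\<in>I'. ball (fst i) (snd i)) \<subseteq> (\<Union>i\<in>J. ball (fst i) (3 * snd i))"
        using psubset.IH by meson
      have "disjoint_family_on (\<lambda>i. ball (fst i) (snd i)) (insert i J)"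
        using J(1,2) by (auto simp: disjoint_family_on_def I'_def)
      moreover have cover: "x \<in> (\<Union>i\<in>insert i J. ball (fst i) (3 * snd i))"
        if j: "j \<in> I" "x \<in> ball (fst j) (snd j)" for j x
      proof (cases "j \<in> I'")
        case True
        then have "x \<in> (\<Union>i\<in>J. ball (fst i) (3 * snd i))"
          using J(3) j(2) by blast
        then show ?thesis by auto
      next
        case False
        have "x \<in> ball (fst i) (3 * snd i)"
        proof (cases "j = i")
          case True
          then show ?thesis
            using j(2) zero_le_dist[of "fst i" x] by (simp del: zero_le_dist)
        next
          case False
          then obtain z where z: "z \<in> ball (fst i) (snd i)" "z \<in> ball (fst j) (snd j)"
            using \<open>j \<notin> I'\<close> j(1) by (auto simp: I'_def)
          have "dist (fst i) x \<le> dist (fst i) z + dist (fst j) z + dist (fst j) x"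
            using dist_triangle[of "fst i" x z] dist_triangle3[of z x "fst j"] by linarith
          then show ?thesis
            using z j(2) i(2)[OF j(1)] by auto
        qed
        then show ?thesis by auto
      qed
      moreover have "insert i J \<subseteq> I"
        using J(1) i(1) by (auto simp: I'_def)
      ultimately show ?thesis
        by (intro exI[of _ "insert i J"]) (meson UN_E subsetI)
    qed
  qed
  then show ?thesis using that by blast
qed

text \<open>
  The set where the uncentred maximal function of \<open>h\<close> exceeds \<open>c\<close>. With uncentred balls this set is a union of
  balls, hence open.
\<close>

definition maximal_superlevel :: "'a::metric_space measure \<Rightarrow> ('a \<Rightarrow> ennreal) \<Rightarrow> ennreal \<Rightarrow> 'a set" where
  "maximal_superlevel \<mu> h c =
     {x. \<exists>p r. x \<in> ball p r \<and> c * emeasure \<mu> (ball p r) < (\<integral>\<^sup>+y\<in>ball p r. h y \<partial>\<mu>)}"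

lemma maximal_superlevelE:
  assumes "x \<in> maximal_superlevel \<mu> h c"
  obtains p r where "x \<in> ball p r" "0 < r" "c * emeasure \<mu> (ball p r) < (\<integral>\<^sup>+y\<in>ball p r. h y \<partial>\<mu>)"
proof -
  obtain p r where pr: "x \<in> ball p r" "c * emeasure \<mu> (ball p r) < (\<integral>\<^sup>+y\<in>ball p r. h y \<partial>\<mu>)"
    using assms unfolding maximal_superlevel_def by blast
  moreover have "0 < r"
    using pr(1) by (auto intro: le_less_trans[OF zero_le_dist])
  ultimately show thesis
    using that by blast
qed

lemma open_maximal_superlevel: "open (maximal_superlevel \<mu> h c)"
proof (rule open_subopen[THEN iffD2], intro ballI)
  fix x assume "x \<in> maximal_superlevel \<mu> h c"
  then obtain p r where "x \<in> ball p r" "c * emeasure \<mu> (ball p r) < (\<integral>\<^sup>+y\<in>ball p r. h y \<partial>\<mu>)"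
    by (rule maximal_superlevelE)
  then have "open (ball p r) \<and> x \<in> ball p r \<and> ball p r \<subseteq> maximal_superlevel \<mu> h c"
    unfolding maximal_superlevel_def by blast
  then show "\<exists>T. open T \<and> x \<in> T \<and> T \<subseteq> maximal_superlevel \<mu> h c"
    by blast
qed

lemma integral_le_outside_maximal_superlevel:
  assumes "x \<notin> maximal_superlevel \<mu> h c" "x \<in> ball p r"
  shows "(\<integral>\<^sup>+x\<in>ball p r. h x \<partial>\<mu>) \<le> c * emeasure \<mu> (ball p r)"
  using assms unfolding maximal_superlevel_def mem_Collect_eq not_ex de_Morgan_conj not_less by blast

lemma maximal_superlevel_antimono:
  assumes "c \<le> c'"
  shows "maximal_superlevel \<mu> h c' \<subseteq> maximal_superlevel \<mu> h c"
proof
  fix x assume "x \<in> maximal_superlevel \<mu> h c'"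
  then obtain p r where "x \<in> ball p r" "c' * emeasure \<mu> (ball p r) < (\<integral>\<^sup>+x\<in>ball p r. h x \<partial>\<mu>)"
    by (rule maximal_superlevelE)
  moreover have "c * emeasure \<mu> (ball p r) \<le> c' * emeasure \<mu> (ball p r)"
    using assms by (rule mult_right_mono) simp
  ultimately show "x \<in> maximal_superlevel \<mu> h c"
    unfolding maximal_superlevel_def mem_Collect_eq using le_less_trans by blast
qed

lemma ball_sets_borel [measurable, simp]: "ball x r \<in> sets borel"
  by (simp add: borel_open)

locale doubling_space =
  fixes \<mu> :: "'a::polish_space measure" and D :: real
  assumes space: "metric_measure_space \<mu>"
    and D_ge_1: "1 \<le> D"
    and doubling: "\<And>x r. 0 < r \<Longrightarrow> emeasure \<mu> (ball x (2 * r)) \<le> ennreal D * emeasure \<mu> (ball x r)"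
begin

lemma sets_eq_borel [measurable_cong, simp]: "sets \<mu> = sets borel"
  using space by (simp add: metric_measure_space_def radon_measure_def)

lemma space_eq_UNIV [simp]: "space \<mu> = UNIV"
  using sets_eq_imp_space_eq[OF sets_eq_borel] by simp

lemma emeasure_ball_pos: "0 < r \<Longrightarrow> 0 < emeasure \<mu> (ball x r)"
  using space by (simp add: metric_measure_space_def)

lemma emeasure_ball_finite: "emeasure \<mu> (ball x r) < \<infinity>"
  using space by (cases "0 < r") (simp_all add: metric_measure_space_def ball_empty)

lemma emeasure_ball: "emeasure \<mu> (ball x r) = ennreal (measure \<mu> (ball x r))"
  using emeasure_ball_finite[of x r] by (intro emeasure_eq_ennreal_measure) auto

lemma measure_ball_pos: "0 < r \<Longrightarrow> 0 < measure \<mu> (ball x r)"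
  using emeasure_ball_pos[of r x] by (simp add: emeasure_ball)

lemma measure_ball_mono: "ball x r \<subseteq> ball y s \<Longrightarrow> measure \<mu> (ball x r) \<le> measure \<mu> (ball y s)"
  using emeasure_ball_finite[of y s] by (intro measure_mono_fmeasurable) (auto simp: fmeasurable_def)

lemma measure_ball_double: "0 < r \<Longrightarrow> measure \<mu> (ball x (2 * r)) \<le> D * measure \<mu> (ball x r)"
  using doubling[of r x] D_ge_1 by (simp add: emeasure_ball ennreal_mult[symmetric])

lemma emeasure_ball_power_le:
  assumes "0 < r"
  shows "emeasure \<mu> (ball x (2 ^ n * r)) \<le> ennreal D ^ n * emeasure \<mu> (ball x r)"
proof (induction n)
  case (Suc n)
  have "emeasure \<mu> (ball x (2 ^ Suc n * r)) \<le> ennreal D * emeasure \<mu> (ball x (2 ^ n * r))"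
    using doubling[of "2 ^ n * r" x] assms by (simp add: mult.assoc)
  also have "\<dots> \<le> ennreal D * (ennreal D ^ n * emeasure \<mu> (ball x r))"
    using Suc by (rule mult_left_mono) simp
  finally show ?case by (simp add: mult.assoc)
qed simp

lemma compact_inner_regular:
  assumes "A \<in> sets borel"
  shows "emeasure \<mu> A = (SUP K\<in>{K. compact K \<and> K \<subseteq> A}. emeasure \<mu> K)"
  using space assms by (simp add: metric_measure_space_def radon_measure_def)

text \<open>
  Inner regularity reduces the weak type \<open>(1, 1)\<close> inequality to compact subsets, for which the finite
  covering lemma suffices. The threefold enlargement of a ball lies in the fourfold one, which costs
  two factors \<open>D\<close>.
\<close>

lemma weak_type_maximal:
  assumes [measurable]: "h \<in> borel_measurable borel"
  shows "c * emeasure \<mu> (maximal_superlevel \<mu> h c) \<le> ennreal D ^ 2 * (\<integral>\<^sup>+x. h x \<partial>\<mu>)"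
proof -
  have "c * emeasure \<mu> K \<le> ennreal D ^ 2 * (\<integral>\<^sup>+x. h x \<partial>\<mu>)"
    if K: "compact K" "K \<subseteq> maximal_superlevel \<mu> h c" for K
  proof -
    \<comment> \<open>Balls are represented by their centre and radius, since a ball need not determine these.\<close>
    define I where "I = {i :: 'a \<times> real. 0 < snd i \<and>
      c * emeasure \<mu> (ball (fst i) (snd i)) < (\<integral>\<^sup>+x\<in>ball (fst i) (snd i). h x \<partial>\<mu>)}"
    have "\<exists>i\<in>I. x \<in> ball (fst i) (snd i)" if "x \<in> K" for x
    proof -
      have "x \<in> maximal_superlevel \<mu> h c"
        using K(2) that by blast
      then obtain p r where "x \<in> ball p r" "0 < r" "c * emeasure \<mu> (ball p r) < (\<integral>\<^sup>+y\<in>ball p r. h y \<partial>\<mu>)"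
        by (rule maximal_superlevelE)
      then show ?thesis
        by (intro bexI[of _ "(p, r)"]) (auto simp: I_def)
    qed
    then have "K \<subseteq> (\<Union>i\<in>I. ball (fst i) (snd i))"
      by blast
    then obtain I' where I': "I' \<subseteq> I" "finite I'" "K \<subseteq> (\<Union>i\<in>I'. ball (fst i) (snd i))"
      using compactE_image[OF K(1), of I "\<lambda>i. ball (fst i) (snd i)"] by auto
    obtain J where J: "J \<subseteq> I'" "disjoint_family_on (\<lambda>i. ball (fst i) (snd i)) J"
      "(\<Union>i\<in>I'. ball (fst i) (snd i)) \<subseteq> (\<Union>i\<in>J. ball (fst i) (3 * snd i))"
      using finite_disjoint_subballs[OF I'(2)] .
    have J_fin: "finite J"
      using J(1) I'(2) by (rule finite_subset)
    have J_I: "0 < snd i" "c * emeasure \<mu> (ball (fst i) (snd i)) \<le> (\<integral>\<^sup>+x\<in>ball (fst i) (snd i). h x \<partial>\<mu>)"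
      if "i \<in> J" for i
      using that J(1) I'(1) by (auto simp: I_def)
    have "emeasure \<mu> K \<le> emeasure \<mu> (\<Union>i\<in>J. ball (fst i) (3 * snd i))"
      using I'(3) J(3) by (intro emeasure_mono) (auto intro!: borel_open open_UN)
    also have "\<dots> \<le> (\<Sum>i\<in>J. emeasure \<mu> (ball (fst i) (3 * snd i)))"
      using J_fin by (intro emeasure_subadditive_finite) auto
    also have "\<dots> \<le> (\<Sum>i\<in>J. ennreal D ^ 2 * emeasure \<mu> (ball (fst i) (snd i)))"
    proof (rule sum_mono)
      fix i assume "i \<in> J"
      have "emeasure \<mu> (ball (fst i) (3 * snd i)) \<le> emeasure \<mu> (ball (fst i) (2 ^ 2 * snd i))"
        using J_I(1)[OF \<open>i \<in> J\<close>] by (intro emeasure_mono) auto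
      also have "\<dots> \<le> ennreal D ^ 2 * emeasure \<mu> (ball (fst i) (snd i))"
        by (rule emeasure_ball_power_le[OF J_I(1)[OF \<open>i \<in> J\<close>]])
      finally show "emeasure \<mu> (ball (fst i) (3 * snd i)) \<le> ennreal D ^ 2 * emeasure \<mu> (ball (fst i) (snd i))" .
    qed
    finally have "c * emeasure \<mu> K \<le> c * (\<Sum>i\<in>J. ennreal D ^ 2 * emeasure \<mu> (ball (fst i) (snd i)))"
      by (rule mult_left_mono) simp
    also have "\<dots> = ennreal D ^ 2 * (\<Sum>i\<in>J. c * emeasure \<mu> (ball (fst i) (snd i)))"
      by (simp add: sum_distrib_left mult.left_commute)
    also have "\<dots> \<le> ennreal D ^ 2 * (\<Sum>i\<in>J. \<integral>\<^sup>+x\<in>ball (fst i) (snd i). h x \<partial>\<mu>)"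
      by (intro mult_left_mono sum_mono J_I) auto
    also have "(\<Sum>i\<in>J. \<integral>\<^sup>+x\<in>ball (fst i) (snd i). h x \<partial>\<mu>)
        = (\<integral>\<^sup>+x. (\<Sum>i\<in>J. h x * indicator (ball (fst i) (snd i)) x) \<partial>\<mu>)"
      by (intro nn_integral_sum[symmetric]) measurable
    also have "\<dots> = (\<integral>\<^sup>+x\<in>(\<Union>i\<in>J. ball (fst i) (snd i)). h x \<partial>\<mu>)"
      by (simp add: indicator_UN_disjoint[OF J_fin J(2)] sum_distrib_left)
    also have "\<dots> \<le> (\<integral>\<^sup>+x. h x \<partial>\<mu>)"
      by (intro nn_integral_mono) (auto split: split_indicator)
    finally show ?thesis by (simp add: mult_left_mono)
  qed
  then have "(SUP K\<in>{K. compact K \<and> K \<subseteq> maximal_superlevel \<mu> h c}. c * emeasure \<mu> K)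
      \<le> ennreal D ^ 2 * (\<integral>\<^sup>+x. h x \<partial>\<mu>)"
    by (intro SUP_least) auto
  moreover have "maximal_superlevel \<mu> h c \<in> sets borel"
    by (simp add: open_maximal_superlevel)
  ultimately show ?thesis
    by (simp add: compact_inner_regular SUP_mult_left_ennreal)
qed

text \<open>
  Near a point \<open>x\<close> where the maximal function is at most \<open>c\<close>, only balls of radius less than \<open>s\<close> can
  witness that it exceeds \<open>c'\<close> somewhere in \<open>ball x s\<close>: the double of a larger ball would contain \<open>x\<close>. So \<open>h\<close> may be cut
  off outside \<open>ball x (3 * s)\<close>, where its integral is controlled by the choice of \<open>x\<close>, and the weak type
  inequality applies.
\<close>

lemma density_maximal_superlevel:
  assumes [measurable]: "h \<in> borel_measurable borel"
    and x: "x \<notin> maximal_superlevel \<mu> h c" and s: "0 < s" and c': "ennreal D * c \<le> c'"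
  shows "c' * emeasure \<mu> (maximal_superlevel \<mu> h c' \<inter> ball x s) \<le> ennreal D ^ 4 * c * emeasure \<mu> (ball x s)"
proof -
  define h' where "h' y = h y * indicator (ball x (3 * s)) y" for y
  have sub: "maximal_superlevel \<mu> h c' \<inter> ball x s \<subseteq> maximal_superlevel \<mu> h' c'"
  proof
    fix z assume z: "z \<in> maximal_superlevel \<mu> h c' \<inter> ball x s"
    then have "z \<in> maximal_superlevel \<mu> h c'"
      by simp
    then obtain p r where pr: "z \<in> ball p r" "0 < r"
      "c' * emeasure \<mu> (ball p r) < (\<integral>\<^sup>+y\<in>ball p r. h y \<partial>\<mu>)"
      by (rule maximal_superlevelE)
    have "r < s"
    proof (rule ccontr)
      assume "\<not> r < s"
      then have "x \<in> ball p (2 * r)"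
        using pr(1) z dist_triangle[of p x z] by (auto simp: dist_commute)
      have "(\<integral>\<^sup>+y\<in>ball p r. h y \<partial>\<mu>) \<le> (\<integral>\<^sup>+y\<in>ball p (2 * r). h y \<partial>\<mu>)"
        using pr(2) by (intro nn_integral_mono mult_left_mono) (auto split: split_indicator)
      also have "\<dots> \<le> c * emeasure \<mu> (ball p (2 * r))"
        using x \<open>x \<in> ball p (2 * r)\<close> by (rule integral_le_outside_maximal_superlevel)
      also have "\<dots> \<le> c * (ennreal D * emeasure \<mu> (ball p r))"
        using pr(2) by (intro mult_left_mono doubling) auto
      also have "\<dots> = ennreal D * c * emeasure \<mu> (ball p r)"
        by (simp add: ac_simps)
      also have "\<dots> \<le> c' * emeasure \<mu> (ball p r)"
        using c' by (rule mult_right_mono) simp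
      finally show False
        using pr(3) by simp
    qed
    have "ball p r \<subseteq> ball x (3 * s)"
    proof
      fix y assume "y \<in> ball p r"
      then show "y \<in> ball x (3 * s)"
        using z pr(1) \<open>r < s\<close> dist_triangle[of x y z] dist_triangle3[of z y p] by (auto simp: dist_commute)
    qed
    then have "(\<integral>\<^sup>+y\<in>ball p r. h y \<partial>\<mu>) = (\<integral>\<^sup>+y\<in>ball p r. h' y \<partial>\<mu>)"
      unfolding h'_def by (intro nn_integral_cong) (auto split: split_indicator)
    then show "z \<in> maximal_superlevel \<mu> h' c'"
      using pr unfolding maximal_superlevel_def mem_Collect_eq by metis
  qed
  have [measurable]: "h' \<in> borel_measurable borel"
    unfolding h'_def by measurable
  have "c' * emeasure \<mu> (maximal_superlevel \<mu> h c' \<inter> ball x s) \<le> c' * emeasure \<mu> (maximal_superlevel \<mu> h' c')"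
    using sub by (intro mult_left_mono emeasure_mono) (auto simp: open_maximal_superlevel)
  also have "\<dots> \<le> ennreal D ^ 2 * (\<integral>\<^sup>+y\<in>ball x (3 * s). h y \<partial>\<mu>)"
    using weak_type_maximal[of h' c'] by (simp add: h'_def)
  also have "\<dots> \<le> ennreal D ^ 2 * (c * emeasure \<mu> (ball x (3 * s)))"
    using s by (intro mult_left_mono integral_le_outside_maximal_superlevel[OF x]) auto
  also have "\<dots> \<le> ennreal D ^ 2 * (c * emeasure \<mu> (ball x (2 ^ 2 * s)))"
    using s by (intro mult_left_mono emeasure_mono) auto
  also have "\<dots> \<le> ennreal D ^ 2 * (c * (ennreal D ^ 2 * emeasure \<mu> (ball x s)))"
    by (intro mult_left_mono emeasure_ball_power_le s) auto
  also have "\<dots> = (ennreal D ^ 2 * ennreal D ^ 2) * c * emeasure \<mu> (ball x s)"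
    by (simp only: ac_simps)
  also have "ennreal D ^ 2 * ennreal D ^ 2 = ennreal D ^ 4"
    by (simp flip: power_add)
  finally show ?thesis .
qed

end

section \<open>Young functions, Lipschitz extension and telescoping\<close>

text \<open>
  Convexity makes \<open>\<Phi>\<close> continuous on the open half line, unbounded, and at most \<open>\<Phi> 1 * t\<close> for small
  \<open>t\<close>, so the intermediate value theorem applies away from \<open>0\<close>.
\<close>

lemma strict_young_function_surj:
  assumes \<Phi>: "strict_young_function \<Phi>" and y: "0 \<le> y"
  shows "\<exists>t\<ge>0. \<Phi> t = y"
proof (cases "y = 0")
  case True
  then show ?thesis using \<Phi> by (auto simp: strict_young_function_def)
next
  case False
  have mono: "strict_mono_on {0..} \<Phi>" and conv: "convex_on {0..} \<Phi>" and zero: "\<Phi> 0 = 0"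
    using \<Phi> by (auto simp: strict_young_function_def)
  have one: "0 < \<Phi> 1"
    using strict_mono_onD[OF mono, of 0 1] zero by simp
  have star: "\<Phi> (s * t) \<le> s * \<Phi> t" if "0 \<le> s" "s \<le> 1" "0 \<le> t" for s t
    using convex_onD[OF conv, of s 0 t] that zero by simp
  \<comment> \<open>By convexity \<open>\<Phi> t\<close> is at most \<open>t * \<Phi> 1\<close> for \<open>t \<le> 1\<close> and at least that for \<open>t \<ge> 1\<close>.\<close>
  define a where "a = min 1 (y / \<Phi> 1)"
  define b where "b = max 1 (y / \<Phi> 1)"
  have a: "0 < a" "a \<le> 1" "a \<le> y / \<Phi> 1" and b: "1 \<le> b" "y / \<Phi> 1 \<le> b"
    using y False one by (auto simp: a_def b_def)
  have "\<Phi> a \<le> a * \<Phi> 1"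
    using star[of a 1] a by simp
  then have lo: "\<Phi> a \<le> y"
    using a one by (simp add: pos_le_divide_eq)
  have "\<Phi> 1 \<le> (1 / b) * \<Phi> b"
    using star[of "1 / b" b] b by simp
  then have hi: "y \<le> \<Phi> b"
    using b one by (simp add: pos_le_divide_eq pos_divide_le_eq mult.commute)
  have "continuous_on {0<..} \<Phi>"
    using conv by (intro convex_on_continuous) (auto intro: convex_on_subset)
  then have "continuous_on {a..b} \<Phi>"
    by (rule continuous_on_subset) (use a in auto)
  then obtain t where "a \<le> t" "\<Phi> t = y"
    using IVT'[of \<Phi> a y b] lo hi a b by auto
  then show ?thesis
    using a by (intro exI[of _ t]) auto
qed

lemma strict_young_inverse:
  assumes \<Phi>: "strict_young_function \<Phi>" and y: "0 \<le> y"
  shows "0 \<le> the_inv_into {0..} \<Phi> y" "\<Phi> (the_inv_into {0..} \<Phi> y) = y"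
proof -
  have inj: "inj_on \<Phi> {0..}"
    using \<Phi> by (auto simp: strict_young_function_def intro: strict_mono_on_imp_inj_on)
  have im: "y \<in> \<Phi> ` {0..}"
    using strict_young_function_surj[OF \<Phi> y] by auto
  show "\<Phi> (the_inv_into {0..} \<Phi> y) = y"
    using inj im by (rule f_the_inv_into_f)
  show "0 \<le> the_inv_into {0..} \<Phi> y"
    using the_inv_into_into[OF inj im, of "{0..}"] by auto
qed

lemma extend_infty_young_inverse_le:
  assumes \<Phi>: "strict_young_function \<Phi>" and y: "0 \<le> y" and t: "t \<le> ennreal y"
  shows "extend_infty (the_inv_into {0..} \<Phi>) t \<le> ennreal (the_inv_into {0..} \<Phi> y)"
proof -
  have mono: "strict_mono_on {0..} \<Phi>"
    using \<Phi> by (auto simp: strict_young_function_def)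
  define s where "s = enn2real t"
  have s: "t = ennreal s" "0 \<le> s"
    using t by (auto simp: s_def ennreal_enn2real_if top_unique)
  then have "s \<le> y"
    using t y by simp
  have "the_inv_into {0..} \<Phi> s \<le> the_inv_into {0..} \<Phi> y"
  proof (rule ccontr)
    assume "\<not> the_inv_into {0..} \<Phi> s \<le> the_inv_into {0..} \<Phi> y"
    then have "\<Phi> (the_inv_into {0..} \<Phi> y) < \<Phi> (the_inv_into {0..} \<Phi> s)"
      using strict_young_inverse[OF \<Phi> s(2)] strict_young_inverse[OF \<Phi> y]
      by (intro strict_mono_onD[OF mono]) auto
    then show False
      using strict_young_inverse[OF \<Phi> s(2)] strict_young_inverse[OF \<Phi> y] \<open>s \<le> y\<close> by simp
  qed
  then show ?thesis
    using s by (simp add: extend_infty_def ennreal_leI)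
qed

text \<open>
  McShane's extension, the infimum of the cones with slope \<open>L\<close> over the given values.
\<close>

lemma lipschitz_extension:
  fixes f :: "'a::metric_space \<Rightarrow> real"
  assumes F: "F \<noteq> {}" and L: "0 \<le> L" and f: "\<And>x y. x \<in> F \<Longrightarrow> y \<in> F \<Longrightarrow> \<bar>f x - f y\<bar> \<le> L * dist x y"
  obtains u where "L-lipschitz_on UNIV u" "\<And>x. x \<in> F \<Longrightarrow> u x = f x"
proof -
  define u where "u z = (INF w\<in>F. f w + L * dist z w)" for z
  obtain w\<^sub>0 where w\<^sub>0: "w\<^sub>0 \<in> F"
    using F by blast
  have bdd: "bdd_below ((\<lambda>w. f w + L * dist z w) ` F)" for z
  proof (rule bdd_belowI2[of _ "f w\<^sub>0 - L * dist z w\<^sub>0"])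
    fix w assume w: "w \<in> F"
    have "L * dist w w\<^sub>0 \<le> L * dist z w + L * dist z w\<^sub>0"
      using L dist_triangle3[of w w\<^sub>0 z] by (simp add: distrib_left[symmetric] mult_left_mono)
    then show "f w\<^sub>0 - L * dist z w\<^sub>0 \<le> f w + L * dist z w"
      using f[OF w w\<^sub>0] by linarith
  qed
  have le: "u z \<le> u z' + L * dist z z'" for z z'
  proof -
    have "u z - L * dist z z' \<le> f w + L * dist z' w" if w: "w \<in> F" for w
    proof -
      have "u z \<le> f w + L * dist z w"
        unfolding u_def using bdd w by (rule cINF_lower)
      moreover have "L * dist z w \<le> L * dist z z' + L * dist z' w"
        using L dist_triangle[of z w z'] by (simp add: distrib_left[symmetric] mult_left_mono)
      ultimately show ?thesis by linarith
    qed
    then have "u z - L * dist z z' \<le> u z'"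
      unfolding u_def[of z'] by (intro cINF_greatest F)
    then show ?thesis by simp
  qed
  have "L-lipschitz_on UNIV u"
  proof (rule lipschitz_onI)
    show "dist (u z) (u z') \<le> L * dist z z'" for z z'
      using le[of z z'] le[of z' z] by (auto simp: dist_real_def dist_commute abs_le_iff)
  qed (rule L)
  moreover have "u x = f x" if x: "x \<in> F" for x
  proof (rule antisym)
    show "u x \<le> f x"
      using cINF_lower[OF bdd x, of x] by (simp add: u_def)
    show "f x \<le> u x"
      unfolding u_def
    proof (intro cINF_greatest F)
      show "f x \<le> f w + L * dist x w" if "w \<in> F" for w
        using f[OF x that] by linarith
    qed
  qed
  ultimately show thesis using that by blast
qed

context doubling_space
begin

lemma nn_average_ball_le_iff:
  assumes "0 < r"
  shows "nn_average \<mu> (ball x r) g \<le> c \<longleftrightarrow> (\<integral>\<^sup>+y\<in>ball x r. g y \<partial>\<mu>) \<le> c * emeasure \<mu> (ball x r)"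
proof -
  define m where "m = emeasure \<mu> (ball x r)"
  have m: "m \<noteq> 0" "m \<noteq> top"
    using emeasure_ball_pos[OF assms, of x] emeasure_ball_finite[of x r] by (auto simp: m_def)
  define I where "I = (\<integral>\<^sup>+y\<in>ball x r. g y \<partial>\<mu>)"
  have "I / m * m = I"
    using m ennreal_mult_divide_eq[of m 1] by (simp add: ennreal_divide_times)
  then have "I \<le> c * m" if "I / m \<le> c"
    using mult_right_mono[OF that, of m] by simp
  moreover have "I / m \<le> c" if "I \<le> c * m"
    using divide_right_mono_ennreal[OF that, of m] ennreal_mult_divide_eq[of m c] m by simp
  ultimately show ?thesis
    unfolding nn_average_def m_def[symmetric] I_def[symmetric] by blast
qed

lemma set_integrable_ball_lipschitz:
  assumes "N-lipschitz_on UNIV (v :: 'a \<Rightarrow> real)"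
  shows "set_integrable \<mu> (ball x r) v"
  unfolding set_integrable_def
proof (rule integrableI_bounded_set_indicator[where B = "\<bar>v x\<bar> + N * r"])
  show "v \<in> borel_measurable \<mu>"
    using lipschitz_borel_measurable[OF assms] by simp
  have "norm (v y) \<le> \<bar>v x\<bar> + N * r" if "y \<in> ball x r" for y
  proof -
    have "N * dist x y \<le> N * r"
      using that lipschitz_on_nonneg[OF assms] by (intro mult_left_mono) auto
    then show ?thesis
      using lipschitz_onD[OF assms, of x y] by (auto simp: dist_real_def)
  qed
  then show "AE y in \<mu>. y \<in> ball x r \<longrightarrow> norm (v y) \<le> \<bar>v x\<bar> + N * r"
    by auto
qed (use emeasure_ball_finite in auto)

lemma average_ball_diff_le:
  assumes v: "set_integrable \<mu> (ball x r) v" and r: "0 < r" and K: "0 \<le> K"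
    and le: "(\<integral>\<^sup>+y\<in>ball x r. ennreal \<bar>v y - m\<bar> \<partial>\<mu>) \<le> ennreal K * emeasure \<mu> (ball x r)"
  shows "\<bar>average \<mu> (ball x r) v - m\<bar> \<le> K"
proof -
  define B where "B = ball x r"
  define b where "b = measure \<mu> B"
  have b: "0 < b" "emeasure \<mu> B = ennreal b"
    using measure_ball_pos[OF r] emeasure_ball by (auto simp: b_def B_def)
  have const: "set_integrable \<mu> B (\<lambda>_. m)"
    unfolding set_integrable_def using b(2) by (simp add: B_def)
  have "(LINT y:B|\<mu>. v y - m) = (LINT y:B|\<mu>. v y) - (LINT y:B|\<mu>. m)"
    using v const by (intro set_integral_diff) (auto simp: B_def)
  also have "(LINT y:B|\<mu>. m) = m * b"
    by (simp add: set_lebesgue_integral_def b_def B_def)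
  finally have eq: "(LINT y:B|\<mu>. v y - m) = b * (average \<mu> B v - m)"
    using b(1) by (simp add: average_def b_def[symmetric] right_diff_distrib mult.commute)
  have "set_integrable \<mu> B (\<lambda>y. v y - m)"
    using v const by (intro set_integral_diff) (auto simp: B_def)
  then have "ennreal (norm (LINT y:B|\<mu>. v y - m)) \<le> (\<integral>\<^sup>+y. ennreal (norm (indicator B y *\<^sub>R (v y - m))) \<partial>\<mu>)"
    unfolding set_integrable_def set_lebesgue_integral_def by (rule integral_norm_bound_ennreal)
  also have "\<dots> = (\<integral>\<^sup>+y\<in>B. ennreal \<bar>v y - m\<bar> \<partial>\<mu>)"
    by (intro nn_integral_cong) (auto split: split_indicator)
  also have "\<dots> \<le> ennreal (K * b)"
    using le b K by (simp add: B_def[symmetric] ennreal_mult)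
  finally have "b * \<bar>average \<mu> B v - m\<bar> \<le> K * b"
    using b K by (simp add: eq abs_mult)
  then show ?thesis
    using b by (simp add: B_def[symmetric] mult.commute)
qed

lemma average_comparison:
  assumes v: "N-lipschitz_on UNIV (v :: 'a \<Rightarrow> real)"
    and balls: "ball y s \<subseteq> ball x r" "0 < s" "0 < r" "measure \<mu> (ball x r) \<le> M * measure \<mu> (ball y s)"
    and osc: "mean_oscillation \<mu> (ball x r) v \<le> ennreal k" "0 \<le> k" "0 \<le> M"
  shows "\<bar>average \<mu> (ball y s) v - average \<mu> (ball x r) v\<bar> \<le> M * k"
proof (rule average_ball_diff_le[OF set_integrable_ball_lipschitz[OF v]])
  define m where "m = average \<mu> (ball x r) v"
  have "(\<integral>\<^sup>+z\<in>ball y s. ennreal \<bar>v z - m\<bar> \<partial>\<mu>) \<le> (\<integral>\<^sup>+z\<in>ball x r. ennreal \<bar>v z - m\<bar> \<partial>\<mu>)"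
    using balls(1) by (intro nn_integral_mono mult_left_mono) (auto split: split_indicator)
  also have "\<dots> \<le> ennreal k * emeasure \<mu> (ball x r)"
    using osc balls(3) by (simp add: mean_oscillation_def nn_average_ball_le_iff m_def)
  also have "\<dots> \<le> ennreal k * ennreal (M * measure \<mu> (ball y s))"
    using balls(4) by (intro mult_left_mono) (auto simp: emeasure_ball intro: ennreal_leI)
  also have "\<dots> = ennreal (M * k) * emeasure \<mu> (ball y s)"
    using osc by (simp add: emeasure_ball ennreal_mult ac_simps)
  finally show "(\<integral>\<^sup>+z\<in>ball y s. ennreal \<bar>v z - average \<mu> (ball x r) v\<bar> \<partial>\<mu>)
      \<le> ennreal (M * k) * emeasure \<mu> (ball y s)"
    by (simp add: m_def)
qed (use assms in auto)

text \<open>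
  Telescoping over the balls with radii \<open>s / 2 ^ n\<close>: consecutive averages differ by at most \<open>D\<close> times the
  mean oscillation on the larger ball, and these bounds form a geometric series.
\<close>

lemma value_minus_ball_average_le:
  assumes v: "N-lipschitz_on UNIV (v :: 'a \<Rightarrow> real)" and \<kappa>: "0 \<le> \<kappa>"
    and osc: "\<And>s. 0 < s \<Longrightarrow> mean_oscillation \<mu> (ball x s) v \<le> ennreal (\<kappa> * s)"
    and s: "0 < s"
  shows "\<bar>v x - average \<mu> (ball x s) v\<bar> \<le> 2 * D * \<kappa> * s"
proof -
  define a where "a n = average \<mu> (ball x (s / 2 ^ n)) v" for n
  have step: "\<bar>a (Suc n) - a n\<bar> \<le> D * (\<kappa> * (s / 2 ^ n))" for n
    unfolding a_def
  proof (rule average_comparison[OF v])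
    show "measure \<mu> (ball x (s / 2 ^ n)) \<le> D * measure \<mu> (ball x (s / 2 ^ Suc n))"
      using measure_ball_double[of "s / 2 ^ Suc n" x] s by simp
    have "s / 2 ^ Suc n \<le> s / 2 ^ n"
      using s by (simp add: field_simps)
    then show "ball x (s / 2 ^ Suc n) \<subseteq> ball x (s / 2 ^ n)"
      by (rule subset_ball)
    show "mean_oscillation \<mu> (ball x (s / 2 ^ n)) v \<le> ennreal (\<kappa> * (s / 2 ^ n))"
      using s by (intro osc) simp
  qed (use s \<kappa> D_ge_1 in auto)
  have tele: "\<bar>a n - a 0\<bar> \<le> 2 * D * \<kappa> * s * (1 - 1 / 2 ^ n)" for n
  proof (induction n)
    case (Suc n)
    have "\<bar>a (Suc n) - a 0\<bar> \<le> D * (\<kappa> * (s / 2 ^ n)) + 2 * D * \<kappa> * s * (1 - 1 / 2 ^ n)"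
      using Suc step[of n] by linarith
    also have "\<dots> = 2 * D * \<kappa> * s * (1 - 1 / 2 ^ Suc n)"
      by (simp add: field_simps)
    finally show ?case .
  qed simp
  have N: "0 \<le> N"
    using v by (rule lipschitz_on_nonneg)
  have close: "\<bar>a n - v x\<bar> \<le> N * (s / 2 ^ n)" for n
    unfolding a_def
  proof (rule average_ball_diff_le[OF set_integrable_ball_lipschitz[OF v]])
    have "(\<integral>\<^sup>+y\<in>ball x (s / 2 ^ n). ennreal \<bar>v y - v x\<bar> \<partial>\<mu>)
        \<le> (\<integral>\<^sup>+y. ennreal (N * (s / 2 ^ n)) * indicator (ball x (s / 2 ^ n)) y \<partial>\<mu>)"
    proof (intro nn_integral_mono)
      fix y
      show "ennreal \<bar>v y - v x\<bar> * indicator (ball x (s / 2 ^ n)) y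
          \<le> ennreal (N * (s / 2 ^ n)) * indicator (ball x (s / 2 ^ n)) y"
      proof (cases "y \<in> ball x (s / 2 ^ n)")
        case True
        then have "N * dist x y \<le> N * (s / 2 ^ n)"
          using N by (intro mult_left_mono) auto
        then have "\<bar>v y - v x\<bar> \<le> N * (s / 2 ^ n)"
          using lipschitz_onD[OF v, of x y] by (simp add: dist_real_def abs_minus_commute)
        then show ?thesis
          by (intro mult_right_mono ennreal_leI) auto
      qed simp
    qed
    then show "(\<integral>\<^sup>+y\<in>ball x (s / 2 ^ n). ennreal \<bar>v y - v x\<bar> \<partial>\<mu>)
        \<le> ennreal (N * (s / 2 ^ n)) * emeasure \<mu> (ball x (s / 2 ^ n))"
      by (simp add: nn_integral_cmult_indicator)
  qed (use s N in auto)
  have "\<bar>v x - a 0\<bar> \<le> 2 * D * \<kappa> * s + N * s * (1 / 2) ^ n" for n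
  proof -
    have "2 * D * \<kappa> * s * (1 - 1 / 2 ^ n) \<le> 2 * D * \<kappa> * s * 1"
      using s \<kappa> D_ge_1 by (intro mult_left_mono) auto
    moreover have "N * (s / 2 ^ n) = N * s * (1 / 2) ^ n"
      by (simp add: power_one_over)
    ultimately show ?thesis
      using tele[of n] close[of n] by linarith
  qed
  moreover have "(\<lambda>n. 2 * D * \<kappa> * s + N * s * (1 / 2) ^ n) \<longlonglongrightarrow> 2 * D * \<kappa> * s + N * s * 0"
    by (intro tendsto_intros LIMSEQ_power_zero) auto
  ultimately have "\<bar>v x - a 0\<bar> \<le> 2 * D * \<kappa> * s"
    by (intro LIMSEQ_le_const[where X = "\<lambda>n. 2 * D * \<kappa> * s + N * s * (1 / 2) ^ n"]) auto
  then show ?thesis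
    by (simp add: a_def)
qed

text \<open>
  With \<open>d = dist x y\<close>, the averages over \<open>ball x d\<close> and \<open>ball y (2 * d)\<close> are compared inside the latter.
\<close>

lemma pointwise_from_mean_oscillation:
  assumes v: "N-lipschitz_on UNIV (v :: 'a \<Rightarrow> real)" and \<kappa>: "0 \<le> \<kappa>"
    and osc: "\<And>s. 0 < s \<Longrightarrow> mean_oscillation \<mu> (ball x s) v \<le> ennreal (\<kappa> * s)"
      "\<And>s. 0 < s \<Longrightarrow> mean_oscillation \<mu> (ball y s) v \<le> ennreal (\<kappa> * s)"
  shows "\<bar>v x - v y\<bar> \<le> 8 * D ^ 2 * \<kappa> * dist x y"
proof (cases "x = y")
  case False
  define d where "d = dist x y"
  have d: "0 < d" using False by (simp add: d_def)
  have sub: "ball x d \<subseteq> ball y (2 * d)" "ball y (2 * d) \<subseteq> ball x (2 * (2 * d))"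
    using d dist_triangle[of y _ x] dist_triangle[of x _ y]
    by (auto simp: d_def dist_commute subset_iff) (smt (verit) dist_commute)+
  have "measure \<mu> (ball y (2 * d)) \<le> D * (D * measure \<mu> (ball x d))"
  proof -
    have "measure \<mu> (ball y (2 * d)) \<le> measure \<mu> (ball x (2 * (2 * d)))"
      using sub(2) by (rule measure_ball_mono)
    also have "\<dots> \<le> D * measure \<mu> (ball x (2 * d))"
      using d by (intro measure_ball_double) simp
    also have "\<dots> \<le> D * (D * measure \<mu> (ball x d))"
      using d D_ge_1 by (intro mult_left_mono measure_ball_double) auto
    finally show ?thesis .
  qed
  then have "\<bar>average \<mu> (ball x d) v - average \<mu> (ball y (2 * d)) v\<bar> \<le> D ^ 2 * (\<kappa> * (2 * d))"
    using d \<kappa> osc(2)[of "2 * d"]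
    by (intro average_comparison[OF v sub(1)]) (auto simp: power2_eq_square mult.assoc)
  moreover have "\<bar>v x - average \<mu> (ball x d) v\<bar> \<le> 2 * D * \<kappa> * d"
    by (rule value_minus_ball_average_le[OF v \<kappa> osc(1) d])
  moreover have "\<bar>v y - average \<mu> (ball y (2 * d)) v\<bar> \<le> 2 * D * \<kappa> * (2 * d)"
    using d by (intro value_minus_ball_average_le[OF v \<kappa> osc(2)]) auto
  ultimately have "\<bar>v x - v y\<bar> \<le> D ^ 2 * (\<kappa> * (2 * d)) + 2 * D * \<kappa> * d + 2 * D * \<kappa> * (2 * d)"
    by linarith
  also have "\<dots> = (2 * D ^ 2 + 6 * D) * (\<kappa> * d)"
    by (simp add: algebra_simps)
  also have "\<dots> \<le> (8 * D ^ 2) * (\<kappa> * d)"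
    using D_ge_1 \<kappa> d by (intro mult_right_mono) (auto simp: power2_eq_square)
  finally show ?thesis
    by (simp add: d_def mult.assoc)
qed simp

end

section \<open>The pointwise estimate on the whole space\<close>

lemma lsc_borel_measurable:
  fixes g :: "'a::topological_space \<Rightarrow> real"
  assumes "\<And>a. open {z. a < g z}"
  shows "g \<in> borel_measurable borel"
  unfolding borel_measurable_iff_greater using assms by (auto intro: borel_open)

context doubling_space
begin

text \<open>
  A lower semicontinuous \<open>g\<close> is, near each point, larger than any number below its value there, so at every
  point it is bounded by the means over small balls, hence by its maximal function.
\<close>

lemma lower_semicontinuous_le_outside_maximal_superlevel:
  fixes g :: "'a \<Rightarrow> real"
  assumes lsc: "\<And>a. open {z. a < g z}" and t: "0 \<le> t"
    and z: "z \<notin> maximal_superlevel \<mu> (\<lambda>z. ennreal (g z ^ q)) (ennreal (t ^ q))" and q: "0 < q"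
  shows "g z \<le> t"
proof (rule ccontr)
  assume "\<not> g z \<le> t"
  then obtain a where a: "t < a" "a < g z"
    using dense[of t "g z"] by auto
  obtain r where r: "0 < r" "ball z r \<subseteq> {z. a < g z}"
    using lsc[of a] a(2) open_contains_ball by blast
  have "ennreal (a ^ q) * emeasure \<mu> (ball z r) = (\<integral>\<^sup>+y. ennreal (a ^ q) * indicator (ball z r) y \<partial>\<mu>)"
    by (simp add: nn_integral_cmult_indicator)
  also have "\<dots> \<le> (\<integral>\<^sup>+y\<in>ball z r. ennreal (g y ^ q) \<partial>\<mu>)"
  proof (intro nn_integral_mono)
    fix y
    show "ennreal (a ^ q) * indicator (ball z r) y \<le> ennreal (g y ^ q) * indicator (ball z r) y"
    proof (cases "y \<in> ball z r")
      case True
      then have "a \<le> g y"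
        using r(2) by auto
      then show ?thesis
        using a t by (intro mult_right_mono ennreal_leI power_mono) auto
    qed simp
  qed
  also have "\<dots> \<le> ennreal (t ^ q) * emeasure \<mu> (ball z r)"
    using z r(1) by (intro integral_le_outside_maximal_superlevel) auto
  finally have "a ^ q * measure \<mu> (ball z r) \<le> t ^ q * measure \<mu> (ball z r)"
    using a t by (simp add: emeasure_ball ennreal_mult[symmetric])
  then have "a ^ q \<le> t ^ q"
    using measure_ball_pos[OF r(1), of z] by simp
  moreover have "t ^ q < a ^ q"
    using a(1) t q by (intro power_strict_mono) auto
  ultimately show False by simp
qed

lemma lipschitz_locally_integrable:
  assumes "N-lipschitz_on UNIV (v :: 'a \<Rightarrow> real)"
  shows "locally_integrable \<mu> v"
  unfolding locally_integrable_def
  by (intro allI exI[of _ 1] conjI set_integrable_ball_lipschitz[OF assms]) simp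

end

text \<open>
  The constants of the strong Orlicz-Poincare inequality are fixed once and for all, since \<open>q\<close> and the
  constants of the conclusion are computed from them.
\<close>

locale orlicz_poincare_space = doubling_space +
  fixes \<Phi> :: "real \<Rightarrow> real" and C \<tau> :: real
  assumes young: "strict_young_function \<Phi>"
    and C_pos: "0 < C" and tau_ge_1: "1 \<le> \<tau>"
    and orlicz_poincare: "\<And>x r u g. 0 < r \<Longrightarrow> locally_integrable \<mu> u \<Longrightarrow> upper_gradient u g \<Longrightarrow>
        mean_oscillation \<mu> (ball x r) u
          \<le> ennreal (C * r) * extend_infty (the_inv_into {0..} \<Phi>)
               (nn_average \<mu> (ball x (\<tau> * r)) (\<lambda>y. extend_infty \<Phi> (g y)))"
begin

text \<open>
  The Lipschitz constant, up to a power of \<open>D\<close>, that the Orlicz-Poincare inequality provides when all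
  \<open>\<Phi>\<close>-means of the upper gradient are at most \<open>\<Phi> 1 + 1\<close>.
\<close>

definition \<kappa> where "\<kappa> = C * the_inv_into {0..} \<Phi> (\<Phi> 1 + 1)"

lemma Phi_nonneg: "0 \<le> t \<Longrightarrow> 0 \<le> \<Phi> t"
  using young by (auto simp: strict_young_function_def)

lemma Phi_mono: "0 \<le> s \<Longrightarrow> s \<le> t \<Longrightarrow> \<Phi> s \<le> \<Phi> t"
  using young strict_mono_on_leD[of "{0..}" \<Phi> s t] by (auto simp: strict_young_function_def)

lemma kappa_nonneg: "0 \<le> \<kappa>"
  using strict_young_inverse(1)[OF young, of "\<Phi> 1 + 1"] Phi_nonneg[of 1] C_pos by (simp add: \<kappa>_def)

text \<open>
  The \<open>\<Phi>\<close>-mean of \<open>G\<close> is at most \<open>\<Phi> 1\<close> plus the contribution of \<open>E\<close>, which sparseness bounds by \<open>1\<close>. So the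
  bound does not involve \<open>\<Lambda>\<close>, and \<open>\<Lambda>\<close> can be chosen large compared with it.
\<close>

lemma mean_oscillation_le_outside_sparse_set:
  assumes v: "N-lipschitz_on UNIV (v :: 'a \<Rightarrow> real)"
    and G: "upper_gradient v (\<lambda>z. ennreal (G z))" "\<And>z. 0 \<le> G z"
    and E: "E \<in> sets borel" "\<And>z. z \<notin> E \<Longrightarrow> G z \<le> 1" "\<And>z. G z \<le> \<Lambda>"
    and sparse: "\<Phi> \<Lambda> * measure \<mu> (E \<inter> ball x (\<tau> * s)) \<le> measure \<mu> (ball x (\<tau> * s))"
    and s: "0 < s"
  shows "mean_oscillation \<mu> (ball x s) v \<le> ennreal (\<kappa> * s)"
proof -
  define B where "B = ball x (\<tau> * s)"
  have \<tau>s: "0 < \<tau> * s"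
    using s tau_ge_1 by simp
  have \<Lambda>: "0 \<le> \<Lambda>"
    using G(2) E(3) order_trans by blast
  have EB: "emeasure \<mu> (E \<inter> B) = ennreal (measure \<mu> (E \<inter> B))"
  proof (rule emeasure_eq_ennreal_measure)
    have "emeasure \<mu> (E \<inter> B) \<le> emeasure \<mu> B"
      by (intro emeasure_mono) (auto simp: B_def)
    then show "emeasure \<mu> (E \<inter> B) \<noteq> top"
      using emeasure_ball_finite[of x "\<tau> * s"] by (auto simp: B_def top_unique)
  qed
  have "(\<integral>\<^sup>+z\<in>B. extend_infty \<Phi> (ennreal (G z)) \<partial>\<mu>)
      \<le> (\<integral>\<^sup>+z. ennreal (\<Phi> 1) * indicator B z + ennreal (\<Phi> \<Lambda>) * indicator (E \<inter> B) z \<partial>\<mu>)"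
  proof (intro nn_integral_mono)
    fix z
    have "\<Phi> (G z) \<le> \<Phi> \<Lambda>" "z \<notin> E \<Longrightarrow> \<Phi> (G z) \<le> \<Phi> 1"
      using G E by (auto intro!: Phi_mono)
    then show "extend_infty \<Phi> (ennreal (G z)) * indicator B z
        \<le> ennreal (\<Phi> 1) * indicator B z + ennreal (\<Phi> \<Lambda>) * indicator (E \<inter> B) z"
      using G(2) by (auto simp: extend_infty_def add_increasing ennreal_leI split: split_indicator)
  qed
  also have "\<dots> = ennreal (\<Phi> 1) * emeasure \<mu> B + ennreal (\<Phi> \<Lambda>) * emeasure \<mu> (E \<inter> B)"
    using E(1) by (subst nn_integral_add) (auto simp: nn_integral_cmult_indicator B_def)
  also have "\<dots> = ennreal (\<Phi> 1 * measure \<mu> B + \<Phi> \<Lambda> * measure \<mu> (E \<inter> B))"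
    using Phi_nonneg[of 1] Phi_nonneg[OF \<Lambda>] emeasure_ball[of x "\<tau> * s"] EB
    by (simp add: B_def ennreal_mult)
  also have "\<dots> \<le> ennreal ((\<Phi> 1 + 1) * measure \<mu> B)"
    using sparse by (intro ennreal_leI) (simp add: B_def distrib_right)
  also have "\<dots> = ennreal (\<Phi> 1 + 1) * emeasure \<mu> B"
    using Phi_nonneg[of 1] emeasure_ball[of x "\<tau> * s"] by (simp add: B_def ennreal_mult)
  finally have "nn_average \<mu> (ball x (\<tau> * s)) (\<lambda>z. extend_infty \<Phi> (ennreal (G z))) \<le> ennreal (\<Phi> 1 + 1)"
    unfolding nn_average_ball_le_iff[OF \<tau>s] B_def .
  then have "extend_infty (the_inv_into {0..} \<Phi>)
      (nn_average \<mu> (ball x (\<tau> * s)) (\<lambda>z. extend_infty \<Phi> (ennreal (G z)))) \<le> ennreal (the_inv_into {0..} \<Phi> (\<Phi> 1 + 1))"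
    using Phi_nonneg[of 1] by (intro extend_infty_young_inverse_le[OF young]) auto
  then have "ennreal (C * s) * extend_infty (the_inv_into {0..} \<Phi>)
      (nn_average \<mu> (ball x (\<tau> * s)) (\<lambda>z. extend_infty \<Phi> (ennreal (G z))))
      \<le> ennreal (C * s) * ennreal (the_inv_into {0..} \<Phi> (\<Phi> 1 + 1))"
    by (rule mult_left_mono) simp
  also have "\<dots> = ennreal (\<kappa> * s)"
    using C_pos s by (simp add: \<kappa>_def ennreal_mult'[symmetric] ac_simps)
  finally show ?thesis
    using orlicz_poincare[OF s lipschitz_locally_integrable[OF v] G(1), of x] by (rule order_trans[rotated])
qed

lemma sparse_maximal_superlevel:
  assumes h: "h \<in> borel_measurable borel" and c: "0 < c" and x: "x \<notin> maximal_superlevel \<mu> h (ennreal (c ^ q))"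
    and q: "D \<le> 2 ^ q" "M * D ^ 4 \<le> 2 ^ q" and s: "0 < s"
  shows "M * measure \<mu> (maximal_superlevel \<mu> h (ennreal ((2 * c) ^ q)) \<inter> ball x s) \<le> measure \<mu> (ball x s)"
proof -
  define E where "E = maximal_superlevel \<mu> h (ennreal ((2 * c) ^ q)) \<inter> ball x s"
  have E: "emeasure \<mu> E = ennreal (measure \<mu> E)"
  proof (rule emeasure_eq_ennreal_measure)
    have "emeasure \<mu> E \<le> emeasure \<mu> (ball x s)"
      by (intro emeasure_mono) (auto simp: E_def)
    then show "emeasure \<mu> E \<noteq> top"
      using emeasure_ball_finite[of x s] by (auto simp: top_unique)
  qed
  have "ennreal D * ennreal (c ^ q) \<le> ennreal ((2 * c) ^ q)"
    using q(1) c D_ge_1 by (simp add: ennreal_mult[symmetric] power_mult_distrib ennreal_leI mult_right_mono)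
  then have "ennreal ((2 * c) ^ q) * emeasure \<mu> E \<le> ennreal D ^ 4 * ennreal (c ^ q) * emeasure \<mu> (ball x s)"
    unfolding E_def by (intro density_maximal_superlevel h x s)
  then have "(2 * c) ^ q * measure \<mu> E \<le> D ^ 4 * c ^ q * measure \<mu> (ball x s)"
    using c D_ge_1 by (simp add: E emeasure_ball ennreal_mult[symmetric] ennreal_power)
  then have "c ^ q * (2 ^ q * measure \<mu> E) \<le> c ^ q * (D ^ 4 * measure \<mu> (ball x s))"
    by (simp add: power_mult_distrib ac_simps)
  then have "2 ^ q * measure \<mu> E \<le> D ^ 4 * measure \<mu> (ball x s)"
    using c by simp
  moreover have "M * D ^ 4 * measure \<mu> E \<le> 2 ^ q * measure \<mu> E"
    using q(2) by (rule mult_right_mono) simp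
  ultimately have "D ^ 4 * (M * measure \<mu> E) \<le> D ^ 4 * measure \<mu> (ball x s)"
    by (simp add: ac_simps)
  then show ?thesis
    using D_ge_1 by (simp add: E_def)
qed

text \<open>
  The self-improvement step described at the beginning. Rescaling so that the Lipschitz
  constant \<open>L = 2 A c\<close> of the extension becomes \<open>\<Lambda>\<close> turns the bound \<open>2 c\<close> off the exceptional set into
  \<open>\<Lambda> / A \<le> 1\<close>. The oscillation estimate then gives \<open>8 D\<^sup>2 \<kappa> \<le> \<Lambda> / 4\<close>, which is a quarter of the
  Lipschitz constant; scaled back this is \<open>L / 4 = A c / 2\<close>.
\<close>

lemma hajlasz_constant_halving:
  fixes f g :: "'a \<Rightarrow> real"
  assumes g: "\<And>z. 0 \<le> g z" "\<And>a. open {z. a < g z}" "variation_dominated f g"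
    and \<Lambda>: "1 \<le> \<Lambda>" "32 * D ^ 2 * \<kappa> \<le> \<Lambda>"
    and q: "0 < q" "D \<le> 2 ^ q" "\<Phi> \<Lambda> * D ^ 4 \<le> 2 ^ q"
    and c: "0 < c" and A: "\<Lambda> \<le> A"
  defines "E \<equiv> \<lambda>t. maximal_superlevel \<mu> (\<lambda>z. ennreal (g z ^ q)) (ennreal (t ^ q))"
  assumes lip: "\<And>z w. z \<notin> E (2 * c) \<Longrightarrow> w \<notin> E (2 * c) \<Longrightarrow> \<bar>f z - f w\<bar> \<le> A * (2 * c) * dist z w"
    and xy: "x \<notin> E c" "y \<notin> E c"
  shows "\<bar>f x - f y\<bar> \<le> A / 2 * c * dist x y"
proof -
  define L where "L = A * (2 * c)"
  have L: "0 < L"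
    using A \<Lambda> c by (simp add: L_def)
  have g_borel: "g \<in> borel_measurable borel"
    using g(2) by (rule lsc_borel_measurable)
  have h_borel: "(\<lambda>z. ennreal (g z ^ q)) \<in> borel_measurable borel"
    using g_borel by measurable
  have "E (2 * c) \<subseteq> E c"
    unfolding E_def using c by (intro maximal_superlevel_antimono ennreal_leI power_mono) auto
  then have xy': "x \<notin> E (2 * c)" "y \<notin> E (2 * c)"
    using xy by auto
  obtain u where u: "L-lipschitz_on UNIV u" "\<And>z. z \<in> - E (2 * c) \<Longrightarrow> u z = f z"
    using lipschitz_extension[of "- E (2 * c)" L f] lip xy' L by (auto simp: L_def)
  have E_borel: "E t \<in> sets borel" for t
    by (simp add: E_def open_maximal_superlevel)
  \<comment> \<open>Off \<open>E (2 * c)\<close> the extension agrees with \<open>f\<close>, and everywhere it is \<open>L\<close>-Lipschitz.\<close>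
  define G where "G z = (if z \<in> - E (2 * c) then g z else L)" for z
  have G_dom: "variation_dominated u G"
    unfolding G_def
    by (rule variation_dominated_cases[OF g(3) variation_dominated_lipschitz[OF u(1)]])
      (use E_borel g_borel u(2) in auto)
  have G_borel: "G \<in> borel_measurable borel"
    unfolding G_def using E_borel g_borel by (intro measurable_If_set) auto
  define k where "k = \<Lambda> / L"
  have k: "0 < k"
    using \<Lambda> L by (simp add: k_def)
  define v where "v z = k * u z" for z
  have v: "(k * L)-lipschitz_on UNIV v"
    unfolding v_def using k by (intro lipschitz_on_cmult_real_nonneg u(1)) auto
  have v_ug: "upper_gradient v (\<lambda>z. ennreal (k * G z))"
    unfolding v_def using k
    by (intro variation_dominated_imp_upper_gradient G_dom G_borel lipschitz_on_continuous_on[OF u(1)]) auto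
  have g_le: "g z \<le> 2 * c" if "z \<notin> E (2 * c)" for z
    using c that q(1) unfolding E_def by (intro lower_semicontinuous_le_outside_maximal_superlevel[OF g(2)]) auto
  have kG_nonneg: "0 \<le> k * G z" for z
    using k L g(1) by (simp add: G_def)
  have kG_small: "k * G z \<le> 1" if "z \<notin> E (2 * c)" for z
  proof -
    have "k * G z \<le> k * (2 * c)"
      using that g_le k by (simp add: G_def)
    also have "\<dots> = \<Lambda> / A"
      using c L by (simp add: k_def L_def)
    also have "\<dots> \<le> 1"
      using A \<Lambda> by simp
    finally show ?thesis .
  qed
  have kG_le: "k * G z \<le> \<Lambda>" for z
  proof (cases "z \<in> E (2 * c)")
    case True
    then show ?thesis using L by (simp add: G_def k_def)
  next
    case False
    then show ?thesis using kG_small \<Lambda>(1) order_trans by blast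
  qed
  have osc: "mean_oscillation \<mu> (ball z s) v \<le> ennreal (\<kappa> * s)" if "z \<notin> E c" "0 < s" for z s
  proof (rule mean_oscillation_le_outside_sparse_set[OF v v_ug kG_nonneg E_borel kG_small kG_le _ that(2)])
    show "\<Phi> \<Lambda> * measure \<mu> (E (2 * c) \<inter> ball z (\<tau> * s)) \<le> measure \<mu> (ball z (\<tau> * s))"
      using that tau_ge_1 unfolding E_def by (intro sparse_maximal_superlevel h_borel c q) auto
  qed
  have "\<bar>v x - v y\<bar> \<le> 8 * D ^ 2 * \<kappa> * dist x y"
    using xy by (intro pointwise_from_mean_oscillation[OF v kappa_nonneg] osc)
  also have "\<dots> \<le> \<Lambda> / 4 * dist x y"
    using \<Lambda>(2) by (intro mult_right_mono) auto
  finally have "k * \<bar>u x - u y\<bar> \<le> \<Lambda> / 4 * dist x y"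
    using k by (simp add: v_def right_diff_distrib[symmetric] abs_mult)
  then have "\<bar>u x - u y\<bar> \<le> \<Lambda> / 4 * dist x y / k"
    using k by (subst pos_le_divide_eq) (simp_all add: ac_simps)
  also have "\<dots> = A / 2 * c * dist x y"
    using \<Lambda>(1) L by (simp add: k_def L_def)
  finally show ?thesis
    using u(2) xy' by simp
qed

text \<open>
  On levels \<open>t \<ge> c\<close> the estimate holds with the constant \<open>N / c\<close>, simply because \<open>f\<close> is
  \<open>N\<close>-Lipschitz. The halving step at level \<open>t\<close> uses the estimate at level \<open>2 t\<close>, which is again at least \<open>c\<close>, so it can
  be iterated until the constant drops to \<open>\<Lambda>\<close>.
\<close>

lemma hajlasz_estimate:
  fixes f g :: "'a \<Rightarrow> real"
  assumes f: "N-lipschitz_on UNIV f"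
    and g: "\<And>z. 0 \<le> g z" "\<And>a. open {z. a < g z}" "variation_dominated f g"
    and \<Lambda>: "1 \<le> \<Lambda>" "32 * D ^ 2 * \<kappa> \<le> \<Lambda>"
    and q: "0 < q" "D \<le> 2 ^ q" "\<Phi> \<Lambda> * D ^ 4 \<le> 2 ^ q"
    and c: "0 < c"
    and xy: "x \<notin> maximal_superlevel \<mu> (\<lambda>z. ennreal (g z ^ q)) (ennreal (c ^ q))"
      "y \<notin> maximal_superlevel \<mu> (\<lambda>z. ennreal (g z ^ q)) (ennreal (c ^ q))"
  shows "\<bar>f x - f y\<bar> \<le> \<Lambda> * c * dist x y"
proof -
  define E where "E t = maximal_superlevel \<mu> (\<lambda>z. ennreal (g z ^ q)) (ennreal (t ^ q))" for t
  define A where "A n = max \<Lambda> (N / c / 2 ^ n)" for n :: nat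
  have bound: "\<bar>f z - f w\<bar> \<le> A n * t * dist z w" if "c \<le> t" "z \<notin> E t" "w \<notin> E t" for n t z w
    using that
  proof (induction n arbitrary: t z w)
    case 0
    have "0 \<le> N"
      using f by (rule lipschitz_on_nonneg)
    then have "N \<le> N / c * t"
      using c 0(1) by (simp add: field_simps mult_left_mono)
    also have "\<dots> \<le> A 0 * t"
      using c 0(1) by (intro mult_right_mono) (auto simp: A_def)
    finally have "N * dist z w \<le> A 0 * t * dist z w"
      by (rule mult_right_mono) simp
    then show ?case
      using lipschitz_onD[OF f, of z w] by (simp add: dist_real_def)
  next
    case (Suc n)
    have "\<bar>f z - f w\<bar> \<le> A n / 2 * t * dist z w"
    proof (rule hajlasz_constant_halving[OF g \<Lambda> q])
      show "0 < t" "\<Lambda> \<le> A n"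
        using c Suc.prems by (auto simp: A_def)
      show "\<bar>f z' - f w'\<bar> \<le> A n * (2 * t) * dist z' w'"
        if "z' \<notin> maximal_superlevel \<mu> (\<lambda>z. ennreal (g z ^ q)) (ennreal ((2 * t) ^ q))"
          "w' \<notin> maximal_superlevel \<mu> (\<lambda>z. ennreal (g z ^ q)) (ennreal ((2 * t) ^ q))" for z' w'
        using that c Suc.prems(1) by (intro Suc.IH) (auto simp: E_def)
    qed (use Suc.prems in \<open>auto simp: E_def\<close>)
    also have "A n / 2 \<le> A (Suc n)"
    proof -
      have "N / c / 2 ^ Suc n = (N / c / 2 ^ n) / 2"
        by simp
      moreover have "max \<Lambda> b / 2 \<le> max \<Lambda> (b / 2)" for b
        using \<Lambda>(1) by (auto simp: max_def)
      ultimately show ?thesis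
        by (simp only: A_def)
    qed
    then have "A n / 2 * t * dist z w \<le> A (Suc n) * t * dist z w"
      using c Suc.prems(1) by (intro mult_right_mono) auto
    finally show ?case .
  qed
  have "(\<lambda>n. N / c * (1 / 2) ^ n) \<longlonglongrightarrow> N / c * 0"
    by (intro tendsto_mult tendsto_const LIMSEQ_power_zero) auto
  then have "\<forall>\<^sub>F n in sequentially. N / c * (1 / 2) ^ n < \<Lambda>"
    using \<Lambda>(1) by (intro order_tendstoD) auto
  then obtain n where "N / c * (1 / 2) ^ n < \<Lambda>"
    using eventually_happens by fastforce
  then have "A n = \<Lambda>"
    by (simp add: A_def power_one_over)
  then show ?thesis
    using bound[of c x y n] xy by (simp add: E_def)
qed

end

section \<open>Measurability of the lower Lipschitz constant and lower semicontinuous majorants\<close>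

text \<open>
  For fixed \<open>r\<close> the supremum over \<open>ball x r\<close> is lower semicontinuous in \<open>x\<close>. The difference
  quotients at radii \<open>r' \<le> r\<close> differ at most by the factor \<open>r / r'\<close>, so the lower limit may be taken along
  rational radii.
\<close>

lemma lower_lip_borel_measurable:
  fixes f :: "'a::metric_space \<Rightarrow> real"
  assumes f: "continuous_on UNIV f"
  shows "lower_lip f \<in> borel_measurable borel"
proof -
  define F where "F r x = (SUP y\<in>ball x r. ennreal (\<bar>f x - f y\<bar> / r))" for r x
  define Q where "Q n = {r \<in> \<rat>. 0 < r \<and> r < 1 / real (Suc n)}" for n
  have F_meas: "F r \<in> borel_measurable borel" for r
  proof (rule borel_measurableI_greater)
    fix a
    have "{x \<in> space borel. a < F r x} = (\<Union>y. {x. dist x y < r} \<inter> {x. a < ennreal (\<bar>f x - f y\<bar> / r)})"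
      by (auto simp: F_def less_SUP_iff)
    also have "open \<dots>"
    proof (intro open_UN ballI open_Int)
      fix y :: 'a
      show "open {x. dist x y < r}"
        by (intro open_Collect_less continuous_intros)
      have "continuous_on UNIV (\<lambda>x. \<bar>f x - f y\<bar> * inverse r)"
        by (intro continuous_intros f)
      then have "continuous_on UNIV (\<lambda>x. ennreal (\<bar>f x - f y\<bar> / r))"
        unfolding divide_inverse by (rule continuous_on_ennreal)
      then show "open {x. a < ennreal (\<bar>f x - f y\<bar> / r)}"
        by (intro open_Collect_less continuous_on_const)
    qed
    finally show "{x \<in> space borel. a < F r x} \<in> sets borel"
      by (rule borel_open)
  qed
  have F_scale: "F r' x \<le> ennreal (r / r') * F r x" if "0 < r'" "r' \<le> r" for r r' x
    unfolding F_def[of r']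
  proof (rule SUP_least)
    fix y assume y: "y \<in> ball x r'"
    have "ennreal (\<bar>f x - f y\<bar> / r') = ennreal (r / r') * ennreal (\<bar>f x - f y\<bar> / r)"
      using that by (simp add: ennreal_mult[symmetric])
    also have "\<dots> \<le> ennreal (r / r') * F r x"
      unfolding F_def using y that by (intro mult_left_mono SUP_upper) auto
    finally show "ennreal (\<bar>f x - f y\<bar> / r') \<le> ennreal (r / r') * F r x" .
  qed
  have rational: "(INF r\<in>Q n. F r x) \<le> F r x" if r: "0 < r" "r < 1 / real (Suc n)" for n r x
  proof (rule ccontr)
    assume "\<not> (INF r\<in>Q n. F r x) \<le> F r x"
    then obtain b where b: "F r x < b" "b < (INF r\<in>Q n. F r x)"
      using dense by (auto simp: not_le)
    define a where "a = enn2real (F r x)"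
    define c where "c = enn2real b"
    have "b < top" "F r x < top"
      using b less_trans less_top_ennreal top.not_eq_extremum by (metis top_greatest less_le_trans)+
    then have a: "F r x = ennreal a" "0 \<le> a" and c: "b = ennreal c" "a < c"
      using b(1) by (auto simp: a_def c_def ennreal_enn2real_if enn2real_less_iff)
    have "r * a / c < r"
      using r a c by (simp add: pos_divide_less_eq)
    \<comment> \<open>So close to \<open>r\<close> that the factor \<open>r / r'\<close> still leaves \<open>F r' x\<close> below \<open>b\<close>.\<close>
    then obtain r' where r': "r' \<in> \<rat>" "max 0 (r * a / c) < r'" "r' < r"
      using Rats_dense_in_real[of "max 0 (r * a / c)" r] r by auto
    have "F r' x \<le> ennreal (r / r') * ennreal a"
      using F_scale[of r' r x] r' a by simp
    also have "\<dots> = ennreal (r * a / r')"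
      using r r' a by (simp add: ennreal_mult[symmetric])
    also have "\<dots> \<le> b"
      using r' c a by (simp add: c(1) field_simps ennreal_leI)
    finally have "F r' x \<le> b" .
    moreover have "(INF r\<in>Q n. F r x) \<le> F r' x"
      using r r' by (intro INF_lower) (auto simp: Q_def)
    ultimately show False
      using b(2) by simp
  qed
  have "lower_lip f x = (SUP n. INF r\<in>Q n. F r x)" for x
  proof (rule antisym)
    show "lower_lip f x \<le> (SUP n. INF r\<in>Q n. F r x)"
      unfolding lower_lip_def Liminf_def F_def[symmetric]
    proof (rule SUP_least)
      fix P assume "P \<in> {P. eventually P (at_right (0 :: real))}"
      then obtain b where b: "0 < b" "\<And>r. 0 < r \<Longrightarrow> r < b \<Longrightarrow> P r"
        by (auto simp: eventually_at_right_field)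
      obtain n where n: "1 / real (Suc n) < b"
        using b(1) reals_Archimedean[of b] by (auto simp: inverse_eq_divide)
      have "(INF r\<in>Collect P. F r x) \<le> (INF r\<in>Q n. F r x)"
        using b n by (intro INF_superset_mono) (auto simp: Q_def)
      also have "\<dots> \<le> (SUP n. INF r\<in>Q n. F r x)"
        by (rule SUP_upper) simp
      finally show "(INF r\<in>Collect P. F r x) \<le> (SUP n. INF r\<in>Q n. F r x)" .
    qed
    show "(SUP n. INF r\<in>Q n. F r x) \<le> lower_lip f x"
    proof (rule SUP_least)
      fix n
      have "\<forall>\<^sub>F r in at_right 0. 0 < r \<and> r < 1 / real (Suc n)"
        by (auto simp: eventually_at_right_field intro!: exI[of _ "1 / real (Suc n)"])
      then have "\<forall>\<^sub>F r in at_right 0. (INF r\<in>Q n. F r x) \<le> F r x"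
        by eventually_elim (use rational in auto)
      then show "(INF r\<in>Q n. F r x) \<le> lower_lip f x"
        unfolding lower_lip_def F_def[symmetric] by (rule Liminf_bounded)
    qed
  qed
  moreover have "(\<lambda>x. SUP n. INF r\<in>Q n. F r x) \<in> borel_measurable borel"
    using countable_rat F_meas
    by (intro borel_measurable_SUP borel_measurable_INF) (auto simp: Q_def intro: countable_subset[OF _ countable_rat])
  ultimately show ?thesis
    by (simp add: fun_eq_iff[symmetric] cong: measurable_cong)
qed

text \<open>
  A discrete layer-cake formula: \<open>a\<close> is, up to an error \<open>\<epsilon>\<close>, \<open>\<epsilon>\<close> times the number of multiples of \<open>\<epsilon>\<close> below it.
\<close>

lemma layer_count:
  fixes a \<epsilon> :: real
  assumes "0 < \<epsilon>" "0 \<le> a" "a \<le> \<epsilon> * real n"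
  shows "a \<le> \<epsilon> * real (card {k. k < n \<and> \<epsilon> * real k < a})"
    "\<epsilon> * real (card {k. k < n \<and> \<epsilon> * real k < a}) \<le> a + \<epsilon>"
proof -
  define j where "j = nat \<lceil>a / \<epsilon>\<rceil>"
  have "0 \<le> a / \<epsilon>"
    using assms by simp
  then have rj: "real j = \<lceil>a / \<epsilon>\<rceil>"
    by (simp add: j_def)
  have lower: "\<epsilon> * real k < a \<longleftrightarrow> k < j" for k
  proof -
    have "\<epsilon> * real k < a \<longleftrightarrow> real_of_int (int k) < a / \<epsilon>"
      using assms(1) by (simp add: pos_less_divide_eq mult.commute)
    also have "\<dots> \<longleftrightarrow> int k < \<lceil>a / \<epsilon>\<rceil>"
      by (simp only: less_ceiling_iff)
    also have "\<dots> \<longleftrightarrow> k < j"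
      using rj by linarith
    finally show ?thesis .
  qed
  have "j \<le> n"
  proof (rule ccontr)
    assume "\<not> j \<le> n"
    then have "\<epsilon> * real n < a"
      by (simp add: lower)
    with assms(3) show False by simp
  qed
  then have "{k. k < n \<and> \<epsilon> * real k < a} = {..<j}"
    by (auto simp: lower)
  then have card: "card {k. k < n \<and> \<epsilon> * real k < a} = j"
    by simp
  have "a / \<epsilon> \<le> real j" "real j \<le> a / \<epsilon> + 1"
    using rj by linarith+
  then show "a \<le> \<epsilon> * real (card {k. k < n \<and> \<epsilon> * real k < a})"
    "\<epsilon> * real (card {k. k < n \<and> \<epsilon> * real k < a}) \<le> a + \<epsilon>"
    unfolding card using assms(1) by (simp_all add: field_simps)
qed

lemma open_superlevel_sum_indicator:
  fixes \<epsilon> :: real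
  assumes "finite I" "0 \<le> \<epsilon>" "\<And>i. i \<in> I \<Longrightarrow> open (V i)"
  shows "open {z. a < (\<Sum>i\<in>I. \<epsilon> * indicator (V i) z)}"
proof (rule open_subopen[THEN iffD2], intro ballI)
  fix z assume z: "z \<in> {z. a < (\<Sum>i\<in>I. \<epsilon> * indicator (V i) z)}"
  define W where "W = (\<Inter>i\<in>{i\<in>I. z \<in> V i}. V i)"
  have "open W"
    unfolding W_def using assms by (intro open_INT) auto
  moreover have "z \<in> W"
    by (simp add: W_def)
  moreover have "a < (\<Sum>i\<in>I. \<epsilon> * indicator (V i) w)" if "w \<in> W" for w
  proof -
    have "(\<Sum>i\<in>I. \<epsilon> * indicator (V i) z) \<le> (\<Sum>i\<in>I. \<epsilon> * indicator (V i) w)"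
      using that assms(2) by (intro sum_mono mult_left_mono) (auto simp: W_def indicator_def)
    then show ?thesis
      using z by simp
  qed
  ultimately show "\<exists>T. open T \<and> z \<in> T \<and> T \<subseteq> {z. a < (\<Sum>i\<in>I. \<epsilon> * indicator (V i) z)}"
    by (intro exI[of _ W]) auto
qed

context doubling_space
begin

text \<open>
  Outer regularity, which holds for finite Borel measures and is therefore applied to the restriction of
  \<open>\<mu>\<close> to the ball.
\<close>

lemma open_superset_in_ball:
  assumes A: "A \<in> sets borel" and \<eta>: "0 < \<eta>"
  obtains V where "open V" "A \<subseteq> V"
    "measure \<mu> (ball x r \<inter> V) \<le> measure \<mu> (ball x r \<inter> A) + \<eta>"
proof -
  define \<nu> where "\<nu> = density \<mu> (indicator (ball x r))"
  have \<nu>: "emeasure \<nu> S = emeasure \<mu> (ball x r \<inter> S)" if "S \<in> sets borel" for S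
    unfolding \<nu>_def using that by (intro emeasure_restricted) auto
  have fin: "emeasure \<mu> (ball x r \<inter> S) = ennreal (measure \<mu> (ball x r \<inter> S))" if "S \<in> sets borel" for S
  proof (rule emeasure_eq_ennreal_measure)
    have "emeasure \<mu> (ball x r \<inter> S) \<le> emeasure \<mu> (ball x r)"
      by (intro emeasure_mono) auto
    then show "emeasure \<mu> (ball x r \<inter> S) \<noteq> top"
      using emeasure_ball_finite[of x r] by (auto simp: top_unique)
  qed
  have "emeasure \<nu> A = (INF U\<in>{U. A \<subseteq> U \<and> open U}. emeasure \<nu> U)"
  proof (rule outer_regular)
    show "sets \<nu> = sets borel" by (simp add: \<nu>_def)
    have "space \<nu> = UNIV" by (simp add: \<nu>_def)
    then show "emeasure \<nu> (space \<nu>) \<noteq> \<infinity>"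
      using \<nu>[of UNIV] emeasure_ball_finite[of x r] by simp
  qed (rule A)
  moreover have "emeasure \<nu> A < emeasure \<nu> A + ennreal \<eta>"
    using \<nu>[OF A] fin[OF A] \<eta>
    by (auto simp: ennreal_plus[symmetric] simp del: ennreal_plus intro!: ennreal_lessI add_nonneg_pos)
  ultimately obtain V where V: "A \<subseteq> V" "open V" "emeasure \<nu> V < emeasure \<nu> A + ennreal \<eta>"
    by (auto simp: INF_less_iff)
  then have "measure \<mu> (ball x r \<inter> V) \<le> measure \<mu> (ball x r \<inter> A) + \<eta>"
    using \<nu>[OF A] \<nu>[of V] fin[OF A] fin[of V] \<eta>
    by (simp add: ennreal_plus[symmetric] ennreal_less_iff del: ennreal_plus)
  then show thesis
    using V that by blast
qed

text \<open>
  The Vitali-Caratheodory theorem for bounded functions: replace the superlevel sets in the layer-cake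
  formula by slightly larger open sets. One half of \<open>\<delta>\<close> pays for the discretisation and the other for
  the enlargement.
\<close>

lemma lower_semicontinuous_majorant:
  fixes g :: "'a \<Rightarrow> real"
  assumes g: "g \<in> borel_measurable borel" "\<And>z. 0 \<le> g z" "\<And>z. g z \<le> M"
    and r: "0 < r" and \<delta>: "0 < \<delta>"
  obtains g' where "\<And>a. open {z. a < g' z}" "\<And>z. g z \<le> g' z"
    "(\<integral>\<^sup>+z\<in>ball x r. ennreal (g' z) \<partial>\<mu>) \<le> (\<integral>\<^sup>+z\<in>ball x r. ennreal (g z) \<partial>\<mu>) + ennreal \<delta>"
proof -
  define U where "U = ball x r"
  define m where "m = measure \<mu> U"
  have m: "0 < m" "emeasure \<mu> U = ennreal m"
    using measure_ball_pos[OF r] emeasure_ball by (auto simp: m_def U_def)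
  have fin: "emeasure \<mu> (U \<inter> S) = ennreal (measure \<mu> (U \<inter> S))" if "S \<in> sets borel" for S
  proof (rule emeasure_eq_ennreal_measure)
    have "emeasure \<mu> (U \<inter> S) \<le> emeasure \<mu> U"
      by (intro emeasure_mono) (auto simp: U_def)
    then show "emeasure \<mu> (U \<inter> S) \<noteq> top"
      using m(2) by (auto simp: top_unique)
  qed
  define \<epsilon> where "\<epsilon> = \<delta> / (2 * m)"
  have \<epsilon>: "0 < \<epsilon>" "\<epsilon> * m = \<delta> / 2"
    using \<delta> m by (auto simp: \<epsilon>_def)
  obtain n where "max 0 (M / \<epsilon>) < real n"
    using reals_Archimedean2 by blast
  then have n: "M / \<epsilon> < real n" "0 < n"
    by auto
  have M: "g z \<le> \<epsilon> * real n" for z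
    using g(3)[of z] n(1) \<epsilon>(1) by (simp add: field_simps)
  define A where "A k = {z. \<epsilon> * real k < g z}" for k
  define \<eta> where "\<eta> = \<delta> / (2 * \<epsilon> * real n)"
  have \<eta>: "0 < \<eta>" "real n * (\<epsilon> * \<eta>) = \<delta> / 2"
    using \<delta> \<epsilon>(1) n(2) by (auto simp: \<eta>_def)
  have A_borel: "A k \<in> sets borel" for k
    unfolding A_def using g(1) by measurable
  have "\<exists>V. open V \<and> A k \<subseteq> V \<and> measure \<mu> (U \<inter> V) \<le> measure \<mu> (U \<inter> A k) + \<eta>" for k
    using open_superset_in_ball[OF A_borel \<eta>(1)] unfolding U_def by metis
  then obtain V where V: "\<And>k. open (V k)" "\<And>k. A k \<subseteq> V k"
    "\<And>k. measure \<mu> (U \<inter> V k) \<le> measure \<mu> (U \<inter> A k) + \<eta>"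
    by metis
  define g' where "g' z = (\<Sum>k<n. \<epsilon> * indicator (V k) z)" for z
  have sum_A: "(\<Sum>k<n. \<epsilon> * indicator (A k) z) = \<epsilon> * real (card {k. k < n \<and> \<epsilon> * real k < g z})" for z
  proof -
    have "(\<Sum>k<n. \<epsilon> * indicator (A k) z) = \<epsilon> * (\<Sum>k<n. if \<epsilon> * real k < g z then 1 else 0)"
      unfolding sum_distrib_left by (intro sum.cong) (auto simp: A_def indicator_def)
    also have "(\<Sum>k<n. if \<epsilon> * real k < g z then 1 else 0) = real (card ({..<n} \<inter> {k. \<epsilon> * real k < g z}))"
      by (simp add: sum.If_cases)
    also have "{..<n} \<inter> {k. \<epsilon> * real k < g z} = {k. k < n \<and> \<epsilon> * real k < g z}"
      by auto
    finally show ?thesis .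
  qed
  have count: "g z \<le> (\<Sum>k<n. \<epsilon> * indicator (A k) z)" "(\<Sum>k<n. \<epsilon> * indicator (A k) z) \<le> g z + \<epsilon>" for z
    using layer_count[OF \<epsilon>(1) g(2)[of z] M] unfolding sum_A by auto
  have "g z \<le> g' z" for z
  proof -
    have "(\<Sum>k<n. \<epsilon> * indicator (A k) z) \<le> g' z"
      unfolding g'_def using \<epsilon>(1) V(2) by (intro sum_mono mult_left_mono) (auto simp: indicator_def)
    then show ?thesis using count(1)[of z] by linarith
  qed
  moreover have "open {z. a < g' z}" for a
    unfolding g'_def using \<epsilon>(1) V(1) by (intro open_superlevel_sum_indicator) auto
  moreover have "(\<integral>\<^sup>+z\<in>U. ennreal (g' z) \<partial>\<mu>) \<le> (\<integral>\<^sup>+z\<in>U. ennreal (g z) \<partial>\<mu>) + ennreal \<delta>"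
  proof -
    have sum_int: "(\<integral>\<^sup>+z\<in>U. ennreal (\<Sum>k<n. \<epsilon> * indicator (S k) z) \<partial>\<mu>)
        = ennreal (\<Sum>k<n. \<epsilon> * measure \<mu> (U \<inter> S k))" if S: "\<And>k. S k \<in> sets borel" for S
    proof -
      have "(\<integral>\<^sup>+z\<in>U. ennreal (\<Sum>k<n. \<epsilon> * indicator (S k) z) \<partial>\<mu>)
          = (\<integral>\<^sup>+z. (\<Sum>k<n. ennreal \<epsilon> * indicator (U \<inter> S k) z) \<partial>\<mu>)"
      proof (intro nn_integral_cong)
        fix z
        have "ennreal (\<Sum>k<n. \<epsilon> * indicator (S k) z) = (\<Sum>k<n. ennreal (\<epsilon> * indicator (S k) z))"
          using \<epsilon>(1) by (intro sum_ennreal[symmetric]) auto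
        then show "ennreal (\<Sum>k<n. \<epsilon> * indicator (S k) z) * indicator U z
            = (\<Sum>k<n. ennreal \<epsilon> * indicator (U \<inter> S k) z)"
        proof (cases "z \<in> U")
          case True
          have "ennreal (\<epsilon> * indicator (S k) z) = ennreal \<epsilon> * indicator (U \<inter> S k) z" for k
            using True by (simp split: split_indicator)
          then show ?thesis
            using True \<open>ennreal (\<Sum>k<n. \<epsilon> * indicator (S k) z) = _\<close> by simp
        qed simp
      qed
      also have "\<dots> = (\<Sum>k<n. \<integral>\<^sup>+z. ennreal \<epsilon> * indicator (U \<inter> S k) z \<partial>\<mu>)"
        using S by (intro nn_integral_sum) (auto simp: U_def)
      also have "\<dots> = (\<Sum>k<n. ennreal (\<epsilon> * measure \<mu> (U \<inter> S k)))"
        using S \<epsilon>(1) fin[OF S] by (intro sum.cong) (auto simp: nn_integral_cmult_indicator U_def ennreal_mult)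
      also have "\<dots> = ennreal (\<Sum>k<n. \<epsilon> * measure \<mu> (U \<inter> S k))"
        using \<epsilon>(1) by (intro sum_ennreal) auto
      finally show ?thesis .
    qed
    have "(\<integral>\<^sup>+z\<in>U. ennreal (g' z) \<partial>\<mu>) = ennreal (\<Sum>k<n. \<epsilon> * measure \<mu> (U \<inter> V k))"
      unfolding g'_def using V(1) by (intro sum_int) auto
    also have "\<dots> \<le> ennreal ((\<Sum>k<n. \<epsilon> * measure \<mu> (U \<inter> A k)) + \<delta> / 2)"
    proof (rule ennreal_leI)
      have "(\<Sum>k<n. \<epsilon> * measure \<mu> (U \<inter> V k)) \<le> (\<Sum>k<n. \<epsilon> * (measure \<mu> (U \<inter> A k) + \<eta>))"
        using \<epsilon>(1) V(3) by (intro sum_mono mult_left_mono) auto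
      also have "\<dots> = (\<Sum>k<n. \<epsilon> * measure \<mu> (U \<inter> A k)) + real n * (\<epsilon> * \<eta>)"
        by (simp add: distrib_left sum.distrib)
      finally show "(\<Sum>k<n. \<epsilon> * measure \<mu> (U \<inter> V k)) \<le> (\<Sum>k<n. \<epsilon> * measure \<mu> (U \<inter> A k)) + \<delta> / 2"
        using \<eta>(2) by simp
    qed
    also have "\<dots> = (\<integral>\<^sup>+z\<in>U. ennreal (\<Sum>k<n. \<epsilon> * indicator (A k) z) \<partial>\<mu>) + ennreal (\<delta> / 2)"
      using sum_int[OF A_borel] \<epsilon>(1) \<delta> by (simp add: sum_nonneg)
    also have "\<dots> \<le> (\<integral>\<^sup>+z\<in>U. ennreal (g z + \<epsilon>) \<partial>\<mu>) + ennreal (\<delta> / 2)"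
      using count(2) by (intro add_right_mono nn_integral_mono mult_right_mono ennreal_leI) auto
    also have "(\<integral>\<^sup>+z\<in>U. ennreal (g z + \<epsilon>) \<partial>\<mu>)
        = (\<integral>\<^sup>+z. ennreal (g z) * indicator U z + ennreal \<epsilon> * indicator U z \<partial>\<mu>)"
      using g(2) \<epsilon>(1) by (intro nn_integral_cong) (auto split: split_indicator)
    also have "\<dots> = (\<integral>\<^sup>+z\<in>U. ennreal (g z) \<partial>\<mu>) + ennreal \<epsilon> * emeasure \<mu> U"
      using g(1) by (subst nn_integral_add) (auto simp: nn_integral_cmult_indicator U_def)
    also have "ennreal \<epsilon> * emeasure \<mu> U = ennreal (\<delta> / 2)"
    proof -
      have "ennreal \<epsilon> * emeasure \<mu> U = ennreal (\<epsilon> * m)"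
        using \<epsilon>(1) m by (simp add: ennreal_mult[symmetric])
      then show ?thesis
        by (simp only: \<epsilon>(2))
    qed
    also have "(\<integral>\<^sup>+z\<in>U. ennreal (g z) \<partial>\<mu>) + ennreal (\<delta> / 2) + ennreal (\<delta> / 2)
        = (\<integral>\<^sup>+z\<in>U. ennreal (g z) \<partial>\<mu>) + ennreal \<delta>"
      using \<delta> by (simp add: add.assoc ennreal_plus[symmetric] del: ennreal_plus)
    finally show ?thesis .
  qed
  ultimately show thesis
    using that[of g'] unfolding U_def by blast
qed

lemma mean_oscillation_le_twice:
  assumes v: "set_integrable \<mu> (ball x r) v" and vm: "v \<in> borel_measurable borel" and r: "0 < r" and K: "0 \<le> K"
    and le: "(\<integral>\<^sup>+y\<in>ball x r. ennreal \<bar>v y - m\<bar> \<partial>\<mu>) \<le> ennreal K * emeasure \<mu> (ball x r)"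
  shows "mean_oscillation \<mu> (ball x r) v \<le> ennreal (2 * K)"
  unfolding mean_oscillation_def nn_average_ball_le_iff[OF r]
proof -
  define a where "a = average \<mu> (ball x r) v"
  have a: "\<bar>m - a\<bar> \<le> K"
    using average_ball_diff_le[OF v r K le] by (simp add: a_def abs_minus_commute)
  have "(\<integral>\<^sup>+y\<in>ball x r. ennreal \<bar>v y - a\<bar> \<partial>\<mu>)
      \<le> (\<integral>\<^sup>+y. ennreal \<bar>v y - m\<bar> * indicator (ball x r) y + ennreal K * indicator (ball x r) y \<partial>\<mu>)"
  proof (intro nn_integral_mono)
    fix y
    have "\<bar>v y - a\<bar> \<le> \<bar>v y - m\<bar> + K"
      using a by linarith
    then show "ennreal \<bar>v y - a\<bar> * indicator (ball x r) y
        \<le> ennreal \<bar>v y - m\<bar> * indicator (ball x r) y + ennreal K * indicator (ball x r) y"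
      using K by (auto simp: ennreal_plus[symmetric] ennreal_leI simp del: ennreal_plus split: split_indicator)
  qed
  also have "\<dots> = (\<integral>\<^sup>+y\<in>ball x r. ennreal \<bar>v y - m\<bar> \<partial>\<mu>) + ennreal K * emeasure \<mu> (ball x r)"
    using vm by (subst nn_integral_add) (auto simp: nn_integral_cmult_indicator)
  also have "\<dots> \<le> ennreal K * emeasure \<mu> (ball x r) + ennreal K * emeasure \<mu> (ball x r)"
    using le by (rule add_right_mono)
  also have "\<dots> = ennreal (2 * K) * emeasure \<mu> (ball x r)"
    using K by (simp add: distrib_right[symmetric] ennreal_plus[symmetric] del: ennreal_plus)
  finally show "(\<integral>\<^sup>+y\<in>ball x r. ennreal \<bar>v y - average \<mu> (ball x r) v\<bar> \<partial>\<mu>)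
      \<le> ennreal (2 * K) * emeasure \<mu> (ball x r)"
    by (simp add: a_def)
qed

end

section \<open>The pointwise estimate on a ball\<close>

context doubling_space
begin

text \<open>
  \<open>(g + t) ^ q \<le> 2 ^ q * (g ^ q + t ^ q)\<close>, so the means of the truncated function are at most
  \<open>2 ^ q * (2 * t ^ q) \<le> (4 * t) ^ q\<close>.
\<close>

lemma not_in_maximal_superlevel_truncated:
  fixes g :: "'a \<Rightarrow> real"
  assumes g: "\<And>z. 0 \<le> g z" "g \<in> borel_measurable borel" and U: "U \<in> sets borel" and t: "0 < t" and q: "0 < q"
    and x: "x \<notin> maximal_superlevel \<mu> (\<lambda>z. ennreal (g z ^ q) * indicator U z) (ennreal (t ^ q))"
  shows "x \<notin> maximal_superlevel \<mu> (\<lambda>z. ennreal ((if z \<in> U then g z + t else 0) ^ q)) (ennreal ((4 * t) ^ q))"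
proof
  define g' where "g' z = (if z \<in> U then g z + t else 0)" for z
  assume "x \<in> maximal_superlevel \<mu> (\<lambda>z. ennreal ((if z \<in> U then g z + t else 0) ^ q)) (ennreal ((4 * t) ^ q))"
  then obtain p s where ps: "x \<in> ball p s" "0 < s"
    "ennreal ((4 * t) ^ q) * emeasure \<mu> (ball p s) < (\<integral>\<^sup>+y\<in>ball p s. ennreal (g' y ^ q) \<partial>\<mu>)"
    unfolding g'_def[symmetric] by (rule maximal_superlevelE)
  define B where "B = ball p s"
  have pointwise: "g' y ^ q \<le> 2 ^ q * (g y ^ q * indicator U y + t ^ q)" for y
  proof (cases "y \<in> U")
    case True
    have "(g y + t) ^ q \<le> (2 * max (g y) t) ^ q"
      using g(1)[of y] t by (intro power_mono) auto
    also have "\<dots> = 2 ^ q * max (g y) t ^ q"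
      by (rule power_mult_distrib)
    also have "\<dots> \<le> 2 ^ q * (g y ^ q + t ^ q)"
      using g(1)[of y] t by (intro mult_left_mono) (auto simp: max_def)
    finally show ?thesis
      using True by (simp add: g'_def)
  next
    case False
    then show ?thesis
      using t q by (simp add: g'_def zero_power)
  qed
  have "(\<integral>\<^sup>+y\<in>B. ennreal (g' y ^ q) \<partial>\<mu>)
      \<le> (\<integral>\<^sup>+y. ennreal (2 ^ q) * (ennreal (g y ^ q) * indicator U y * indicator B y + ennreal (t ^ q) * indicator B y) \<partial>\<mu>)"
  proof (intro nn_integral_mono)
    fix y
    have "ennreal (g' y ^ q) \<le> ennreal (2 ^ q * (g y ^ q * indicator U y + t ^ q))"
      by (rule ennreal_leI[OF pointwise])
    also have "\<dots> = ennreal (2 ^ q) * (ennreal (g y ^ q) * indicator U y + ennreal (t ^ q))"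
      using g(1)[of y] t by (auto simp: ennreal_mult split: split_indicator)
    finally show "ennreal (g' y ^ q) * indicator B y
        \<le> ennreal (2 ^ q) * (ennreal (g y ^ q) * indicator U y * indicator B y + ennreal (t ^ q) * indicator B y)"
      by (auto split: split_indicator)
  qed
  also have "\<dots> = ennreal (2 ^ q) * ((\<integral>\<^sup>+y\<in>B. ennreal (g y ^ q) * indicator U y \<partial>\<mu>) + ennreal (t ^ q) * emeasure \<mu> B)"
    using g(2) U
    by (subst nn_integral_cmult) (auto simp: nn_integral_add nn_integral_cmult_indicator B_def)
  also have "\<dots> \<le> ennreal (2 ^ q) * (ennreal (t ^ q) * emeasure \<mu> B + ennreal (t ^ q) * emeasure \<mu> B)"
    using integral_le_outside_maximal_superlevel[OF x ps(1)]
    by (intro mult_left_mono add_right_mono) (auto simp: B_def)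
  also have "\<dots> = ennreal (2 ^ q * (2 * t ^ q)) * emeasure \<mu> B"
    using t by (simp add: distrib_right[symmetric] ennreal_plus[symmetric] ennreal_mult mult.assoc del: ennreal_plus)
  also have "\<dots> \<le> ennreal ((4 * t) ^ q) * emeasure \<mu> B"
  proof (intro mult_right_mono ennreal_leI)
    have "(2 :: real) \<le> 2 ^ q"
      using q self_le_power[of "2 :: real" q] by simp
    then have "2 ^ q * (2 * t ^ q) \<le> 2 ^ q * (2 ^ q * t ^ q)"
      using t by (intro mult_left_mono mult_right_mono) auto
    also have "\<dots> = (2 * (2 * t)) ^ q"
      by (simp only: power_mult_distrib)
    also have "2 * (2 * t) = 4 * t"
      by simp
    finally show "2 ^ q * (2 * t ^ q) \<le> (4 * t) ^ q" .
  qed simp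
  finally show False
    using ps(3) by (simp add: B_def)
qed

end

context orlicz_poincare_space
begin

text \<open>
  To see only the values of \<open>g\<close> in the ball \<open>U\<close>, apply the global estimate to a function \<open>\<phi>\<close> that is
  constant outside \<open>U\<close>. It is the maximum of \<open>f\<close>, cut off to the interval from \<open>f x\<close> to \<open>f x + b\<close>,
  and of a cone that takes the value \<open>f x + b\<close> at the boundary of \<open>U\<close> and descends into \<open>U\<close> with slope \<open>t\<close>.
  As \<open>b\<close> is chosen at most \<open>8 * \<Lambda> * t * r\<close>, the cone is at most \<open>f x\<close> on \<open>ball x\<^sub>0 r\<close>.
  The global estimate then shows \<open>b < 8 * \<Lambda> * t * r\<close>, which is only possible if \<open>b = f y - f x\<close>.
\<close>

lemma local_hajlasz_estimate_aux:
  fixes f g :: "'a \<Rightarrow> real" and x\<^sub>0 :: 'a and r :: real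
  assumes f: "N-lipschitz_on UNIV f"
    and g: "\<And>z. 0 \<le> g z" "\<And>a. open {z. a < g z}" "variation_dominated f g"
    and \<Lambda>: "1 \<le> \<Lambda>" "32 * D ^ 2 * \<kappa> \<le> \<Lambda>"
    and q: "0 < q" "D \<le> 2 ^ q" "\<Phi> \<Lambda> * D ^ 4 \<le> 2 ^ q"
    and t: "0 < t"
  defines "U \<equiv> ball x\<^sub>0 ((1 + 8 * \<Lambda>) * r)"
  assumes xy: "x \<in> ball x\<^sub>0 r" "y \<in> ball x\<^sub>0 r"
    and good: "x \<notin> maximal_superlevel \<mu> (\<lambda>z. ennreal (g z ^ q) * indicator U z) (ennreal (t ^ q))"
      "y \<notin> maximal_superlevel \<mu> (\<lambda>z. ennreal (g z ^ q) * indicator U z) (ennreal (t ^ q))"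
  shows "f y - f x \<le> 8 * \<Lambda> * t * r"
proof (cases "f y \<le> f x")
  case True
  have "0 \<le> r"
    using xy(1) zero_le_dist[of x\<^sub>0 x] unfolding mem_ball by linarith
  then have "0 \<le> 8 * \<Lambda> * t * r"
    using \<Lambda>(1) t by simp
  with True show ?thesis by linarith
next
  case False
  define R where "R = (1 + 8 * \<Lambda>) * r"
  define b where "b = min (f y - f x) (8 * \<Lambda> * t * r)"
  define P where "P z = min (max (f z) (f x)) (f x + b)" for z
  define S where "S z = f x + b - t * max 0 (R - dist x\<^sub>0 z)" for z
  define \<phi> where "\<phi> z = max (P z) (S z)" for z
  define g' where "g' z = (if z \<in> U then g z + t else 0)" for z
  have r: "0 < r"
    using xy(1) zero_le_dist[of x\<^sub>0 x] unfolding mem_ball by linarith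
  then have b: "0 < b"
    using False \<Lambda>(1) t by (simp add: b_def)
  have N: "0 \<le> N"
    using f by (rule lipschitz_on_nonneg)
  have f_borel: "f \<in> borel_measurable borel"
    using f by (rule lipschitz_borel_measurable)
  have g_borel: "g \<in> borel_measurable borel"
    using g(2) by (rule lsc_borel_measurable)
  have S: "t-lipschitz_on UNIV S"
  proof (rule lipschitz_onI)
    fix z w
    have "\<bar>max 0 (R - dist x\<^sub>0 z) - max 0 (R - dist x\<^sub>0 w)\<bar> \<le> dist z w"
      using dist_triangle[of x\<^sub>0 z w] dist_triangle[of x\<^sub>0 w z] by (auto simp: dist_commute max_def)
    then have "t * \<bar>max 0 (R - dist x\<^sub>0 z) - max 0 (R - dist x\<^sub>0 w)\<bar> \<le> t * dist z w"
      using t by (intro mult_left_mono) auto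
    moreover have "\<bar>S z - S w\<bar> = t * \<bar>max 0 (R - dist x\<^sub>0 z) - max 0 (R - dist x\<^sub>0 w)\<bar>"
      using t abs_mult[of t "max 0 (R - dist x\<^sub>0 z) - max 0 (R - dist x\<^sub>0 w)"]
      by (simp add: S_def right_diff_distrib abs_minus_commute)
    ultimately show "dist (S z) (S w) \<le> t * dist z w"
      by (simp add: dist_real_def)
  qed (use t in simp)
  have \<phi>: "(N + t)-lipschitz_on UNIV \<phi>"
  proof (rule lipschitz_onI)
    fix z w
    have "\<bar>P z - P w\<bar> \<le> \<bar>f z - f w\<bar>"
      by (auto simp: P_def min_def max_def)
    moreover have "\<bar>f z - f w\<bar> \<le> N * dist z w"
      using lipschitz_onD[OF f, of z w] by (simp add: dist_real_def)
    moreover have "\<bar>S z - S w\<bar> \<le> t * dist z w"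
      using lipschitz_onD[OF S, of z w] by (simp add: dist_real_def)
    moreover have "\<bar>\<phi> z - \<phi> w\<bar> \<le> max \<bar>P z - P w\<bar> \<bar>S z - S w\<bar>"
      by (auto simp: \<phi>_def max_def)
    moreover have "0 \<le> N * dist z w" "0 \<le> t * dist z w"
      using N t by auto
    ultimately show "dist (\<phi> z) (\<phi> w) \<le> (N + t) * dist z w"
      by (auto simp: dist_real_def distrib_right)
  qed (use N t in simp)
  have \<phi>_dom: "variation_dominated \<phi> (\<lambda>z. g z + t)"
    unfolding \<phi>_def
  proof (rule variation_dominated_max)
    show "variation_dominated P g"
      unfolding P_def by (rule variation_dominated_clamp[OF f_borel g_borel g(1,3)])
    show "variation_dominated S (\<lambda>_. t)"
      by (rule variation_dominated_lipschitz[OF S])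
    show "P \<in> borel_measurable borel"
      unfolding P_def using f_borel by measurable
    show "S \<in> borel_measurable borel"
      by (rule lipschitz_borel_measurable[OF S])
  qed (use g(1) t g_borel in auto)
  have outside: "\<phi> z = f x + b" if "z \<notin> U" for z
    using that b by (auto simp: \<phi>_def S_def P_def U_def R_def max_def min_def)
  have g'_dom: "variation_dominated \<phi> g'"
    unfolding g'_def
    by (rule variation_dominated_cases[OF \<phi>_dom variation_dominated_const[of "f x + b"]])
      (use outside g_borel in \<open>auto simp: U_def\<close>)
  have g'_nonneg: "0 \<le> g' z" for z
    using g(1)[of z] t by (simp add: g'_def)
  have g'_lsc: "open {z. a < g' z}" for a
  proof (cases "a < 0")
    case True
    then have "{z. a < g' z} = UNIV"
      using g'_nonneg by (auto intro: less_le_trans)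
    then show ?thesis by simp
  next
    case False
    then have "{z. a < g' z} = U \<inter> {z. a - t < g z}"
      by (auto simp: g'_def)
    then show ?thesis
      using g(2)[of "a - t"] by (auto simp: U_def intro: open_Int)
  qed
  have "\<bar>\<phi> x - \<phi> y\<bar> \<le> \<Lambda> * (4 * t) * dist x y"
  proof (rule hajlasz_estimate[OF \<phi> g'_nonneg g'_lsc g'_dom \<Lambda> q])
    have "U \<in> sets borel" by (simp add: U_def)
    then show "x \<notin> maximal_superlevel \<mu> (\<lambda>z. ennreal (g' z ^ q)) (ennreal ((4 * t) ^ q))"
      "y \<notin> maximal_superlevel \<mu> (\<lambda>z. ennreal (g' z ^ q)) (ennreal ((4 * t) ^ q))"
      unfolding g'_def
      using not_in_maximal_superlevel_truncated[OF g(1) g_borel _ t q(1)] good by blast+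
  qed (use t in simp)
  also have "\<dots> < \<Lambda> * (4 * t) * (2 * r)"
    using xy dist_triangle3[of x y x\<^sub>0] \<Lambda>(1) t by (intro mult_strict_left_mono) auto
  finally have small: "\<bar>\<phi> x - \<phi> y\<bar> < 8 * \<Lambda> * t * r"
    by (simp add: ac_simps)
  have deep: "S z \<le> f x" if "z \<in> ball x\<^sub>0 r" for z
  proof -
    have "8 * \<Lambda> * r \<le> max 0 (R - dist x\<^sub>0 z)"
      using that by (auto simp: R_def distrib_right)
    then have "t * (8 * \<Lambda> * r) \<le> t * max 0 (R - dist x\<^sub>0 z)"
      using t by (intro mult_left_mono) auto
    moreover have "b \<le> t * (8 * \<Lambda> * r)"
      by (simp add: b_def ac_simps)
    ultimately show ?thesis
      by (simp add: S_def)
  qed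
  have "\<phi> x = f x"
    using deep[OF xy(1)] b by (simp add: \<phi>_def P_def)
  moreover have "\<phi> y = f x + b"
    using deep[OF xy(2)] b False by (auto simp: \<phi>_def P_def b_def min_def max_def)
  ultimately have "b < 8 * \<Lambda> * t * r"
    using small b by simp
  then show ?thesis
    by (simp add: b_def)
qed

lemma local_hajlasz_estimate:
  fixes f g :: "'a \<Rightarrow> real" and x\<^sub>0 :: 'a and r :: real
  assumes "N-lipschitz_on UNIV f"
    and "\<And>z. 0 \<le> g z" "\<And>a. open {z. a < g z}" "variation_dominated f g"
    and "1 \<le> \<Lambda>" "32 * D ^ 2 * \<kappa> \<le> \<Lambda>"
    and "0 < q" "D \<le> 2 ^ q" "\<Phi> \<Lambda> * D ^ 4 \<le> 2 ^ q"
    and "0 < t"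
  defines "U \<equiv> ball x\<^sub>0 ((1 + 8 * \<Lambda>) * r)"
  defines "Z \<equiv> maximal_superlevel \<mu> (\<lambda>z. ennreal (g z ^ q) * indicator U z) (ennreal (t ^ q))"
  assumes "x \<in> ball x\<^sub>0 r - Z" "y \<in> ball x\<^sub>0 r - Z"
  shows "\<bar>f x - f y\<bar> \<le> 8 * \<Lambda> * t * r"
  using local_hajlasz_estimate_aux[OF assms(1-10), of x x\<^sub>0 r y]
    local_hajlasz_estimate_aux[OF assms(1-10), of y x\<^sub>0 r x] assms(13,14)
  unfolding U_def Z_def by (auto simp: abs_le_iff)

end

section \<open>From the pointwise estimate to the Poincare inequality\<close>

context orlicz_poincare_space
begin

text \<open>
  Fix a point \<open>y\<close> of the ball off the exceptional set \<open>Z k\<^sub>0\<close> of level \<open>2 ^ k\<^sub>0 * T\<close>. On the part of the ball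
  where the maximal function lies between the levels \<open>k\<close> and \<open>k + 1\<close> the local estimate bounds \<open>\<bar>f x - f y\<bar>\<close> by a multiple of
  \<open>2 ^ k\<close>, while the weak type inequality bounds the measure of that part by a multiple of
  \<open>2 ^ (- q * k) \<le> 4 ^ (- k)\<close>. The sum over \<open>k\<close> converges because \<open>q \<ge> 2\<close>.
\<close>

lemma mean_oscillation_le_majorant:
  fixes f g :: "'a \<Rightarrow> real" and x\<^sub>0 :: 'a and r :: real
  assumes f: "N-lipschitz_on UNIV f"
    and g: "\<And>z. 0 \<le> g z" "\<And>a. open {z. a < g z}" "variation_dominated f g"
    and \<Lambda>: "1 \<le> \<Lambda>" "32 * D ^ 2 * \<kappa> \<le> \<Lambda>"
    and q: "2 \<le> q" "D \<le> 2 ^ q" "\<Phi> \<Lambda> * D ^ 4 \<le> 2 ^ q"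
    and r: "0 < r" and T: "0 < T"
  defines "U \<equiv> ball x\<^sub>0 ((1 + 8 * \<Lambda>) * r)"
  assumes g_int: "(\<integral>\<^sup>+z\<in>U. ennreal (g z ^ q) \<partial>\<mu>) \<le> ennreal (T ^ q) * emeasure \<mu> U"
    and m: "1 + 8 * \<Lambda> \<le> 2 ^ m" and k\<^sub>0: "D ^ (m + 2) < 2 ^ k\<^sub>0"
  shows "mean_oscillation \<mu> (ball x\<^sub>0 r) f \<le> ennreal (2 * (8 * \<Lambda> * T * r * (2 ^ k\<^sub>0 + 4 * D ^ (m + 2))))"
proof -
  \<comment> \<open>Two factors \<open>D\<close> come from the weak type inequality and \<open>m\<close> from comparing \<open>U\<close> with the given ball.\<close>
  define W where "W = D ^ (m + 2)"
  define B where "B = ball x\<^sub>0 r"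
  define b where "b = measure \<mu> B"
  define h where "h z = ennreal (g z ^ q) * indicator U z" for z
  define Z where "Z k = maximal_superlevel \<mu> h (ennreal ((2 ^ k * T) ^ q))" for k :: nat
  define K where "K = 8 * \<Lambda> * T * r"
  have K: "0 < K"
    using \<Lambda> T r by (simp add: K_def)
  have W: "1 \<le> W"
    unfolding W_def using D_ge_1 by (rule one_le_power)
  have b: "0 < b" "emeasure \<mu> B = ennreal b"
    using measure_ball_pos[OF r] emeasure_ball by (auto simp: b_def B_def)
  have g_borel: "g \<in> borel_measurable borel"
    using g(2) by (rule lsc_borel_measurable)
  have h_borel: "h \<in> borel_measurable borel"
    unfolding h_def U_def using g_borel by measurable
  have Z_borel: "Z k \<in> sets borel" for k
    by (simp add: Z_def open_maximal_superlevel)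
  have Z_anti: "Z k' \<subseteq> Z k" if "k \<le> k'" for k k'
    unfolding Z_def using that T
    by (intro maximal_superlevel_antimono ennreal_leI power_mono mult_right_mono power_increasing) auto
  have ZB: "emeasure \<mu> (B \<inter> Z k) = ennreal (measure \<mu> (B \<inter> Z k))" for k
  proof (rule emeasure_eq_ennreal_measure)
    have "emeasure \<mu> (B \<inter> Z k) \<le> emeasure \<mu> B"
      by (intro emeasure_mono) (auto simp: B_def)
    then show "emeasure \<mu> (B \<inter> Z k) \<noteq> top"
      using b(2) by (auto simp: top_unique)
  qed
  have Z_small: "4 ^ k * measure \<mu> (B \<inter> Z k) \<le> W * b" for k
  proof -
    have "ennreal ((2 ^ k * T) ^ q) * emeasure \<mu> (B \<inter> Z k) \<le> ennreal ((2 ^ k * T) ^ q) * emeasure \<mu> (Z k)"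
      using Z_borel by (intro mult_left_mono emeasure_mono) auto
    also have "\<dots> \<le> ennreal D ^ 2 * (\<integral>\<^sup>+z. h z \<partial>\<mu>)"
      unfolding Z_def by (rule weak_type_maximal[OF h_borel])
    also have "\<dots> \<le> ennreal D ^ 2 * (ennreal (T ^ q) * emeasure \<mu> U)"
      using g_int by (intro mult_left_mono) (auto simp: h_def)
    also have "\<dots> \<le> ennreal D ^ 2 * (ennreal (T ^ q) * (ennreal D ^ m * emeasure \<mu> B))"
    proof (intro mult_left_mono)
      have "(1 + 8 * \<Lambda>) * r \<le> 2 ^ m * r"
        using m r by (intro mult_right_mono) auto
      then have "emeasure \<mu> U \<le> emeasure \<mu> (ball x\<^sub>0 (2 ^ m * r))"
        unfolding U_def by (intro emeasure_mono subset_ball) auto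
      also have "\<dots> \<le> ennreal D ^ m * emeasure \<mu> B"
        unfolding B_def by (rule emeasure_ball_power_le[OF r])
      finally show "emeasure \<mu> U \<le> ennreal D ^ m * emeasure \<mu> B" .
    qed auto
    also have "\<dots> = ennreal (T ^ q * (W * b))"
      using D_ge_1 T b by (simp add: W_def ennreal_power ennreal_mult[symmetric] power_add power2_eq_square ac_simps)
    finally have "(2 ^ k * T) ^ q * measure \<mu> (B \<inter> Z k) \<le> T ^ q * (W * b)"
      using T W b by (simp add: ZB ennreal_mult[symmetric])
    then have "T ^ q * ((2 ^ k) ^ q * measure \<mu> (B \<inter> Z k)) \<le> T ^ q * (W * b)"
      by (simp add: power_mult_distrib ac_simps)
    then have "(2 ^ k) ^ q * measure \<mu> (B \<inter> Z k) \<le> W * b"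
      using T by simp
    moreover have "(4 :: real) ^ k \<le> (2 ^ k) ^ q"
    proof -
      have "(4 :: real) ^ k = (2 ^ k) ^ 2"
        by (simp add: power_mult[symmetric] mult.commute[of k] power_mult)
      also have "\<dots> \<le> (2 ^ k) ^ q"
        using q(1) by (intro power_increasing) auto
      finally show ?thesis .
    qed
    then have "4 ^ k * measure \<mu> (B \<inter> Z k) \<le> (2 ^ k) ^ q * measure \<mu> (B \<inter> Z k)"
      by (rule mult_right_mono) simp
    ultimately show ?thesis by linarith
  qed
  have "\<exists>y. y \<in> B - Z k\<^sub>0"
  proof (rule ccontr)
    assume "\<nexists>y. y \<in> B - Z k\<^sub>0"
    then have "B \<inter> Z k\<^sub>0 = B" by auto
    then have "4 ^ k\<^sub>0 * b \<le> W * b"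
      using Z_small[of k\<^sub>0] by (simp add: b_def)
    then have "4 ^ k\<^sub>0 \<le> W"
      using b by simp
    moreover have "(2 :: real) ^ k\<^sub>0 \<le> 4 ^ k\<^sub>0"
      by (intro power_mono) auto
    ultimately show False
      using k\<^sub>0 by (simp add: W_def)
  qed
  then obtain y where y: "y \<in> B - Z k\<^sub>0" by blast
  have est: "\<bar>f x - f y\<bar> \<le> K * 2 ^ k" if "x \<in> B - Z k" "k\<^sub>0 \<le> k" for x k
  proof -
    have "y \<in> B - Z k"
      using y Z_anti[OF that(2)] by blast
    then have "\<bar>f x - f y\<bar> \<le> 8 * \<Lambda> * (2 ^ k * T) * r"
      using that(1) T q unfolding B_def Z_def h_def U_def
      by (intro local_hajlasz_estimate[OF f g \<Lambda> _ q(2,3)]) auto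
    then show ?thesis
      by (simp add: K_def ac_simps)
  qed
  have pointwise: "ennreal \<bar>f x - f y\<bar> \<le> ennreal (K * 2 ^ k\<^sub>0)
      + (\<Sum>j. ennreal (K * 2 ^ (k\<^sub>0 + j + 1)) * indicator (Z (k\<^sub>0 + j)) x)" if x: "x \<in> B" for x
  proof (cases "x \<in> Z k\<^sub>0")
    case False
    then have "ennreal \<bar>f x - f y\<bar> \<le> ennreal (K * 2 ^ k\<^sub>0)"
      using est[of x k\<^sub>0] x by (intro ennreal_leI) auto
    then show ?thesis
      by (simp add: add_increasing2)
  next
    case True
    have "\<exists>j. x \<in> Z (k\<^sub>0 + j) \<and> \<bar>f x - f y\<bar> \<le> K * 2 ^ (k\<^sub>0 + j + 1)"
    proof (cases "\<forall>j. x \<in> Z (k\<^sub>0 + j)")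
      \<comment> \<open>On this null set the series diverges; a single late term is already large enough.\<close>
      case True
      obtain j where "\<bar>f x - f y\<bar> / K < 2 ^ j"
        using real_arch_pow[of 2 "\<bar>f x - f y\<bar> / K"] by auto
      moreover have "(2 :: real) ^ j \<le> 2 ^ (k\<^sub>0 + j + 1)"
        by (intro power_increasing) auto
      ultimately have "\<bar>f x - f y\<bar> / K \<le> 2 ^ (k\<^sub>0 + j + 1)"
        by linarith
      then have "\<bar>f x - f y\<bar> \<le> K * 2 ^ (k\<^sub>0 + j + 1)"
        using K by (simp only: pos_divide_le_eq mult.commute)
      with True show ?thesis by blast
    next
      case False
      define i where "i = (LEAST i. x \<notin> Z (k\<^sub>0 + i))"
      have i: "x \<notin> Z (k\<^sub>0 + i)"
        unfolding i_def using False by (metis LeastI)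
      then obtain j where j: "i = Suc j"
        using \<open>x \<in> Z k\<^sub>0\<close> by (cases i) auto
      then have "x \<in> Z (k\<^sub>0 + j)"
        using not_less_Least[of j "\<lambda>i. x \<notin> Z (k\<^sub>0 + i)"] by (auto simp: i_def)
      moreover have "\<bar>f x - f y\<bar> \<le> K * 2 ^ (k\<^sub>0 + j + 1)"
        using est[of x "k\<^sub>0 + i"] i x j by auto
      ultimately show ?thesis by blast
    qed
    then obtain j where j: "x \<in> Z (k\<^sub>0 + j)" "\<bar>f x - f y\<bar> \<le> K * 2 ^ (k\<^sub>0 + j + 1)"
      by blast
    define a where "a j = ennreal (K * 2 ^ (k\<^sub>0 + j + 1)) * indicator (Z (k\<^sub>0 + j)) x" for j
    have "ennreal \<bar>f x - f y\<bar> \<le> sum a {j}"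
      using j by (simp add: a_def ennreal_leI)
    also have "\<dots> \<le> suminf a"
      by (rule sum_le_suminf) auto
    finally show ?thesis
      unfolding a_def by (rule add_increasing[rotated]) simp
  qed
  have "(\<integral>\<^sup>+x\<in>B. ennreal \<bar>f x - f y\<bar> \<partial>\<mu>)
      \<le> (\<integral>\<^sup>+x. ennreal (K * 2 ^ k\<^sub>0) * indicator B x
          + (\<Sum>j. ennreal (K * 2 ^ (k\<^sub>0 + j + 1)) * indicator (B \<inter> Z (k\<^sub>0 + j)) x) \<partial>\<mu>)"
  proof (intro nn_integral_mono)
    fix x
    show "ennreal \<bar>f x - f y\<bar> * indicator B x \<le> ennreal (K * 2 ^ k\<^sub>0) * indicator B x
          + (\<Sum>j. ennreal (K * 2 ^ (k\<^sub>0 + j + 1)) * indicator (B \<inter> Z (k\<^sub>0 + j)) x)"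
    proof (cases "x \<in> B")
      case True
      then have "indicator (B \<inter> Z k) x = (indicator (Z k) x :: ennreal)" for k
        by (simp split: split_indicator)
      then show ?thesis
        using pointwise[OF True] True by simp
    qed simp
  qed
  also have "\<dots> = ennreal (K * 2 ^ k\<^sub>0) * emeasure \<mu> B
      + (\<Sum>j. ennreal (K * 2 ^ (k\<^sub>0 + j + 1)) * emeasure \<mu> (B \<inter> Z (k\<^sub>0 + j)))"
  proof -
    have "(\<lambda>x. \<Sum>j. ennreal (K * 2 ^ (k\<^sub>0 + j + 1)) * indicator (B \<inter> Z (k\<^sub>0 + j)) x) \<in> borel_measurable \<mu>"
      using Z_borel by (intro borel_measurable_suminf_order) (auto simp: B_def)
    moreover have "(\<integral>\<^sup>+x. (\<Sum>j. ennreal (K * 2 ^ (k\<^sub>0 + j + 1)) * indicator (B \<inter> Z (k\<^sub>0 + j)) x) \<partial>\<mu>)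
        = (\<Sum>j. ennreal (K * 2 ^ (k\<^sub>0 + j + 1)) * emeasure \<mu> (B \<inter> Z (k\<^sub>0 + j)))"
      using Z_borel by (subst nn_integral_suminf) (auto simp: nn_integral_cmult_indicator B_def)
    ultimately show ?thesis
      by (subst nn_integral_add) (auto simp: nn_integral_cmult_indicator B_def)
  qed
  also have "(\<Sum>j. ennreal (K * 2 ^ (k\<^sub>0 + j + 1)) * emeasure \<mu> (B \<inter> Z (k\<^sub>0 + j)))
      \<le> (\<Sum>j. ennreal (2 * K * W * b * (1 / 2) ^ j))"
  proof (intro suminf_le summableI)
    fix j
    have "2 ^ (k\<^sub>0 + j) * measure \<mu> (B \<inter> Z (k\<^sub>0 + j)) \<le> W * b * (1 / 2) ^ (k\<^sub>0 + j)"
      using Z_small[of "k\<^sub>0 + j"] power_mult_distrib[of "2 :: real" 2 "k\<^sub>0 + j"]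
      by (simp add: power_one_over field_simps)
    also have "\<dots> \<le> W * b * (1 / 2) ^ j"
      using W b by (intro mult_left_mono power_decreasing) auto
    finally have "2 * K * (2 ^ (k\<^sub>0 + j) * measure \<mu> (B \<inter> Z (k\<^sub>0 + j))) \<le> 2 * K * (W * b * (1 / 2) ^ j)"
      using K by (intro mult_left_mono) auto
    then show "ennreal (K * 2 ^ (k\<^sub>0 + j + 1)) * emeasure \<mu> (B \<inter> Z (k\<^sub>0 + j)) \<le> ennreal (2 * K * W * b * (1 / 2) ^ j)"
      using K by (simp add: ZB ennreal_mult[symmetric] ac_simps ennreal_leI)
  qed
  also have "(\<Sum>j. ennreal (2 * K * W * b * (1 / 2) ^ j)) = ennreal (2 * K * W * b * 2)"
  proof -
    have "(\<lambda>j. (1 / 2 :: real) ^ j) sums 2"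
      using geometric_sums[of "1 / 2 :: real"] by simp
    then have "(\<lambda>j. 2 * K * W * b * (1 / 2) ^ j) sums (2 * K * W * b * 2)"
      by (rule sums_mult)
    then show ?thesis
      using K W b by (intro suminf_ennreal_eq) auto
  qed
  also have "ennreal (K * 2 ^ k\<^sub>0) * emeasure \<mu> B + ennreal (2 * K * W * b * 2)
      = ennreal (K * (2 ^ k\<^sub>0 + 4 * W)) * emeasure \<mu> B"
    using K W b by (simp add: ennreal_mult[symmetric] ennreal_plus[symmetric] algebra_simps del: ennreal_plus)
  finally have "mean_oscillation \<mu> (ball x\<^sub>0 r) f \<le> ennreal (2 * (K * (2 ^ k\<^sub>0 + 4 * W)))"
    using K W lipschitz_borel_measurable[OF f]
    by (intro mean_oscillation_le_twice[OF set_integrable_ball_lipschitz[OF f]] r) (auto simp: B_def add_left_mono)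
  then show ?thesis
    by (simp add: K_def W_def)
qed

text \<open>
  Apply the preceding estimate to lower semicontinuous majorants of \<open>lower_lip f\<close> whose \<open>q\<close>-th powers
  have means arbitrarily close to that of \<open>(lower_lip f) ^ q\<close>. The mean \<open>H\<close> of the majorant is kept
  positive, so the case that \<open>lower_lip f\<close> vanishes almost everywhere is included.
\<close>

lemma mean_oscillation_le_lower_lip:
  fixes f :: "'a \<Rightarrow> real" and x\<^sub>0 :: 'a and r :: real
  assumes f: "N-lipschitz_on UNIV f"
    and \<Lambda>: "1 \<le> \<Lambda>" "32 * D ^ 2 * \<kappa> \<le> \<Lambda>"
    and q: "2 \<le> q" "D \<le> 2 ^ q" "\<Phi> \<Lambda> * D ^ 4 \<le> 2 ^ q"
    and r: "0 < r" and m: "1 + 8 * \<Lambda> \<le> 2 ^ m" and k\<^sub>0: "D ^ (m + 2) < 2 ^ k\<^sub>0"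
  shows "mean_oscillation \<mu> (ball x\<^sub>0 r) f
    \<le> ennreal (16 * \<Lambda> * (2 ^ k\<^sub>0 + 4 * D ^ (m + 2)) * r) *
       extend_infty (\<lambda>t. t powr (1 / real q))
         (nn_average \<mu> (ball x\<^sub>0 ((1 + 8 * \<Lambda>) * r)) (\<lambda>y. extend_infty (\<lambda>t. t powr real q) (lower_lip f y)))"
proof -
  define R where "R = (1 + 8 * \<Lambda>) * r"
  define U where "U = ball x\<^sub>0 R"
  have R: "0 < R"
    using \<Lambda>(1) r by (simp add: R_def)
  define u where "u = measure \<mu> U"
  have u: "0 < u" "emeasure \<mu> U = ennreal u"
    using measure_ball_pos[OF R] emeasure_ball by (auto simp: u_def U_def)
  define g\<^sub>0 where "g\<^sub>0 z = enn2real (lower_lip f z)" for z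
  have g\<^sub>0: "lower_lip f z = ennreal (g\<^sub>0 z)" "0 \<le> g\<^sub>0 z" "g\<^sub>0 z \<le> N" for z
  proof -
    have le: "lower_lip f z \<le> ennreal N"
      using f by (rule lower_lip_le_lipschitz_constant)
    show eq: "lower_lip f z = ennreal (g\<^sub>0 z)"
      using le by (auto simp: g\<^sub>0_def ennreal_enn2real_if top_unique)
    show "0 \<le> g\<^sub>0 z"
      by (simp add: g\<^sub>0_def)
    show "g\<^sub>0 z \<le> N"
      using le ennreal_le_iff[OF lipschitz_on_nonneg[OF f]] by (simp only: eq)
  qed
  have "g\<^sub>0 \<in> borel_measurable borel"
    unfolding g\<^sub>0_def using lower_lip_borel_measurable[OF lipschitz_on_continuous_on[OF f]] by measurable
  then have pow_borel: "(\<lambda>z. g\<^sub>0 z ^ q) \<in> borel_measurable borel"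
    by measurable
  have pow_le: "g\<^sub>0 z ^ q \<le> N ^ q" for z
    using g\<^sub>0 by (intro power_mono) auto
  have N: "0 \<le> N ^ q"
    using lipschitz_on_nonneg[OF f] by simp
  have pow_eq: "extend_infty (\<lambda>t. t powr real q) (lower_lip f z) = ennreal (g\<^sub>0 z ^ q)" for z
    using g\<^sub>0(2)[of z] q(1) by (cases "g\<^sub>0 z = 0") (auto simp: g\<^sub>0(1) extend_infty_def powr_realpow zero_power)
  define I where "I = nn_average \<mu> U (\<lambda>z. ennreal (g\<^sub>0 z ^ q))"
  have "(\<integral>\<^sup>+z\<in>U. ennreal (g\<^sub>0 z ^ q) \<partial>\<mu>) \<le> (\<integral>\<^sup>+z. ennreal (N ^ q) * indicator U z \<partial>\<mu>)"
    using pow_le by (intro nn_integral_mono mult_right_mono ennreal_leI) auto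
  also have "\<dots> = ennreal (N ^ q) * emeasure \<mu> U"
    by (simp add: nn_integral_cmult_indicator U_def)
  finally have "I \<le> ennreal (N ^ q)"
    unfolding I_def U_def nn_average_ball_le_iff[OF R] .
  define i where "i = enn2real I"
  have i: "I = ennreal i" "0 \<le> i"
    using \<open>I \<le> ennreal (N ^ q)\<close> by (auto simp: i_def ennreal_enn2real_if top_unique)
  have I_int: "(\<integral>\<^sup>+z\<in>U. ennreal (g\<^sub>0 z ^ q) \<partial>\<mu>) \<le> ennreal i * emeasure \<mu> U"
    using nn_average_ball_le_iff[OF R, of x\<^sub>0 "\<lambda>z. ennreal (g\<^sub>0 z ^ q)" "ennreal i"] i by (simp add: I_def U_def)
  define K where "K = 16 * \<Lambda> * (2 ^ k\<^sub>0 + 4 * D ^ (m + 2)) * r"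
  have K: "0 \<le> K"
    using \<Lambda>(1) D_ge_1 r by (simp add: K_def)
  have q0: "0 < q"
    using q(1) by simp
  have bound: "mean_oscillation \<mu> (ball x\<^sub>0 r) f \<le> ennreal (K * root q (i + 1 / real (Suc n)))" for n
  proof -
    \<comment> \<open>The mean of \<open>(lower_lip f) ^ q\<close> is \<open>i\<close>.\<close>
    define H where "H = i + 1 / real (Suc n)"
    have H: "0 < H"
      using i by (simp add: H_def add_nonneg_pos)
    obtain g\<^sub>1 where g\<^sub>1: "\<And>a. open {z. a < g\<^sub>1 z}" "\<And>z. g\<^sub>0 z ^ q \<le> g\<^sub>1 z"
      "(\<integral>\<^sup>+z\<in>U. ennreal (g\<^sub>1 z) \<partial>\<mu>) \<le> (\<integral>\<^sup>+z\<in>U. ennreal (g\<^sub>0 z ^ q) \<partial>\<mu>) + ennreal (u / real (Suc n))"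
      using lower_semicontinuous_majorant[OF pow_borel _ pow_le R, of "u / real (Suc n)" x\<^sub>0] g\<^sub>0(2) u(1)
      unfolding U_def by auto
    have g\<^sub>1_nonneg: "0 \<le> g\<^sub>1 z" for z
      using g\<^sub>1(2)[of z] g\<^sub>0(2)[of z] by (meson order_trans zero_le_power)
    define g where "g z = root q (g\<^sub>1 z)" for z
    have g_pow: "g z ^ q = g\<^sub>1 z" for z
      using g\<^sub>1_nonneg q0 by (simp add: g_def)
    have g_nonneg: "0 \<le> g z" for z
      using g\<^sub>1_nonneg q0 by (simp add: g_def)
    have g_ge: "g\<^sub>0 z \<le> g z" for z
    proof -
      have "root q (g\<^sub>0 z ^ q) \<le> root q (g\<^sub>1 z)"
        using q0 g\<^sub>1(2) by simp
      then show ?thesis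
        using q0 g\<^sub>0(2) by (simp add: g_def real_root_power_cancel)
    qed
    have g_lsc: "open {z. a < g z}" for a
    proof (cases "a < 0")
      case True
      then have "{z. a < g z} = UNIV"
        using g_nonneg by (auto intro: less_le_trans)
      then show ?thesis by simp
    next
      case False
      have "a < g z \<longleftrightarrow> a ^ q < g\<^sub>1 z" for z
        using False g_nonneg[of z] q0 unfolding g_pow[symmetric] by (auto intro: power_strict_mono power_less_imp_less_base)
      then show ?thesis
        using g\<^sub>1(1) by simp
    qed
    have g_dom: "variation_dominated f g"
      using g_nonneg g_ge by (intro variation_dominated_lower_lip[OF f] lsc_borel_measurable g_lsc)
        (auto simp: g\<^sub>0(1) ennreal_leI)
    have "(\<integral>\<^sup>+z\<in>U. ennreal (g z ^ q) \<partial>\<mu>) \<le> ennreal i * emeasure \<mu> U + ennreal (u / real (Suc n))"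
      unfolding g_pow using g\<^sub>1(3) I_int by (meson add_right_mono order_trans)
    also have "\<dots> = ennreal (H * u)"
      using i u by (simp add: H_def ennreal_mult[symmetric] ennreal_plus[symmetric] distrib_right del: ennreal_plus)
    also have "\<dots> = ennreal (root q H ^ q) * emeasure \<mu> U"
      using H u q0 by (simp add: ennreal_mult)
    finally have g_int: "(\<integral>\<^sup>+z\<in>U. ennreal (g z ^ q) \<partial>\<mu>) \<le> ennreal (root q H ^ q) * emeasure \<mu> U" .
    have "mean_oscillation \<mu> (ball x\<^sub>0 r) f \<le> ennreal (2 * (8 * \<Lambda> * root q H * r * (2 ^ k\<^sub>0 + 4 * D ^ (m + 2))))"
      using H q0 g_int unfolding U_def R_def
      by (intro mean_oscillation_le_majorant[OF f g_nonneg g_lsc g_dom \<Lambda> q r _ _ m k\<^sub>0]) auto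
    also have "2 * (8 * \<Lambda> * root q H * r * (2 ^ k\<^sub>0 + 4 * D ^ (m + 2))) = K * root q H"
      unfolding K_def by (simp add: algebra_simps)
    finally show ?thesis
      by (simp add: H_def)
  qed
  have "(\<lambda>n. ennreal (K * root q (i + 1 / real (Suc n)))) \<longlonglongrightarrow> ennreal (K * root q (i + 0))"
    by (intro tendsto_ennrealI tendsto_mult tendsto_const tendsto_real_root tendsto_add
        LIMSEQ_Suc[OF lim_const_over_n])
  then have "mean_oscillation \<mu> (ball x\<^sub>0 r) f \<le> ennreal (K * root q (i + 0))"
    using bound by (intro LIMSEQ_le_const) auto
  also have "\<dots> = ennreal K * extend_infty (\<lambda>t. t powr (1 / real q)) I"
    using K i q0 by (cases "i = 0") (auto simp: extend_infty_def ennreal_mult root_powr_inverse inverse_eq_divide)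
  finally show ?thesis
    by (simp add: pow_eq I_def U_def R_def K_def)
qed

lemma ex_poincare: "\<exists>q::real. 1 \<le> q \<and> poincare \<mu> q"
proof -
  define \<Lambda> where "\<Lambda> = max 1 (32 * D ^ 2 * \<kappa>)"
  have \<Lambda>: "1 \<le> \<Lambda>" "32 * D ^ 2 * \<kappa> \<le> \<Lambda>"
    by (auto simp: \<Lambda>_def)
  \<comment> \<open>The exponent makes the superlevel sets of the maximal function sparse enough for \<open>\<Phi> \<Lambda>\<close>; the
    summand \<open>2\<close> ensures that the sum over the levels converges.\<close>
  obtain q\<^sub>0 where q\<^sub>0: "max D (\<Phi> \<Lambda> * D ^ 4) < 2 ^ q\<^sub>0"
    using real_arch_pow[of 2 "max D (\<Phi> \<Lambda> * D ^ 4)"] by auto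
  define q where "q = q\<^sub>0 + 2"
  have q_mono: "(2 :: real) ^ q\<^sub>0 \<le> 2 ^ q"
    unfolding q_def by (intro power_increasing) auto
  have "D < 2 ^ q\<^sub>0" "\<Phi> \<Lambda> * D ^ 4 < 2 ^ q\<^sub>0"
    using q\<^sub>0 by auto
  then have q: "D \<le> 2 ^ q" "\<Phi> \<Lambda> * D ^ 4 \<le> 2 ^ q"
    using q_mono by linarith+
  have q2: "2 \<le> q"
    by (simp add: q_def)
  obtain m where m: "1 + 8 * \<Lambda> < 2 ^ m"
    using real_arch_pow[of 2 "1 + 8 * \<Lambda>"] by auto
  obtain k\<^sub>0 where k\<^sub>0: "D ^ (m + 2) < 2 ^ k\<^sub>0"
    using real_arch_pow[of 2] by auto
  define C' where "C' = 16 * \<Lambda> * (2 ^ k\<^sub>0 + 4 * D ^ (m + 2))"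
  have "0 < C'"
    using \<Lambda>(1) D_ge_1 by (simp add: C'_def add_pos_nonneg)
  have radius_pos: "0 < 1 + 8 * \<Lambda>"
    using \<Lambda>(1) by simp
  have "poincare \<mu> (real q)"
    unfolding poincare_def
  proof (rule exI[of _ "1 + 8 * \<Lambda>"], rule conjI, rule radius_pos, rule exI[of _ C'], intro conjI allI impI)
    fix x :: 'a and r :: real and f :: "'a \<Rightarrow> real"
    assume r: "0 < r" and "\<exists>N. N-lipschitz_on UNIV f"
    then obtain N where "N-lipschitz_on UNIV f" by blast
    then show "mean_oscillation \<mu> (ball x r) f \<le> ennreal (C' * r) *
       extend_infty (\<lambda>t. t powr (1 / real q))
         (nn_average \<mu> (ball x ((1 + 8 * \<Lambda>) * r)) (\<lambda>y. extend_infty (\<lambda>t. t powr real q) (lower_lip f y)))"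
      unfolding C'_def using m by (intro mean_oscillation_le_lower_lip \<Lambda> q2 q r k\<^sub>0) auto
  qed (rule \<open>0 < C'\<close>)
  then show ?thesis
    using q2 by (intro exI[of _ "real q"]) auto
qed

end

theorem theorem1p5:
  fixes \<mu> :: "'a::polish_space measure" and \<Phi> :: "real \<Rightarrow> real"
  assumes "metric_measure_space \<mu>"
    and "doubling \<mu>"
    and "strict_young_function \<Phi>"
    and "strong_orlicz_poincare \<mu> \<Phi>"
  shows "\<exists>q::real. 1 \<le> q \<and> poincare \<mu> q"
proof -
  obtain D where D: "\<And>x r. 0 < r \<Longrightarrow> emeasure \<mu> (ball x (2 * r)) \<le> ennreal D * emeasure \<mu> (ball x r)"
    using assms(2) unfolding doubling_def by blast
  have D': "emeasure \<mu> (ball x (2 * r)) \<le> ennreal (max 1 D) * emeasure \<mu> (ball x r)" if "0 < r" for x r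
  proof -
    have "ennreal D * emeasure \<mu> (ball x r) \<le> ennreal (max 1 D) * emeasure \<mu> (ball x r)"
      by (intro mult_right_mono ennreal_leI) auto
    then show ?thesis
      using D[OF that, of x] by (rule order_trans[rotated])
  qed
  obtain C \<tau> where C: "0 < C" "1 \<le> \<tau>"
    "\<And>x r u g. 0 < r \<Longrightarrow> locally_integrable \<mu> u \<Longrightarrow> upper_gradient u g \<Longrightarrow>
        mean_oscillation \<mu> (ball x r) u
          \<le> ennreal (C * r) * extend_infty (the_inv_into {0..} \<Phi>)
               (nn_average \<mu> (ball x (\<tau> * r)) (\<lambda>y. extend_infty \<Phi> (g y)))"
    using assms(4) unfolding strong_orlicz_poincare_def by blast
  interpret orlicz_poincare_space \<mu> "max 1 D" \<Phi> C \<tau>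
    using assms(1,3) D' C by unfold_locales auto
  show ?thesis
    by (rule ex_poincare)
qed

end
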